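(* For each positive integer $p$, suppose that $(X_p,Y_p)\sim\mathcal N_{2p}(\mu_p,\Sigma_p)$, where $X_p,Y_p\in\mathbb{R}^p$ and $$\Sigma_p=\begin{pmatrix}\Sigma_{X,p}&\Sigma_{XY,p}\\ \Sigma_{YX,p}&\Sigma_{Y,p}\end{pmatrix}$$ with $\Sigma_{X,p}\in\mathbb{R}^{p\times p}$ and $\Sigma_{Y,p}\in\mathbb{R}^{p\times p}$ positive definite and such that $$\Lambda_p=\Sigma_{Y,p}^{-1/2}\,\Sigma_{YX,p}\,\Sigma_{X,p}^{-1}\,\Sigma_{XY,p}\,\Sigma_{Y,p}^{-1/2}\ne0 .$$ Then $$\lim_{p\to\infty}\frac{p}{\operatorname{tr}(\Lambda_p)}\,\widetilde{\mathcal V}^2(X_p,Y_p)=\frac12$$ and $$\lim_{p\to\infty}\frac{p}{\operatorname{tr}(\Lambda_p)}\,\widetilde{\mathcal R}^2(X_p,Y_p)=1 .$$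
   Context: $|\cdot|_p$ and $\langle\cdot,\cdot\rangle_p$ denote the Euclidean norm and scalar product on $\mathbb{R}^p$; $c_p=\pi^{(p+1)/2}/\Gamma((p+1)/2)$. For jointly distributed random vectors $X\in\mathbb{R}^p$, $Y\in\mathbb{R}^q$ let $f_{X,Y}(s,t)=\mathbb{E}\exp[\mathrm{i}\langle s,X\rangle_p+\mathrm{i}\langle t,Y\rangle_q]$, $f_X(s)=f_{X,Y}(s,0)$, $f_Y(t)=f_{X,Y}(0,t)$. The distance covariance $\mathcal V(X,Y)\ge0$ is defined by $$\mathcal V^2(X,Y)=\frac{1}{c_pc_q}\int_{\mathbb{R}^{p+q}}\frac{|f_{X,Y}(s,t)-f_X(s)f_Y(t)|^2}{|s|_p^{p+1}|t|_q^{q+1}}\,ds\,dt .$$ For $X,Y$ with finite second moments and nonsingular covariance matrices $\Sigma_X,\Sigma_Y$, the affinely invariant distance covariance $\widetilde{\mathcal V}(X,Y)\ge0$ is defined by $\widetilde{\mathcal V}^2(X,Y)=\mathcal V^2(\Sigma_X^{-1/2}X,\Sigma_Y^{-1/2}Y)$ (and $\widetilde{\mathcal V}(X,X)$, $\widetilde{\mathcal V}(Y,Y)$ are obtained by taking both arguments to be the same random vector). The affinely invariant distance correlation is $$\widetilde{\mathcal R}(X,Y)=\frac{\widetilde{\mathcal V}(X,Y)}{\sqrt{\widetilde{\mathcal V}(X,X)\,\widetilde{\mathcal V}(Y,Y)}}$$ if both factors in the denominator are strictly positive, and $0$ otherwise; $\widetilde{\mathcal R}^2$ is its square. $\mathcal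 N_{m}(\mu,\Sigma)$ is the multivariate normal distribution with mean $\mu\in\mathbb{R}^{m}$ and covariance matrix $\Sigma$ (possibly singular); $\Sigma_{YX,p}=\Sigma_{XY,p}'$, where $'$ denotes transpose. *)

theory Defs
  imports "HOL-Probability.Probability" "Jordan_Normal_Form.Gauss_Jordan_Elimination"
begin

unbundle no inner_syntax and no vec_syntax

hide_const (open) Finite_Cartesian_Product.vec
hide_type (open) Finite_Cartesian_Product.vec

(* The dimension p varies inside the limit, so R^p is carrier_vec p and p x p matrices are
   carrier_mat p p, rather than a type-indexed space. *)

definition vnorm :: "real vec \<Rightarrow> real" where
  "vnorm v = sqrt (v \<bullet> v)"

definition mat_tr :: "real mat \<Rightarrow> real" where
  "mat_tr A = (\<Sum>i<dim_row A. A $$ (i, i))"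

definition pos_semidef :: "nat \<Rightarrow> real mat \<Rightarrow> bool" where
  "pos_semidef n A \<longleftrightarrow> A \<in> carrier_mat n n \<and> transpose_mat A = A \<and>
     (\<forall>v \<in> carrier_vec n. 0 \<le> v \<bullet> (A *\<^sub>v v))"

definition pos_def :: "nat \<Rightarrow> real mat \<Rightarrow> bool" where
  "pos_def n A \<longleftrightarrow> A \<in> carrier_mat n n \<and> transpose_mat A = A \<and>
     (\<forall>v \<in> carrier_vec n. v \<noteq> 0\<^sub>v n \<longrightarrow> 0 < v \<bullet> (A *\<^sub>v v))"

(* Meaningful for nonsingular A only. *)
definition mat_inv :: "real mat \<Rightarrow> real mat" where
  "mat_inv A = the (mat_inverse A)"

(* The unique positive semidefinite square root of a positive semidefinite matrix. *)
definition mat_sqrt :: "real mat \<Rightarrow> real mat" where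
  "mat_sqrt A = (THE B. pos_semidef (dim_row A) B \<and> B * B = A)"

definition mat_inv_sqrt :: "real mat \<Rightarrow> real mat" where
  "mat_inv_sqrt A = mat_inv (mat_sqrt A)"

definition random_vec :: "'a measure \<Rightarrow> nat \<Rightarrow> ('a \<Rightarrow> real vec) \<Rightarrow> bool" where
  "random_vec M n X \<longleftrightarrow> (\<forall>\<omega> \<in> space M. X \<omega> \<in> carrier_vec n) \<and>
     (\<forall>i<n. (\<lambda>\<omega>. X \<omega> $ i) \<in> borel_measurable M)"

definition cov_mat :: "'a measure \<Rightarrow> nat \<Rightarrow> ('a \<Rightarrow> real vec) \<Rightarrow> real mat" where
  "cov_mat M n X = mat n n (\<lambda>(i, j).
     LINT \<omega>|M. (X \<omega> $ i - (LINT \<omega>'|M. X \<omega>' $ i)) * (X \<omega> $ j - (LINT \<omega>'|M. X \<omega>' $ j)))"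

(* The univariate law N(m, v), parametrised by its variance v \<ge> 0; a point mass if v = 0. *)
definition normal_law :: "real \<Rightarrow> real \<Rightarrow> real measure" where
  "normal_law m v =
     (if v = 0 then return borel m else density lborel (normal_density m (sqrt v)))"

(* X ~ N_n(mu, S), with S possibly singular: every linear combination <a, X> has the univariate
   normal law N(<a, mu>, <a, S a>). This determines the law of X (Cramer-Wold). *)
definition mv_normal ::
  "'a measure \<Rightarrow> nat \<Rightarrow> ('a \<Rightarrow> real vec) \<Rightarrow> real vec \<Rightarrow> real mat \<Rightarrow> bool" where
  "mv_normal M n X \<mu> S \<longleftrightarrow> random_vec M n X \<and> \<mu> \<in> carrier_vec n \<and> pos_semidef n S \<and>
     (\<forall>a \<in> carrier_vec n.
        distr M borel (\<lambda>\<omega>. a \<bullet> X \<omega>) = normal_law (a \<bullet> \<mu>) (a \<bullet> (S *\<^sub>v a)))"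

definition joint_char ::
  "'a measure \<Rightarrow> ('a \<Rightarrow> real vec) \<Rightarrow> ('a \<Rightarrow> real vec) \<Rightarrow> real vec \<Rightarrow> real vec \<Rightarrow> complex" where
  "joint_char M X Y s t =
     (LINT \<omega>|M. exp (\<i> * complex_of_real (s \<bullet> X \<omega>) + \<i> * complex_of_real (t \<bullet> Y \<omega>)))"

definition dcov_const :: "nat \<Rightarrow> real" where
  "dcov_const p = pi powr ((real p + 1) / 2) / Gamma ((real p + 1) / 2)"

(* Lebesgue measure on R^(p+q) is the product measure of p + q copies of lborel; vec p turns the
   coordinate functions into vectors. The integrand is nonnegative, and integrable whenever X and Y
   have finite first moments, so the Bochner integral is the intended one there. On the null set
   where s = 0 or t = 0 the quotient has the value 0. *)
definition dcov ::
  "'a measure \<Rightarrow> nat \<Rightarrow> nat \<Rightarrow> ('a \<Rightarrow> real vec) \<Rightarrow> ('a \<Rightarrow> real vec) \<Rightarrow> real" where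
  "dcov M p q X Y = sqrt (1 / (dcov_const p * dcov_const q) *
     (LINT (x, y)|(PiM {..<p} (\<lambda>_. lborel) \<Otimes>\<^sub>M PiM {..<q} (\<lambda>_. lborel)).
        (let s = vec p x; t = vec q y in
          (cmod (joint_char M X Y s t
                 - joint_char M X Y s (0\<^sub>v q) * joint_char M X Y (0\<^sub>v p) t))\<^sup>2
          / (vnorm s ^ (p + 1) * vnorm t ^ (q + 1)))))"

definition aff_dcov ::
  "'a measure \<Rightarrow> nat \<Rightarrow> nat \<Rightarrow> ('a \<Rightarrow> real vec) \<Rightarrow> ('a \<Rightarrow> real vec) \<Rightarrow> real" where
  "aff_dcov M p q X Y = dcov M p q
     (\<lambda>\<omega>. mat_inv_sqrt (cov_mat M p X) *\<^sub>v X \<omega>)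
     (\<lambda>\<omega>. mat_inv_sqrt (cov_mat M q Y) *\<^sub>v Y \<omega>)"

definition aff_dcor ::
  "'a measure \<Rightarrow> nat \<Rightarrow> nat \<Rightarrow> ('a \<Rightarrow> real vec) \<Rightarrow> ('a \<Rightarrow> real vec) \<Rightarrow> real" where
  "aff_dcor M p q X Y =
     (if aff_dcov M p p X X > 0 \<and> aff_dcov M q q Y Y > 0
      then aff_dcov M p q X Y / sqrt (aff_dcov M p p X X * aff_dcov M q q Y Y)
      else 0)"

(* Arguments: the blocks S_X, S_XY, S_Y of the joint covariance matrix. *)
definition Lambda_mat :: "real mat \<Rightarrow> real mat \<Rightarrow> real mat \<Rightarrow> real mat" where
  "Lambda_mat SX SXY SY =
     mat_inv_sqrt SY * transpose_mat SXY * mat_inv SX * SXY * mat_inv_sqrt SY"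

end

theory Submission
  imports Defs "Jordan_Normal_Form.Determinant" "HOL-Real_Asymp.Real_Asymp"
begin

text \<open>
Write \<open>W\<^sub>X\<close>, \<open>W\<^sub>Y\<close> for the inverse square roots of the covariance matrices, and let
\<open>A = W\<^sub>X \<Sigma>\<^sub>X\<^sub>Y W\<^sub>Y\<close> be the cross covariance of the whitened vectors, so that \<open>\<Lambda> = A' A\<close> and
\<open>tr \<Lambda>\<close> is the sum of the squared entries of \<open>A\<close>. For Gaussian vectors the numerator of the
distance covariance is explicit (\<open>joint_char_whitened\<close>): the squared modulus at \<open>(s, t)\<close> is
\<open>exp (-|s|\<^sup>2 - |t|\<^sup>2) (1 - exp (-<s, A t>))\<^sup>2\<close>. Everything thus rests on the size of the integral
of this function against \<open>1 / (|s| |t|)^(p+1)\<close>, which is called \<open>energy p A\<close> below.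

Averaging over \<open>s\<close> and \<open>-s\<close> replaces \<open>(1 - exp (-u))\<^sup>2\<close> by \<open>cosh 2u - 2 cosh u + 1 = u\<^sup>2 + g u\<close>,
where the power series of \<open>g\<close> has nonnegative coefficients and starts at \<open>u^4\<close>. The quadratic
term can be integrated exactly: on a sphere the mean of \<open><s, a>\<^sup>2\<close> is \<open>|a|\<^sup>2 |s|\<^sup>2 / p\<close>, and one gets
\<open>tr \<Lambda> K\<^sup>2 / p\<^sup>2\<close> for a radial integral \<open>K\<close> with \<open>K / c\<^sub>p = \<Gamma> ((p+1)/2) / \<Gamma> (p/2)\<close>, whose
square is asymptotic to \<open>p / 2\<close> by log-convexity of \<open>\<Gamma>\<close>. This gives the limit \<open>1/2\<close>.

The rest is small uniformly in \<open>A\<close>. Positivity of the joint covariance matrix makes \<open>A\<close> a contraction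
(\<open>whitened_contraction\<close>), so that \<open>x = <s, A t> / (|s| |t|)\<close> lies in \<open>[-1, 1]\<close>; as \<open>g\<close> starts at order
four, \<open>g (x |s| |t|) \<le> x^4 g (|s| |t|)\<close>. The mean of \<open>x^4\<close> over both spheres is at most
\<open>3 tr \<Lambda> / (p\<^sup>2 (p+2))\<close>, which wins a factor \<open>1/p\<close> over the quadratic term, and the remaining
radial double integral of \<open>g\<close> is a finite constant independent of the dimension
(\<open>rem_const_finite\<close>). The two estimates are combined in \<open>energy_bounds\<close>.

The pair \<open>(X, X)\<close> is covered by the same computation with \<open>A\<close> the identity matrix, for which
\<open>p / tr \<Lambda> = 1\<close>. Hence both factors in the denominator of the distance correlation have
squares that tend to \<open>1/2\<close>, and the second limit is \<open>(1/2) / (1/2)\<close>.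

Two tools are developed on the way. The inverse square root in the definition of the affinely invariant
covariance requires existence and uniqueness of the positive semidefinite square root of a matrix, which is
obtained from the binomial series of \<open>sqrt (1 - z)\<close>. The sphere averages are replaced by
identities for Lebesgue measure on \<open>R^p\<close>: integrals of functions of \<open>|x|\<close> and \<open><a, x>\<close>
depend on \<open>a\<close> only through \<open>|a|\<close> (\<open>nn_integral_linear_form_cong\<close>).
\<close>

section \<open>Square roots of positive semidefinite matrices\<close>

lemma sym_mat_scalar_prod:
  fixes S :: "real mat"
  assumes S: "S \<in> carrier_mat n n" "transpose_mat S = S"
    and xy: "x \<in> carrier_vec n" "y \<in> carrier_vec n"
  shows "(S *\<^sub>v x) \<bullet> y = x \<bullet> (S *\<^sub>v y)"
  using transpose_vec_mult_scalar[OF S(1) xy(2) xy(1)] S(2) by simp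

lemma psd_Cauchy_Schwarz:
  assumes S: "pos_semidef n S" and x: "x \<in> carrier_vec n" and y: "y \<in> carrier_vec n"
  shows "(x \<bullet> (S *\<^sub>v y))\<^sup>2 \<le> (x \<bullet> (S *\<^sub>v x)) * (y \<bullet> (S *\<^sub>v y))"
proof -
  have Sc: "S \<in> carrier_mat n n" and St: "transpose_mat S = S"
    and nn: "\<And>v. v \<in> carrier_vec n \<Longrightarrow> 0 \<le> v \<bullet> (S *\<^sub>v v)"
    using S by (auto simp: pos_semidef_def)
  define a b c where "a = x \<bullet> (S *\<^sub>v x)" and "b = x \<bullet> (S *\<^sub>v y)" and "c = y \<bullet> (S *\<^sub>v y)"
  have sym: "y \<bullet> (S *\<^sub>v x) = b"
    using sym_mat_scalar_prod[OF Sc St x y] comm_scalar_prod[of y n "S *\<^sub>v x"] Sc x y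
    by (simp add: b_def)
  have q: "0 \<le> a + 2 * t * b + t\<^sup>2 * c" for t
  proof -
    have "0 \<le> (x + t \<cdot>\<^sub>v y) \<bullet> (S *\<^sub>v (x + t \<cdot>\<^sub>v y))"
      using x y by (intro nn) auto
    also have "S *\<^sub>v (x + t \<cdot>\<^sub>v y) = S *\<^sub>v x + t \<cdot>\<^sub>v (S *\<^sub>v y)"
      using Sc x y by (simp add: mult_add_distrib_mat_vec[of _ n n] mult_mat_vec[of _ n n])
    also have "(x + t \<cdot>\<^sub>v y) \<bullet> (S *\<^sub>v x + t \<cdot>\<^sub>v (S *\<^sub>v y)) = a + t * b + t * (b + t * c)"
      using Sc x y sym
      by (simp add: add_scalar_prod_distrib[of _ n] scalar_prod_add_distrib[of _ n] a_def b_def c_def algebra_simps)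
    finally show ?thesis by (simp add: power2_eq_square algebra_simps)
  qed
  have c: "0 \<le> c" using nn[OF y] by (simp add: c_def)
  have "b\<^sup>2 \<le> a * c"
  proof (cases "c = 0")
    case True
    have "b = 0"
    proof (rule ccontr)
      assume "b \<noteq> 0"
      then show False using q[of "- (a + 1) / (2 * b)"] True by (simp add: field_simps)
    qed
    then show ?thesis using True by simp
  next
    case False
    then have "0 \<le> c * (a + 2 * (- b / c) * b + (- b / c)\<^sup>2 * c)"
      using c q[of "- b / c"] by (intro mult_nonneg_nonneg) auto
    also have "\<dots> = a * c - b\<^sup>2"
      using False by (simp add: field_simps power2_eq_square)
    finally show ?thesis by simp
  qed
  then show ?thesis by (simp add: a_def b_def c_def)
qed

lemma psd_one: "pos_semidef n (1\<^sub>m n)"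
  by (auto simp: pos_semidef_def scalar_prod_def intro!: sum_nonneg)

lemma scalar_prod_Cauchy_Schwarz:
  fixes x y :: "real vec"
  assumes "x \<in> carrier_vec n" "y \<in> carrier_vec n"
  shows "(x \<bullet> y)\<^sup>2 \<le> (x \<bullet> x) * (y \<bullet> y)"
  using psd_Cauchy_Schwarz[OF psd_one assms] assms by simp

lemma scalar_prod_self_nonneg: "0 \<le> (x :: real vec) \<bullet> x"
  by (auto simp: scalar_prod_def intro!: sum_nonneg)

lemma scalar_prod_self_eq_0:
  assumes "(x :: real vec) \<in> carrier_vec n" "x \<bullet> x = 0"
  shows "x = 0\<^sub>v n"
proof -
  have "(\<Sum>i = 0..<dim_vec x. x $ i * x $ i) = 0"
    using assms(2) by (simp add: scalar_prod_def)
  then show ?thesis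
    using assms(1) by (intro eq_vecI) (auto simp: sum_nonneg_eq_0_iff)
qed

text \<open>A zero of a nonnegative quadratic form is a critical point, that is, a kernel vector: by Cauchy--Schwarz
\<open>(S x \<bullet> S x)\<^sup>2\<close> is at most \<open>x \<bullet> S x\<close> times a finite number.\<close>

lemma psd_kernel:
  assumes S: "pos_semidef n S" and x: "x \<in> carrier_vec n" "x \<bullet> (S *\<^sub>v x) = 0"
  shows "S *\<^sub>v x = 0\<^sub>v n"
proof -
  have Sc: "S \<in> carrier_mat n n" using S by (simp add: pos_semidef_def)
  have "((S *\<^sub>v x) \<bullet> (S *\<^sub>v x))\<^sup>2 \<le> 0"
    using psd_Cauchy_Schwarz[OF S, of "S *\<^sub>v x" x] Sc x by simp
  then show ?thesis
    using Sc x(1) by (intro scalar_prod_self_eq_0) auto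
qed

text \<open>Cauchy--Schwarz for the form of \<open>C\<close>, applied to \<open>v\<close> and \<open>C v\<close>, gives
\<open>|C v|^4 \<le> |v|\<^sup>2 |C v|\<^sup>2\<close>; no eigenvalues are involved.\<close>

lemma psd_contraction:
  assumes C: "pos_semidef n C" and le: "\<And>v. v \<in> carrier_vec n \<Longrightarrow> v \<bullet> (C *\<^sub>v v) \<le> v \<bullet> v"
    and v: "v \<in> carrier_vec n"
  shows "(C *\<^sub>v v) \<bullet> (C *\<^sub>v v) \<le> v \<bullet> v"
proof -
  let ?w = "C *\<^sub>v v"
  have Cc: "C \<in> carrier_mat n n" and Ct: "transpose_mat C = C"
    and nn: "\<And>v. v \<in> carrier_vec n \<Longrightarrow> 0 \<le> v \<bullet> (C *\<^sub>v v)"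
    using C by (auto simp: pos_semidef_def)
  have w: "?w \<in> carrier_vec n" using Cc v by simp
  have "(?w \<bullet> ?w)\<^sup>2 = (v \<bullet> (C *\<^sub>v ?w))\<^sup>2"
    using sym_mat_scalar_prod[OF Cc Ct v w] by simp
  also have "\<dots> \<le> (v \<bullet> (C *\<^sub>v v)) * (?w \<bullet> (C *\<^sub>v ?w))"
    by (rule psd_Cauchy_Schwarz[OF C v w])
  also have "\<dots> \<le> (v \<bullet> v) * (?w \<bullet> ?w)"
    using le v w nn by (intro mult_mono scalar_prod_self_nonneg) auto
  finally have "(?w \<bullet> ?w) * (?w \<bullet> ?w) \<le> (v \<bullet> v) * (?w \<bullet> ?w)"
    by (simp add: power2_eq_square)
  then show ?thesis
    using scalar_prod_self_nonneg[of ?w] scalar_prod_self_nonneg[of v]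
    by (cases "?w \<bullet> ?w = 0") (auto simp: mult_le_cancel_right)
qed

lemma pow_mat_contraction:
  assumes C: "pos_semidef n C" and le: "\<And>v. v \<in> carrier_vec n \<Longrightarrow> v \<bullet> (C *\<^sub>v v) \<le> v \<bullet> v"
    and v: "v \<in> carrier_vec n"
  shows "((C ^\<^sub>m k) *\<^sub>v v) \<bullet> ((C ^\<^sub>m k) *\<^sub>v v) \<le> v \<bullet> v"
  using v
proof (induction k arbitrary: v)
  case 0
  then show ?case using C by (auto simp: pos_semidef_def)
next
  case (Suc k)
  have Cc: "C \<in> carrier_mat n n" using C by (auto simp: pos_semidef_def)
  have "((C ^\<^sub>m Suc k) *\<^sub>v v) = (C ^\<^sub>m k) *\<^sub>v (C *\<^sub>v v)"
    using Cc Suc.prems by (simp add: assoc_mult_mat_vec[of _ n n _ n])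
  then show ?case
    using Suc.IH[of "C *\<^sub>v v"] psd_contraction[OF C le Suc.prems] Cc Suc.prems by auto
qed

lemma scalar_prod_pow_mat_le:
  assumes C: "pos_semidef n C" and le: "\<And>v. v \<in> carrier_vec n \<Longrightarrow> v \<bullet> (C *\<^sub>v v) \<le> v \<bullet> v"
    and v: "v \<in> carrier_vec n"
  shows "v \<bullet> ((C ^\<^sub>m k) *\<^sub>v v) \<le> v \<bullet> v"
proof -
  have Cc: "C \<in> carrier_mat n n" using C by (auto simp: pos_semidef_def)
  have "(v \<bullet> ((C ^\<^sub>m k) *\<^sub>v v))\<^sup>2 \<le> (v \<bullet> v) * (((C ^\<^sub>m k) *\<^sub>v v) \<bullet> ((C ^\<^sub>m k) *\<^sub>v v))"
    using Cc v by (intro scalar_prod_Cauchy_Schwarz[of _ n] mult_mat_vec_carrier[of _ n n] pow_carrier_mat) auto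
  also have "\<dots> \<le> (v \<bullet> v) * (v \<bullet> v)"
    by (intro mult_left_mono pow_mat_contraction[OF C le v] scalar_prod_self_nonneg)
  finally have "(v \<bullet> ((C ^\<^sub>m k) *\<^sub>v v))\<^sup>2 \<le> (v \<bullet> v)\<^sup>2"
    by (simp add: power2_eq_square)
  then show ?thesis
    using scalar_prod_self_nonneg by (rule power2_le_imp_le)
qed

lemma abs_pow_mat_entry_le_1:
  assumes C: "pos_semidef n C" and le: "\<And>v. v \<in> carrier_vec n \<Longrightarrow> v \<bullet> (C *\<^sub>v v) \<le> v \<bullet> v"
    and ij: "i < n" "j < n"
  shows "\<bar>(C ^\<^sub>m k) $$ (i, j)\<bar> \<le> 1"
proof -
  have Cc: "C ^\<^sub>m k \<in> carrier_mat n n" using C by (auto simp: pos_semidef_def)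
  let ?w = "(C ^\<^sub>m k) *\<^sub>v unit_vec n j"
  have w: "?w $ i = (C ^\<^sub>m k) $$ (i, j)"
    using carrier_matD[OF Cc] ij by simp
  have "(?w $ i)\<^sup>2 \<le> ?w \<bullet> ?w"
    using ij carrier_matD[OF Cc] unfolding scalar_prod_def
    by (intro order_trans[OF _ member_le_sum[of i]]) (auto simp: power2_eq_square)
  also have "\<dots> \<le> unit_vec n j \<bullet> unit_vec n j"
    using ij by (intro pow_mat_contraction[OF C le]) auto
  also have "\<dots> = 1" using ij by simp
  finally show ?thesis unfolding w by (simp add: abs_square_le_1)
qed

text \<open>The coefficient of \<open>z ^ k\<close> in the binomial series of \<open>sqrt (1 - z)\<close>.\<close>

definition sqrt_coeff :: "nat \<Rightarrow> real" where
  "sqrt_coeff k = (-1) ^ k * ((1 / 2) gchoose k)"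

lemma gbinomial_Suc_ratio: "(-1) ^ Suc k * (a gchoose Suc k) = ((-1) ^ k * (a gchoose k)) * ((real k - a) / (real k + 1))"
  for a :: real
proof -
  have "(a gchoose k) * a = real k * (a gchoose k) + real (Suc k) * (a gchoose Suc k)"
    by (rule gbinomial_mult_1')
  then have "(real k + 1) * (a gchoose Suc k) = (a - real k) * (a gchoose k)"
    by (simp add: algebra_simps)
  then have "a gchoose Suc k = (a - real k) * (a gchoose k) / (real k + 1)"
    by (simp add: nonzero_eq_divide_eq mult.commute add_nonneg_eq_0_iff)
  then have "(-1) ^ Suc k * (a gchoose Suc k) = - ((-1) ^ k * ((a - real k) * (a gchoose k) / (real k + 1)))"
    by simp
  also have "\<dots> = ((-1) ^ k * (a gchoose k)) * (- (a - real k) / (real k + 1))"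
    by (simp only: times_divide_eq_right times_divide_eq_left mult_minus_left mult_minus_right minus_divide_left mult_ac)
  finally show ?thesis by simp
qed

lemma sqrt_coeff_0: "sqrt_coeff 0 = 1"
  by (simp add: sqrt_coeff_def)

lemma sqrt_coeff_nonpos: "sqrt_coeff (Suc k) \<le> 0"
proof (induction k)
  case 0
  then show ?case by (simp add: sqrt_coeff_def)
next
  case (Suc k)
  have "sqrt_coeff (Suc (Suc k)) = sqrt_coeff (Suc k) * ((real (Suc k) - 1 / 2) / (real (Suc k) + 1))"
    unfolding sqrt_coeff_def by (rule gbinomial_Suc_ratio)
  also have "\<dots> \<le> 0" using Suc.IH by (intro mult_nonpos_nonneg) auto
  finally show ?case .
qed

text \<open>The partial sums telescope to \<open>(-1) ^ m\<close> times a binomial coefficient of \<open>-1/2\<close>, a product of positive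
numbers. As all coefficients but the first are at most \<open>0\<close>, this one fact yields both absolute
summability and, later, positivity of the square root.\<close>

lemma sqrt_coeff_partial_sum_nonneg: "0 \<le> (\<Sum>k\<le>m. sqrt_coeff k)"
proof -
  have "0 \<le> (-1) ^ m * ((- 1 / 2 :: real) gchoose m)"
  proof (induction m)
    case (Suc m)
    have "0 \<le> (real m - (- 1 / 2)) / (real m + 1)" by simp
    with Suc show ?case unfolding gbinomial_Suc_ratio by (rule mult_nonneg_nonneg)
  qed simp
  then show ?thesis
    using gbinomial_sum_lower_neg[of "1 / 2 :: real" m] by (simp add: sqrt_coeff_def mult.commute)
qed

lemma summable_abs_sqrt_coeff: "summable (\<lambda>k. \<bar>sqrt_coeff k\<bar>)"
proof (rule bounded_imp_summable[where B = 2])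
  fix m
  have "(\<Sum>k\<le>m. \<bar>sqrt_coeff k\<bar>) = (\<Sum>k\<le>m. (if k = 0 then 2 else 0) - sqrt_coeff k)"
  proof (intro sum.cong refl)
    fix k show "\<bar>sqrt_coeff k\<bar> = (if k = 0 then 2 else 0) - sqrt_coeff k"
      using sqrt_coeff_nonpos[of "k - 1"] by (cases k) (auto simp: sqrt_coeff_0)
  qed
  also have "\<dots> \<le> 2" using sqrt_coeff_partial_sum_nonneg[of m] by (simp add: sum_subtractf)
  finally show "(\<Sum>k\<le>m. \<bar>sqrt_coeff k\<bar>) \<le> 2" .
qed simp

text \<open>This is \<open>(sqrt (1 - z))\<^sup>2 = 1 - z\<close>, read coefficientwise.\<close>

lemma sqrt_coeff_convolution:
  "(\<Sum>k\<le>m. sqrt_coeff k * sqrt_coeff (m - k)) = (if m = 0 then 1 else if m = 1 then -1 else 0)"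
proof -
  have "(\<Sum>k\<le>m. sqrt_coeff k * sqrt_coeff (m - k))
      = (\<Sum>k\<le>m. (-1) ^ m * (((1 / 2) gchoose k) * ((1 / 2) gchoose (m - k))))"
    by (intro sum.cong refl) (auto simp: sqrt_coeff_def mult_ac simp flip: power_add)
  also have "\<dots> = (-1) ^ m * (((1 / 2) + (1 / 2)) gchoose m :: real)"
    unfolding gbinomial_Vandermonde[symmetric] by (simp add: atLeast0AtMost sum_distrib_left)
  also have "((1 / 2) + (1 / 2) :: real) gchoose m = real (1 choose m)"
    by (simp add: binomial_gbinomial)
  finally show ?thesis
    by (cases "m = 0 \<or> m = 1") auto
qed

definition sqrt_series :: "nat \<Rightarrow> real mat \<Rightarrow> real mat" where
  "sqrt_series n C = mat n n (\<lambda>(i, j). \<Sum>k. sqrt_coeff k * (C ^\<^sub>m k) $$ (i, j))"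

text \<open>For \<open>0 \<le> C \<le> 1\<close> in the order of quadratic forms, all entries of all powers of \<open>C\<close> are bounded by
\<open>1\<close>, so that \<open>sqrt (1 - C)\<close> may be computed by the binomial series, entry by entry.\<close>

context
  fixes n :: nat and C :: "real mat"
  assumes C: "pos_semidef n C" and le: "\<And>v. v \<in> carrier_vec n \<Longrightarrow> v \<bullet> (C *\<^sub>v v) \<le> v \<bullet> v"
begin

private lemma Cc: "C \<in> carrier_mat n n" and Ct: "transpose_mat C = C"
  using C by (auto simp: pos_semidef_def)

private lemma dims: "dim_row C = n" "dim_col C = n"
  using Cc by auto

lemma sqrt_series_abs_summable:
  assumes "i < n" "j < n"
  shows "summable (\<lambda>k. norm (sqrt_coeff k * (C ^\<^sub>m k) $$ (i, j)))"
proof (rule summable_comparison_test[OF _ summable_abs_sqrt_coeff], intro exI allI impI)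
  fix k
  show "norm (norm (sqrt_coeff k * (C ^\<^sub>m k) $$ (i, j))) \<le> \<bar>sqrt_coeff k\<bar>"
    using mult_left_mono[OF abs_pow_mat_entry_le_1[OF C le assms, of k], of "\<bar>sqrt_coeff k\<bar>"]
    by (simp add: abs_mult)
qed

lemma sqrt_series_sums:
  assumes "i < n" "j < n"
  shows "(\<lambda>k. sqrt_coeff k * (C ^\<^sub>m k) $$ (i, j)) sums (sqrt_series n C $$ (i, j))"
  using summable_norm_cancel[OF sqrt_series_abs_summable[OF assms]] assms
  by (simp add: sqrt_series_def summable_sums)

lemma sqrt_series_quadratic_sums:
  assumes v: "v \<in> carrier_vec n"
  shows "(\<lambda>k. sqrt_coeff k * (v \<bullet> ((C ^\<^sub>m k) *\<^sub>v v))) sums (v \<bullet> (sqrt_series n C *\<^sub>v v))"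
proof -
  have q: "v \<bullet> (B *\<^sub>v v) = (\<Sum>i<n. \<Sum>j<n. B $$ (i, j) * (v $ i * v $ j))"
    if "B \<in> carrier_mat n n" for B :: "real mat"
    using that v by (simp add: scalar_prod_def sum_distrib_left lessThan_atLeast0 mult_ac)
  have "(\<lambda>k. \<Sum>i<n. \<Sum>j<n. sqrt_coeff k * (C ^\<^sub>m k) $$ (i, j) * (v $ i * v $ j))
      sums (\<Sum>i<n. \<Sum>j<n. sqrt_series n C $$ (i, j) * (v $ i * v $ j))"
    by (intro sums_sum sums_mult2 sqrt_series_sums) auto
  then show ?thesis
    by (simp add: q Cc sqrt_series_def[of n C, THEN arg_cong[where f = "\<lambda>A. A \<in> carrier_mat n n"]] sum_distrib_left mult.assoc)
qed

lemma pow_mat_add: "C ^\<^sub>m j * C ^\<^sub>m k = C ^\<^sub>m (j + k)"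
proof (induction k)
  case (Suc k)
  have "C ^\<^sub>m j * C ^\<^sub>m Suc k = (C ^\<^sub>m j * C ^\<^sub>m k) * C"
    using Cc by (simp add: assoc_mult_mat[of _ n n _ n _ n])
  then show ?case using Suc.IH by simp
qed (use Cc in auto)

lemma pow_mat_symmetric: "transpose_mat (C ^\<^sub>m k) = C ^\<^sub>m k"
proof (induction k)
  case (Suc k)
  have "C * C ^\<^sub>m k = C ^\<^sub>m k * C"
    using pow_mat_add[of 1 k] pow_mat_add[of k 1] Cc by simp
  then show ?case
    using Suc Cc Ct by (simp add: transpose_mult[of _ n n _ n])
qed (use Cc in auto)

text \<open>For the quadratic form, \<open>v \<bullet> C^k v \<le> v \<bullet> v\<close> and the coefficients with \<open>k > 0\<close> are at most \<open>0\<close>, so each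
partial sum is at least \<open>v \<bullet> v\<close> times a partial sum of the coefficients.\<close>

lemma sqrt_series_psd: "pos_semidef n (sqrt_series n C)"
  unfolding pos_semidef_def
proof (intro conjI ballI)
  show "sqrt_series n C \<in> carrier_mat n n" by (simp add: sqrt_series_def)
  have "(C ^\<^sub>m k) $$ (j, i) = (C ^\<^sub>m k) $$ (i, j)" if "i < n" "j < n" for i j k
    using pow_mat_symmetric[of k] that carrier_matD[OF pow_carrier_mat[OF Cc, of k]]
    by (metis index_transpose_mat(1))
  then show "transpose_mat (sqrt_series n C) = sqrt_series n C"
    by (intro eq_matI) (auto simp: sqrt_series_def)
next
  fix v :: "real vec" assume v: "v \<in> carrier_vec n"
  show "0 \<le> v \<bullet> (sqrt_series n C *\<^sub>v v)"
  proof (rule LIMSEQ_le_const[OF sqrt_series_quadratic_sums[OF v, unfolded sums_def_le]], intro exI allI impI)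
    fix m
    have "0 \<le> (v \<bullet> v) * (\<Sum>k\<le>m. sqrt_coeff k)"
      by (intro mult_nonneg_nonneg scalar_prod_self_nonneg sqrt_coeff_partial_sum_nonneg)
    also have "\<dots> \<le> (\<Sum>k\<le>m. sqrt_coeff k * (v \<bullet> ((C ^\<^sub>m k) *\<^sub>v v)))"
      unfolding sum_distrib_left
    proof (rule sum_mono)
      fix k
      show "(v \<bullet> v) * sqrt_coeff k \<le> sqrt_coeff k * (v \<bullet> ((C ^\<^sub>m k) *\<^sub>v v))"
      proof (cases k)
        case 0
        then show ?thesis using Cc v by (simp add: sqrt_coeff_0)
      next
        case (Suc k')
        then show ?thesis
          using scalar_prod_pow_mat_le[OF C le v, of k] sqrt_coeff_nonpos[of k']
          by (subst mult.commute) (simp add: mult_left_mono_neg del: pow_mat.simps)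
      qed
    qed
    finally show "0 \<le> (\<Sum>k\<le>m. sqrt_coeff k * (v \<bullet> ((C ^\<^sub>m k) *\<^sub>v v)))" .
  qed
qed

lemma sqrt_series_square: "sqrt_series n C * sqrt_series n C = 1\<^sub>m n - C"
proof (rule eq_matI)
  fix i j assume "i < dim_row (1\<^sub>m n - C)" "j < dim_col (1\<^sub>m n - C)"
  then have ij: "i < n" "j < n" using Cc by auto
  let ?c = "\<lambda>i j k. sqrt_coeff k * (C ^\<^sub>m k) $$ (i, j)"
  let ?\<delta> = "\<lambda>m. (if m = 0 then 1 else if m = 1 then -1 else 0) :: real"
  have "(\<lambda>m. \<Sum>k\<le>m. ?c i l k * ?c l j (m - k)) sums (sqrt_series n C $$ (i, l) * sqrt_series n C $$ (l, j))"
    if "l < n" for l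
    using Cauchy_product_sums[OF sqrt_series_abs_summable[OF ij(1) that] sqrt_series_abs_summable[OF that ij(2)]]
      sums_unique[OF sqrt_series_sums[OF ij(1) that]] sums_unique[OF sqrt_series_sums[OF that ij(2)]] by simp
  then have 1: "(\<lambda>m. \<Sum>l<n. \<Sum>k\<le>m. ?c i l k * ?c l j (m - k)) sums (\<Sum>l<n. sqrt_series n C $$ (i, l) * sqrt_series n C $$ (l, j))"
    by (intro sums_sum) auto
  have 2: "(\<Sum>l<n. \<Sum>k\<le>m. ?c i l k * ?c l j (m - k)) = ?\<delta> m * (C ^\<^sub>m m) $$ (i, j)" for m
  proof -
    have "(\<Sum>l<n. \<Sum>k\<le>m. ?c i l k * ?c l j (m - k))
      = (\<Sum>k\<le>m. sqrt_coeff k * sqrt_coeff (m - k) * (\<Sum>l<n. (C ^\<^sub>m k) $$ (i, l) * (C ^\<^sub>m (m - k)) $$ (l, j)))"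
      by (subst sum.swap) (simp add: sum_distrib_left mult_ac)
    also have "\<dots> = (\<Sum>k\<le>m. sqrt_coeff k * sqrt_coeff (m - k) * (C ^\<^sub>m m) $$ (i, j))"
    proof (intro sum.cong refl)
      fix k assume "k \<in> {..m}"
      then have "C ^\<^sub>m k * C ^\<^sub>m (m - k) = C ^\<^sub>m m"
        using pow_mat_add[of k "m - k"] by simp
      moreover have "(C ^\<^sub>m k * C ^\<^sub>m (m - k)) $$ (i, j) = (\<Sum>l<n. (C ^\<^sub>m k) $$ (i, l) * (C ^\<^sub>m (m - k)) $$ (l, j))"
        using ij dims by (simp add: scalar_prod_def lessThan_atLeast0)
      ultimately show "sqrt_coeff k * sqrt_coeff (m - k) * (\<Sum>l<n. (C ^\<^sub>m k) $$ (i, l) * (C ^\<^sub>m (m - k)) $$ (l, j))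
        = sqrt_coeff k * sqrt_coeff (m - k) * (C ^\<^sub>m m) $$ (i, j)"
        by simp
    qed
    finally show ?thesis by (simp add: sqrt_coeff_convolution flip: sum_distrib_right)
  qed
  have "(\<lambda>m. ?\<delta> m * (C ^\<^sub>m m) $$ (i, j)) sums (\<Sum>m\<in>{0, 1}. ?\<delta> m * (C ^\<^sub>m m) $$ (i, j))"
    by (rule sums_finite) auto
  also have "(\<Sum>m\<in>{0, 1}. ?\<delta> m * (C ^\<^sub>m m) $$ (i, j)) = (1\<^sub>m n - C) $$ (i, j)"
    using Cc ij by simp
  finally have "(\<Sum>l<n. sqrt_series n C $$ (i, l) * sqrt_series n C $$ (l, j)) = (1\<^sub>m n - C) $$ (i, j)"
    using 1 unfolding 2 by (rule sums_unique2[rotated])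
  then show "(sqrt_series n C * sqrt_series n C) $$ (i, j) = (1\<^sub>m n - C) $$ (i, j)"
    using ij by (simp add: scalar_prod_def sqrt_series_def lessThan_atLeast0)
qed (use Cc in \<open>auto simp: sqrt_series_def\<close>)

text \<open>The square root commutes with everything that commutes with \<open>C\<close>, being a limit of polynomials in \<open>C\<close>. Uniqueness
of the square root depends on this.\<close>

lemma sqrt_series_commute:
  assumes B: "B \<in> carrier_mat n n" and BC: "B * C = C * B"
  shows "B * sqrt_series n C = sqrt_series n C * B"
proof (rule eq_matI)
  have pow: "B * C ^\<^sub>m k = C ^\<^sub>m k * B" for k
  proof (induction k)
    case (Suc k)
    have "B * C ^\<^sub>m Suc k = (B * C ^\<^sub>m k) * C"
      using B Cc by (simp add: assoc_mult_mat[of _ n n _ n _ n])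
    also have "\<dots> = C ^\<^sub>m k * (B * C)"
      unfolding Suc.IH using B Cc by (simp add: assoc_mult_mat[of _ n n _ n _ n])
    also have "\<dots> = C ^\<^sub>m Suc k * B"
      unfolding BC using B Cc by (simp add: assoc_mult_mat[of _ n n _ n _ n])
    finally show ?case .
  qed (use B Cc in auto)
  fix i j assume "i < dim_row (sqrt_series n C * B)" "j < dim_col (sqrt_series n C * B)"
  then have ij: "i < n" "j < n" using B by (auto simp: sqrt_series_def)
  have "(\<lambda>k. \<Sum>l<n. B $$ (i, l) * (sqrt_coeff k * (C ^\<^sub>m k) $$ (l, j))) sums (\<Sum>l<n. B $$ (i, l) * sqrt_series n C $$ (l, j))"
    using ij by (intro sums_sum sums_mult sqrt_series_sums) auto
  moreover have "(\<lambda>k. \<Sum>l<n. sqrt_coeff k * (C ^\<^sub>m k) $$ (i, l) * B $$ (l, j)) sums (\<Sum>l<n. sqrt_series n C $$ (i, l) * B $$ (l, j))"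
    using ij by (intro sums_sum sums_mult2 sqrt_series_sums) auto
  moreover have "(\<Sum>l<n. B $$ (i, l) * (sqrt_coeff k * (C ^\<^sub>m k) $$ (l, j))) = (\<Sum>l<n. sqrt_coeff k * (C ^\<^sub>m k) $$ (i, l) * B $$ (l, j))" for k
  proof -
    have "(B * C ^\<^sub>m k) $$ (i, j) = (\<Sum>l<n. B $$ (i, l) * (C ^\<^sub>m k) $$ (l, j))"
      "(C ^\<^sub>m k * B) $$ (i, j) = (\<Sum>l<n. (C ^\<^sub>m k) $$ (i, l) * B $$ (l, j))"
      using ij dims B by (auto simp: scalar_prod_def lessThan_atLeast0)
    then have "sqrt_coeff k * (\<Sum>l<n. B $$ (i, l) * (C ^\<^sub>m k) $$ (l, j)) = sqrt_coeff k * (\<Sum>l<n. (C ^\<^sub>m k) $$ (i, l) * B $$ (l, j))"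
      using pow[of k] by simp
    then show ?thesis by (simp add: sum_distrib_left mult_ac)
  qed
  ultimately have "(\<Sum>l<n. B $$ (i, l) * sqrt_series n C $$ (l, j)) = (\<Sum>l<n. sqrt_series n C $$ (i, l) * B $$ (l, j))"
    by (simp add: sums_unique2)
  then show "(B * sqrt_series n C) $$ (i, j) = (sqrt_series n C * B) $$ (i, j)"
    using ij B by (simp add: scalar_prod_def sqrt_series_def lessThan_atLeast0)
qed (use B in \<open>auto simp: sqrt_series_def\<close>)

end

lemma mat_eq_if_mult_vec_eq:
  fixes A B :: "real mat"
  assumes A: "A \<in> carrier_mat n n" and B: "B \<in> carrier_mat n n"
    and eq: "\<And>v. v \<in> carrier_vec n \<Longrightarrow> A *\<^sub>v v = B *\<^sub>v v"
  shows "A = B"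
proof (rule eq_matI)
  fix i j assume "i < dim_row B" "j < dim_col B"
  then have ij: "i < n" "j < n" using B by auto
  have "(A *\<^sub>v unit_vec n j) $ i = (B *\<^sub>v unit_vec n j) $ i" using eq[of "unit_vec n j"] by simp
  then show "A $$ (i, j) = B $$ (i, j)" using A B ij by simp
qed (use A B in auto)

lemma smult_mat_mult_vec:
  fixes A :: "real mat"
  assumes "A \<in> carrier_mat n n" "v \<in> carrier_vec n"
  shows "(k \<cdot>\<^sub>m A) *\<^sub>v v = k \<cdot>\<^sub>v (A *\<^sub>v v)"
  using assms by (intro eq_vecI) auto

lemma quadratic_form_bound:
  fixes A :: "real mat"
  assumes A: "A \<in> carrier_mat n n" and v: "v \<in> carrier_vec n"
  shows "v \<bullet> (A *\<^sub>v v) \<le> (\<Sum>i<n. \<Sum>j<n. \<bar>A $$ (i, j)\<bar>) * (v \<bullet> v)"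
proof -
  have sq: "(v $ i)\<^sup>2 \<le> v \<bullet> v" if "i < n" for i
    using that v unfolding scalar_prod_def
    by (intro order_trans[OF _ member_le_sum[of i]]) (auto simp: power2_eq_square)
  have e: "A $$ (i, j) * (v $ i * v $ j) \<le> \<bar>A $$ (i, j)\<bar> * (v \<bullet> v)" if "i < n" "j < n" for i j
  proof -
    have "\<bar>v $ i\<bar> \<le> sqrt (v \<bullet> v)" "\<bar>v $ j\<bar> \<le> sqrt (v \<bullet> v)"
      using sq[OF that(1)] sq[OF that(2)] by (auto intro!: real_le_rsqrt)
    then have "\<bar>v $ i\<bar> * \<bar>v $ j\<bar> \<le> sqrt (v \<bullet> v) * sqrt (v \<bullet> v)"
      by (intro mult_mono) (auto simp: scalar_prod_self_nonneg)
    then have "\<bar>v $ i * v $ j\<bar> \<le> v \<bullet> v"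
      using scalar_prod_self_nonneg[of v] by (simp add: abs_mult)
    then have "\<bar>A $$ (i, j)\<bar> * \<bar>v $ i * v $ j\<bar> \<le> \<bar>A $$ (i, j)\<bar> * (v \<bullet> v)"
      by (rule mult_left_mono) simp
    then show ?thesis
      using abs_ge_self[of "A $$ (i, j) * (v $ i * v $ j)"] by (simp add: abs_mult)
  qed
  have "v \<bullet> (A *\<^sub>v v) = (\<Sum>i<n. \<Sum>j<n. A $$ (i, j) * (v $ i * v $ j))"
    using A v by (simp add: scalar_prod_def sum_distrib_left lessThan_atLeast0 mult_ac)
  also have "\<dots> \<le> (\<Sum>i<n. \<Sum>j<n. \<bar>A $$ (i, j)\<bar> * (v \<bullet> v))"
    by (intro sum_mono e) auto
  finally show ?thesis by (simp add: sum_distrib_right)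
qed

text \<open>Rescaling by a bound \<open>l\<close> of the quadratic form brings \<open>A\<close> into the range of the series:
\<open>sqrt A = sqrt l * sqrt (1 - C)\<close> with \<open>C = 1 - A / l\<close>.\<close>

lemma psd_sqrt_exists:
  assumes A: "pos_semidef n A"
  obtains R where "pos_semidef n R" "R * R = A"
    "\<And>B. B \<in> carrier_mat n n \<Longrightarrow> B * A = A * B \<Longrightarrow> B * R = R * B"
proof -
  have Ac: "A \<in> carrier_mat n n" and At: "transpose_mat A = A"
    and nn: "\<And>v. v \<in> carrier_vec n \<Longrightarrow> 0 \<le> v \<bullet> (A *\<^sub>v v)"
    using A by (auto simp: pos_semidef_def)
  define l where "l = 1 + (\<Sum>i<n. \<Sum>j<n. \<bar>A $$ (i, j)\<bar>)"
  have l: "l > 0" unfolding l_def by (intro add_pos_nonneg sum_nonneg) auto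
  define C where "C = 1\<^sub>m n - (1 / l) \<cdot>\<^sub>m A"
  have Cc: "C \<in> carrier_mat n n" using Ac by (auto simp: C_def intro!: minus_carrier_mat)
  have Ct: "transpose_mat C = C"
  proof -
    have "A $$ (j, i) = A $$ (i, j)" if "i < n" "j < n" for i j
      using At Ac that by (metis carrier_matD index_transpose_mat(1))
    then show ?thesis using Ac by (intro eq_matI) (auto simp: C_def)
  qed
  have Cq: "v \<bullet> (C *\<^sub>v v) = v \<bullet> v - (1 / l) * (v \<bullet> (A *\<^sub>v v))" if v: "v \<in> carrier_vec n" for v
  proof -
    have "C *\<^sub>v v = v - (1 / l) \<cdot>\<^sub>v (A *\<^sub>v v)"
      using Ac v by (simp add: C_def minus_mult_distrib_mat_vec[of _ n n] smult_mat_mult_vec[of _ n])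
    then show ?thesis
      using Ac v by (simp add: scalar_prod_minus_distrib[of _ n])
  qed
  have le: "v \<bullet> (C *\<^sub>v v) \<le> v \<bullet> v" if v: "v \<in> carrier_vec n" for v
    using nn[OF v] l by (simp add: Cq[OF v])
  have C: "pos_semidef n C"
    unfolding pos_semidef_def
  proof (intro conjI ballI Cc Ct)
    fix v :: "real vec" assume v: "v \<in> carrier_vec n"
    have "v \<bullet> (A *\<^sub>v v) \<le> l * (v \<bullet> v)"
      using quadratic_form_bound[OF Ac v] scalar_prod_self_nonneg[of v] unfolding l_def
      by (simp add: distrib_right)
    then show "0 \<le> v \<bullet> (C *\<^sub>v v)"
      using l by (simp add: Cq[OF v] field_simps)
  qed
  define S where "S = sqrt_series n C"
  define R where "R = sqrt l \<cdot>\<^sub>m S"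
  have S: "pos_semidef n S" unfolding S_def by (rule sqrt_series_psd[OF C le])
  then have Sc: "S \<in> carrier_mat n n" and St: "transpose_mat S = S" by (auto simp: pos_semidef_def)
  show thesis
  proof
    show "pos_semidef n R"
      unfolding pos_semidef_def R_def
    proof (intro conjI ballI)
      show "sqrt l \<cdot>\<^sub>m S \<in> carrier_mat n n" using Sc by simp
      have "S $$ (j, i) = S $$ (i, j)" if "i < n" "j < n" for i j
        using St Sc that by (metis carrier_matD index_transpose_mat(1))
      then show "transpose_mat (sqrt l \<cdot>\<^sub>m S) = sqrt l \<cdot>\<^sub>m S" using Sc by (intro eq_matI) auto
      fix v :: "real vec" assume v: "v \<in> carrier_vec n"
      have "v \<bullet> (sqrt l \<cdot>\<^sub>m S *\<^sub>v v) = sqrt l * (v \<bullet> (S *\<^sub>v v))"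
        using Sc v by (simp add: smult_mat_mult_vec[of _ n])
      then show "0 \<le> v \<bullet> (sqrt l \<cdot>\<^sub>m S *\<^sub>v v)"
        using S v l by (simp add: pos_semidef_def)
    qed
    have "R * R = (sqrt l * sqrt l) \<cdot>\<^sub>m (S * S)"
      using Sc unfolding R_def by (intro eq_matI) (auto simp: mult_ac)
    also have "S * S = 1\<^sub>m n - C" unfolding S_def by (rule sqrt_series_square[OF C le])
    also have "1\<^sub>m n - C = (1 / l) \<cdot>\<^sub>m A"
      using Ac unfolding C_def by (intro eq_matI) auto
    also have "(sqrt l * sqrt l) \<cdot>\<^sub>m ((1 / l) \<cdot>\<^sub>m A) = A"
      using l by (intro eq_matI) auto
    finally show "R * R = A" .
    fix B :: "real mat" assume B: "B \<in> carrier_mat n n" and BA: "B * A = A * B"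
    have lA: "(1 / l) \<cdot>\<^sub>m A \<in> carrier_mat n n" using Ac by simp
    have "B * C = B * 1\<^sub>m n - B * ((1 / l) \<cdot>\<^sub>m A)"
      unfolding C_def by (rule mult_minus_distrib_mat[OF B one_carrier_mat lA])
    also have "\<dots> = 1\<^sub>m n * B - ((1 / l) \<cdot>\<^sub>m A) * B"
      using B Ac BA by (simp add: mult_smult_distrib[OF B Ac] mult_smult_assoc_mat[OF Ac B])
    also have "\<dots> = C * B"
      unfolding C_def by (rule minus_mult_distrib_mat[OF one_carrier_mat lA B, symmetric])
    finally have BC: "B * C = C * B" .
    have "B * S = S * B"
      unfolding S_def by (rule sqrt_series_commute[OF C _ B BC]) (rule le)
    then show "B * R = R * B"
      using B Sc unfolding R_def by (simp add: mult_smult_distrib[of _ n n] mult_smult_assoc_mat[of _ n n])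
  qed
qed

text \<open>If \<open>R\<close> and \<open>B\<close> commute, then \<open>(R + B) (R - B) = 0\<close>. For \<open>w = (R - B) v\<close> the two nonnegative numbers
\<open>w \<bullet> R w\<close> and \<open>w \<bullet> B w\<close> add up to \<open>0\<close>, so \<open>w\<close> lies in both kernels, hence is orthogonal to both
ranges and to itself.\<close>

lemma psd_sqrt_unique:
  assumes R: "pos_semidef n R" and B: "pos_semidef n B" and BR: "B * R = R * B" and sq: "R * R = B * B"
  shows "R = B"
proof -
  have Rc: "R \<in> carrier_mat n n" and Rt: "transpose_mat R = R"
    and Bc: "B \<in> carrier_mat n n" and Bt: "transpose_mat B = B"
    using R B by (auto simp: pos_semidef_def)
  show ?thesis
  proof (rule mat_eq_if_mult_vec_eq[OF Rc Bc])
    fix v :: "real vec" assume v: "v \<in> carrier_vec n"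
    define w where "w = R *\<^sub>v v - B *\<^sub>v v"
    have w: "w \<in> carrier_vec n" using Rc Bc v by (simp add: w_def)
    have "R *\<^sub>v w = (R * R) *\<^sub>v v - (R * B) *\<^sub>v v"
      using Rc Bc v by (simp add: w_def mult_minus_distrib_mat_vec[of _ n n] assoc_mult_mat_vec[of _ n n _ n])
    also have "\<dots> = - (B *\<^sub>v w)"
      using Rc Bc v unfolding sq BR[symmetric]
      by (intro eq_vecI)
        (auto simp: w_def mult_minus_distrib_mat_vec[of _ n n] assoc_mult_mat_vec[of _ n n _ n])
    finally have RB: "R *\<^sub>v w = - (B *\<^sub>v w)" .
    have "w \<bullet> (R *\<^sub>v w) = - (w \<bullet> (B *\<^sub>v w))"
      unfolding RB using w Bc by simp
    moreover have "0 \<le> w \<bullet> (R *\<^sub>v w)" "0 \<le> w \<bullet> (B *\<^sub>v w)"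
      using R B w by (auto simp: pos_semidef_def)
    ultimately have "w \<bullet> (R *\<^sub>v w) = 0" "w \<bullet> (B *\<^sub>v w) = 0" by auto
    then have "R *\<^sub>v w = 0\<^sub>v n" "B *\<^sub>v w = 0\<^sub>v n"
      using psd_kernel[OF R w] psd_kernel[OF B w] by auto
    then have "w \<bullet> (R *\<^sub>v v) = 0" "w \<bullet> (B *\<^sub>v v) = 0"
      using sym_mat_scalar_prod[OF Rc Rt w v] sym_mat_scalar_prod[OF Bc Bt w v] v by auto
    then have "w \<bullet> w = 0"
      using w Rc Bc v by (subst (2) w_def) (simp add: scalar_prod_minus_distrib[of _ n])
    then have "w = 0\<^sub>v n" by (rule scalar_prod_self_eq_0[OF w])
    then have "(R *\<^sub>v v - B *\<^sub>v v) $ i = 0" if "i < n" for i using that by (simp add: w_def)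
    then show "R *\<^sub>v v = B *\<^sub>v v"
      using Rc Bc by (intro eq_vecI) auto
  qed
qed

lemma mat_sqrt_psd:
  assumes A: "pos_semidef n A"
  shows "pos_semidef n (mat_sqrt A)" "mat_sqrt A * mat_sqrt A = A"
proof -
  obtain R where R: "pos_semidef n R" "R * R = A"
    and comm: "\<And>B. B \<in> carrier_mat n n \<Longrightarrow> B * A = A * B \<Longrightarrow> B * R = R * B"
    using psd_sqrt_exists[OF A] by blast
  have n: "dim_row A = n" using A by (auto simp: pos_semidef_def)
  have "pos_semidef n (mat_sqrt A) \<and> mat_sqrt A * mat_sqrt A = A"
    unfolding mat_sqrt_def n
  proof (rule theI[where a = R])
    fix B assume B: "pos_semidef n B \<and> B * B = A"
    then have Bc: "B \<in> carrier_mat n n" by (simp add: pos_semidef_def)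
    have "B * A = A * B"
      using B Bc by (auto simp: assoc_mult_mat[of _ n n _ n _ n])
    then show "B = R"
      using psd_sqrt_unique[OF R(1), of B] B R(2) comm[OF Bc] by simp
  qed (use R in simp)
  then show "pos_semidef n (mat_sqrt A)" "mat_sqrt A * mat_sqrt A = A" by auto
qed

lemma mat_inv_inverse:
  assumes A: "A \<in> carrier_mat n n" and ker: "\<And>v. v \<in> carrier_vec n \<Longrightarrow> A *\<^sub>v v = 0\<^sub>v n \<Longrightarrow> v = 0\<^sub>v n"
  shows "mat_inv A \<in> carrier_mat n n" "A * mat_inv A = 1\<^sub>m n" "mat_inv A * A = 1\<^sub>m n"
proof -
  have "det A \<noteq> 0" using det_0_iff_vec_prod_zero[OF A] ker by auto
  then have "A \<in> Units (ring_mat TYPE(real) n ())" by (rule det_non_zero_imp_unit[OF A])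
  then obtain B where "mat_inverse A = Some B"
    using mat_inverse(1)[OF A, of "()"] by (cases "mat_inverse A") auto
  then show "mat_inv A \<in> carrier_mat n n" "A * mat_inv A = 1\<^sub>m n" "mat_inv A * A = 1\<^sub>m n"
    using mat_inverse(2)[OF A] by (auto simp: mat_inv_def)
qed

lemma left_inverse_eq_right_inverse:
  fixes A B C :: "real mat"
  assumes "A \<in> carrier_mat n n" "B \<in> carrier_mat n n" "C \<in> carrier_mat n n" "B * A = 1\<^sub>m n" "A * C = 1\<^sub>m n"
  shows "B = C"
proof -
  have "B = B * 1\<^sub>m n" using assms(2) by simp
  also have "\<dots> = B * (A * C)" by (simp only: assms(5))
  also have "\<dots> = (B * A) * C" by (rule assoc_mult_mat[OF assms(2,1,3), symmetric])
  also have "\<dots> = C" using assms(3,4) by simp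
  finally show ?thesis .
qed

lemma pos_def_imp_pos_semidef: "pos_def n A \<Longrightarrow> pos_semidef n A"
  by (fastforce simp: pos_def_def pos_semidef_def intro: less_imp_le)

lemma mat_inv_sqrt_pos_def:
  assumes A: "pos_def n A"
  defines "W \<equiv> mat_inv_sqrt A"
  shows "W \<in> carrier_mat n n" "transpose_mat W = W" "W * A * W = 1\<^sub>m n" "W * W = mat_inv A"
proof -
  define R where "R = mat_sqrt A"
  have Ac: "A \<in> carrier_mat n n" using A by (simp add: pos_def_def)
  have R: "pos_semidef n R" and RR: "R * R = A"
    using mat_sqrt_psd[OF pos_def_imp_pos_semidef[OF A]] by (auto simp: R_def)
  have Rc: "R \<in> carrier_mat n n" and Rt: "transpose_mat R = R" using R by (auto simp: pos_semidef_def)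
  have kerA: "v = 0\<^sub>v n" if "v \<in> carrier_vec n" "A *\<^sub>v v = 0\<^sub>v n" for v
    using A that by (force simp: pos_def_def)
  have kerR: "v = 0\<^sub>v n" if v: "v \<in> carrier_vec n" "R *\<^sub>v v = 0\<^sub>v n" for v
  proof (rule kerA[OF v(1)])
    show "A *\<^sub>v v = 0\<^sub>v n"
      using Rc v unfolding RR[symmetric] by (auto simp: assoc_mult_mat_vec[of _ n n _ n])
  qed
  have W: "W \<in> carrier_mat n n" "R * W = 1\<^sub>m n" "W * R = 1\<^sub>m n"
    using mat_inv_inverse[OF Rc kerR] by (auto simp: W_def mat_inv_sqrt_def R_def)
  show "W \<in> carrier_mat n n" by fact
  have "transpose_mat W * R = transpose_mat (R * W)"
    using Rc W(1) Rt by (simp add: transpose_mult[of _ n n _ n])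
  then have "transpose_mat W * R = 1\<^sub>m n" using W by simp
  then show "transpose_mat W = W"
    using left_inverse_eq_right_inverse[of R n "transpose_mat W" W] Rc W by simp
  have "W * A * W = (W * R) * (R * W)"
    unfolding RR[symmetric] using Rc W(1) by (simp add: assoc_mult_mat[of _ n n _ n _ n])
  then show "W * A * W = 1\<^sub>m n" using W by simp
  have "(W * W) * A = W * (W * R) * R"
    unfolding RR[symmetric] using Rc W(1) by (simp add: assoc_mult_mat[of _ n n _ n _ n])
  then have "(W * W) * A = 1\<^sub>m n" using W by simp
  then show "W * W = mat_inv A"
    using W(1) by (intro left_inverse_eq_right_inverse[OF Ac mult_carrier_mat mat_inv_inverse(1)[OF Ac kerA] _
          mat_inv_inverse(2)[OF Ac kerA]])
qed

section \<open>Characteristic functions of whitened Gaussian pairs\<close>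

lemma char_normal_law:
  assumes v: "0 \<le> v"
  shows "(LINT x|normal_law m v. exp (\<i> * complex_of_real x)) = exp (\<i> * complex_of_real m) * complex_of_real (exp (- v / 2))"
proof (cases "v = 0")
  case True
  then show ?thesis by (simp add: normal_law_def integral_return)
next
  case False
  define \<sigma> where "\<sigma> = sqrt v"
  have \<sigma>: "\<sigma> > 0" using v False by (simp add: \<sigma>_def)
  have dens: "\<sigma> * normal_density m \<sigma> (m + \<sigma> * z) = std_normal_density z" for z
    using \<sigma> by (simp add: normal_density_def power_mult_distrib real_sqrt_mult)
  have "(LINT x|normal_law m v. exp (\<i> * complex_of_real x))
    = (LINT x|lborel. normal_density m \<sigma> x *\<^sub>R exp (\<i> * complex_of_real x))"
    using False by (simp add: normal_law_def \<sigma>_def integral_density)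
  also have "\<dots> = \<bar>\<sigma>\<bar> *\<^sub>R (LINT z|lborel. normal_density m \<sigma> (m + \<sigma> * z) *\<^sub>R exp (\<i> * complex_of_real (m + \<sigma> * z)))"
    using \<sigma> by (intro lborel_integral_real_affine) auto
  also have "\<dots> = (LINT z|lborel. std_normal_density z *\<^sub>R (exp (\<i> * complex_of_real m) * exp (\<i> * complex_of_real (\<sigma> * z))))"
    unfolding dens[symmetric] using \<sigma>
    by (simp add: exp_add distrib_left flip: integral_scaleR_right scaleR_scaleR)
  also have "\<dots> = (LINT z|std_normal_distribution. exp (\<i> * complex_of_real m) * iexp (\<sigma> * z))"
    by (subst integral_density) auto
  also have "\<dots> = exp (\<i> * complex_of_real m) * char std_normal_distribution \<sigma>"
    by (simp add: char_def)
  also have "\<dots> = exp (\<i> * complex_of_real m) * complex_of_real (exp (- v / 2))"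
    using v by (simp add: char_std_normal_distribution \<sigma>_def)
  finally show ?thesis .
qed

lemma normal_law_moments:
  assumes v: "0 \<le> v"
  shows "has_bochner_integral (normal_law m v) (\<lambda>x. x) m"
    and "has_bochner_integral (normal_law m v) (\<lambda>x. (x - m)\<^sup>2) v"
proof -
  have "has_bochner_integral (normal_law m v) (\<lambda>x. x) m \<and> has_bochner_integral (normal_law m v) (\<lambda>x. (x - m)\<^sup>2) v"
  proof (cases "v = 0")
    case True
    have I: "integrable (return borel m) f" if "f \<in> borel_measurable borel" for f :: "real \<Rightarrow> real"
      using that by (simp add: integrable_iff_bounded nn_integral_return)
    have L: "normal_law m v = return borel m" using True by (simp add: normal_law_def)
    show ?thesis unfolding L has_bochner_integral_iff using True
      by (simp add: integral_return I)
  next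
    case False
    then have \<sigma>: "0 < sqrt v" using v by simp
    have L: "normal_law m v = density lborel (normal_density m (sqrt v))" using False by (simp add: normal_law_def)
    have "has_bochner_integral lborel (\<lambda>x. normal_density m (sqrt v) x * (x - m) ^ (2 * 1)) (fact (2 * 1) / ((2 / (sqrt v)\<^sup>2) ^ 1 * fact 1))"
      using \<sigma> by (rule normal_moment_even)
    then have "has_bochner_integral lborel (\<lambda>x. normal_density m (sqrt v) x *\<^sub>R (x - m)\<^sup>2) v"
      using v by simp
    moreover have "has_bochner_integral lborel (\<lambda>x. normal_density m (sqrt v) x *\<^sub>R x) m"
      using normal_moment_nz_1[OF \<sigma>] by simp
    ultimately show ?thesis
      unfolding L by (intro conjI has_bochner_integral_density) simp_all
  qed
  then show "has_bochner_integral (normal_law m v) (\<lambda>x. x) m" "has_bochner_integral (normal_law m v) (\<lambda>x. (x - m)\<^sup>2) v"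
    by auto
qed

lemma random_vec_scalar_prod_measurable:
  assumes "random_vec M n X"
  shows "(\<lambda>\<omega>. a \<bullet> X \<omega>) \<in> borel_measurable M"
proof -
  have "(\<lambda>\<omega>. \<Sum>i = 0..<n. a $ i * X \<omega> $ i) \<in> borel_measurable M"
    using assms by (intro borel_measurable_sum borel_measurable_times) (auto simp: random_vec_def)
  also have "?this \<longleftrightarrow> (\<lambda>\<omega>. a \<bullet> X \<omega>) \<in> borel_measurable M"
    using assms by (intro measurable_cong) (auto simp: random_vec_def scalar_prod_def)
  finally show ?thesis .
qed

text \<open>The laws of the linear forms \<open>a \<bullet> X\<close> carry the second moments only through their variances; the mixed
moments come from polarization with \<open>a = e\<^sub>i + e\<^sub>j\<close>.\<close>

lemma cov_mat_eqI:
  assumes X: "random_vec M n X" and S: "S \<in> carrier_mat n n" "transpose_mat S = S"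
    and v: "\<And>a. a \<in> carrier_vec n \<Longrightarrow> 0 \<le> a \<bullet> (S *\<^sub>v a)"
    and law: "\<And>a. a \<in> carrier_vec n \<Longrightarrow> distr M borel (\<lambda>\<omega>. a \<bullet> X \<omega>) = normal_law (m a) (a \<bullet> (S *\<^sub>v a))"
  shows "cov_mat M n X = S"
proof -
  have mom: "has_bochner_integral M (\<lambda>\<omega>. a \<bullet> X \<omega>) (m a)"
    "has_bochner_integral M (\<lambda>\<omega>. (a \<bullet> X \<omega> - m a)\<^sup>2) (a \<bullet> (S *\<^sub>v a))" if a: "a \<in> carrier_vec n" for a
  proof -
    note [measurable] = random_vec_scalar_prod_measurable[OF X, of a]
    show "has_bochner_integral M (\<lambda>\<omega>. a \<bullet> X \<omega>) (m a)"
      using normal_law_moments(1)[OF v[OF a], of "m a"] unfolding law[OF a, symmetric]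
      by (auto simp: has_bochner_integral_iff integrable_distr_eq integral_distr)
    show "has_bochner_integral M (\<lambda>\<omega>. (a \<bullet> X \<omega> - m a)\<^sup>2) (a \<bullet> (S *\<^sub>v a))"
      using normal_law_moments(2)[OF v[OF a], of "m a"] unfolding law[OF a, symmetric]
      by (auto simp: has_bochner_integral_iff integrable_distr_eq integral_distr)
  qed
  have Xc: "X \<omega> \<in> carrier_vec n" if "\<omega> \<in> space M" for \<omega> using X that by (simp add: random_vec_def)
  have Xi: "unit_vec n i \<bullet> X \<omega> = X \<omega> $ i" if "\<omega> \<in> space M" "i < n" for \<omega> i
    using Xc[OF that(1)] that(2) by simp
  define e where "e i = m (unit_vec n i)" for i
  have E: "has_bochner_integral M (\<lambda>\<omega>. X \<omega> $ i) (e i)" if i: "i < n" for i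
    using mom(1)[of "unit_vec n i"] i unfolding e_def
    by (subst has_bochner_integral_cong[where g = "\<lambda>\<omega>. unit_vec n i \<bullet> X \<omega>" and N = M]) (auto simp: Xi)
  have V: "has_bochner_integral M (\<lambda>\<omega>. (X \<omega> $ i - e i)\<^sup>2) (S $$ (i, i))" if i: "i < n" for i
    using mom(2)[of "unit_vec n i"] i S unfolding e_def
    by (subst has_bochner_integral_cong[where g = "\<lambda>\<omega>. (unit_vec n i \<bullet> X \<omega> - m (unit_vec n i))\<^sup>2" and N = M]) (auto simp: Xi)
  have C: "has_bochner_integral M (\<lambda>\<omega>. (X \<omega> $ i - e i) * (X \<omega> $ j - e j)) (S $$ (i, j))"
    if ij: "i < n" "j < n" for i j
  proof -
    let ?a = "unit_vec n i + unit_vec n j :: real vec"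
    have aX: "?a \<bullet> X \<omega> = X \<omega> $ i + X \<omega> $ j" if "\<omega> \<in> space M" for \<omega>
      using Xc[OF that] ij by (simp add: add_scalar_prod_distrib[of _ n])
    have "has_bochner_integral M (\<lambda>\<omega>. ?a \<bullet> X \<omega>) (e i + e j)"
      using has_bochner_integral_add[OF E[OF ij(1)] E[OF ij(2)]]
      by (subst has_bochner_integral_cong[where g = "\<lambda>\<omega>. X \<omega> $ i + X \<omega> $ j" and N = M]) (auto simp: aX)
    then have ma: "m ?a = e i + e j"
      using mom(1)[of ?a] ij by (intro has_bochner_integral_eq) auto
    have "S $$ (j, i) = S $$ (i, j)"
      using S ij by (metis carrier_matD index_transpose_mat(1))
    then have "?a \<bullet> (S *\<^sub>v ?a) = S $$ (i, i) + 2 * S $$ (i, j) + S $$ (j, j)"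
      using S ij by (simp add: mult_add_distrib_mat_vec[of _ n n] add_scalar_prod_distrib[of _ n] scalar_prod_add_distrib[of _ n])
    then have "has_bochner_integral M (\<lambda>\<omega>. (?a \<bullet> X \<omega> - m ?a)\<^sup>2) (S $$ (i, i) + 2 * S $$ (i, j) + S $$ (j, j))"
      using mom(2)[of ?a] ij by simp
    then have "has_bochner_integral M (\<lambda>\<omega>. ((?a \<bullet> X \<omega> - m ?a)\<^sup>2 - (X \<omega> $ i - e i)\<^sup>2 - (X \<omega> $ j - e j)\<^sup>2) / 2)
      ((S $$ (i, i) + 2 * S $$ (i, j) + S $$ (j, j) - S $$ (i, i) - S $$ (j, j)) / 2)"
      by (intro has_bochner_integral_divide_zero has_bochner_integral_diff V ij)
    also have "(S $$ (i, i) + 2 * S $$ (i, j) + S $$ (j, j) - S $$ (i, i) - S $$ (j, j)) / 2 = S $$ (i, j)"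
      by simp
    finally show ?thesis
      by (subst has_bochner_integral_cong[where N = M and g = "\<lambda>\<omega>. ((?a \<bullet> X \<omega> - m ?a)\<^sup>2 - (X \<omega> $ i - e i)\<^sup>2 - (X \<omega> $ j - e j)\<^sup>2) / 2"])
        (auto simp: aX ma power2_eq_square algebra_simps)
  qed
  show ?thesis
  proof (rule eq_matI)
    fix i j assume "i < dim_row S" "j < dim_col S"
    then have ij: "i < n" "j < n" using S by auto
    have "(LINT \<omega>'|M. X \<omega>' $ i) = e i" "(LINT \<omega>'|M. X \<omega>' $ j) = e j"
      using E ij by (auto intro: has_bochner_integral_integral_eq)
    then show "cov_mat M n X $$ (i, j) = S $$ (i, j)"
      using has_bochner_integral_integral_eq[OF C[OF ij]] ij by (simp add: cov_mat_def)
  qed (use S in \<open>auto simp: cov_mat_def\<close>)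
qed

text \<open>Joint normality expressed by the blocks, with the linear forms in \<open>X\<close> and \<open>Y\<close> kept apart, so that
exchanging the two vectors and passing to the pair \<open>(X, X)\<close> need no manipulation of block matrices.
The explicit nonnegativity of the variance is positivity of the joint covariance matrix.\<close>

definition gaussian_pair ::
  "'a measure \<Rightarrow> nat \<Rightarrow> ('a \<Rightarrow> real vec) \<Rightarrow> ('a \<Rightarrow> real vec) \<Rightarrow> real mat \<Rightarrow> real mat \<Rightarrow> real mat \<Rightarrow> bool" where
  "gaussian_pair M n X Y SX SXY SY \<longleftrightarrow> random_vec M n X \<and> random_vec M n Y \<and> SXY \<in> carrier_mat n n \<and>
     (\<exists>\<mu>\<^sub>1 \<in> carrier_vec n. \<exists>\<mu>\<^sub>2 \<in> carrier_vec n. \<forall>a \<in> carrier_vec n. \<forall>b \<in> carrier_vec n.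
       0 \<le> a \<bullet> (SX *\<^sub>v a) + 2 * (a \<bullet> (SXY *\<^sub>v b)) + b \<bullet> (SY *\<^sub>v b) \<and>
       distr M borel (\<lambda>\<omega>. a \<bullet> X \<omega> + b \<bullet> Y \<omega>)
         = normal_law (a \<bullet> \<mu>\<^sub>1 + b \<bullet> \<mu>\<^sub>2) (a \<bullet> (SX *\<^sub>v a) + 2 * (a \<bullet> (SXY *\<^sub>v b)) + b \<bullet> (SY *\<^sub>v b)))"

lemma mv_normal_gaussian_pair:
  assumes X: "random_vec M n X" and Y: "random_vec M n Y"
    and S: "SX \<in> carrier_mat n n" "SXY \<in> carrier_mat n n" "SY \<in> carrier_mat n n"
    and N: "mv_normal M (2 * n) (\<lambda>\<omega>. X \<omega> @\<^sub>v Y \<omega>) \<mu> (four_block_mat SX SXY (transpose_mat SXY) SY)"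
  shows "gaussian_pair M n X Y SX SXY SY"
  unfolding gaussian_pair_def
proof (intro conjI X Y S, rule bexI[OF bexI[OF _ vec_last_carrier[of \<mu> n]] vec_first_carrier[of \<mu> n]], intro ballI conjI)
  let ?S = "four_block_mat SX SXY (transpose_mat SXY) SY"
  have \<mu>: "\<mu> \<in> carrier_vec (n + n)" using N by (simp add: mv_normal_def mult_2)
  fix a b :: "real vec" assume a: "a \<in> carrier_vec n" and b: "b \<in> carrier_vec n"
  have ab: "a @\<^sub>v b \<in> carrier_vec (2 * n)" using a b by (simp add: mult_2)
  have "b \<bullet> (transpose_mat SXY *\<^sub>v a) = a \<bullet> (SXY *\<^sub>v b)"
    using transpose_vec_mult_scalar[OF S(2) b a] comm_scalar_prod[OF b, of "transpose_mat SXY *\<^sub>v a"] S a by simp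
  then have q: "(a @\<^sub>v b) \<bullet> (?S *\<^sub>v (a @\<^sub>v b)) = a \<bullet> (SX *\<^sub>v a) + 2 * (a \<bullet> (SXY *\<^sub>v b)) + b \<bullet> (SY *\<^sub>v b)"
    using S a b
    by (subst four_block_mat_mult_vec[of _ n n _ n _ n])
      (auto simp: scalar_prod_append[of _ n _ n] scalar_prod_add_distrib[of _ n])
  have "\<mu> = vec_first \<mu> n @\<^sub>v vec_last \<mu> n" using \<mu> by simp
  then have m: "(a @\<^sub>v b) \<bullet> \<mu> = a \<bullet> vec_first \<mu> n + b \<bullet> vec_last \<mu> n"
    using a b by (metis scalar_prod_append vec_first_carrier vec_last_carrier)
  show "0 \<le> a \<bullet> (SX *\<^sub>v a) + 2 * (a \<bullet> (SXY *\<^sub>v b)) + b \<bullet> (SY *\<^sub>v b)"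
    using N ab unfolding q[symmetric] by (simp add: mv_normal_def pos_semidef_def)
  have "distr M borel (\<lambda>\<omega>. a \<bullet> X \<omega> + b \<bullet> Y \<omega>) = distr M borel (\<lambda>\<omega>. (a @\<^sub>v b) \<bullet> (X \<omega> @\<^sub>v Y \<omega>))"
    using X Y a b by (intro distr_cong) (auto simp: random_vec_def scalar_prod_append[of _ n _ n])
  then show "distr M borel (\<lambda>\<omega>. a \<bullet> X \<omega> + b \<bullet> Y \<omega>)
    = normal_law (a \<bullet> vec_first \<mu> n + b \<bullet> vec_last \<mu> n) (a \<bullet> (SX *\<^sub>v a) + 2 * (a \<bullet> (SXY *\<^sub>v b)) + b \<bullet> (SY *\<^sub>v b))"
    using N ab by (simp add: mv_normal_def q m)
qed

lemma gaussian_pair_swap: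
  assumes P: "gaussian_pair M n X Y SX SXY SY"
  shows "gaussian_pair M n Y X SY (transpose_mat SXY) SX"
proof -
  have S: "SXY \<in> carrier_mat n n" "transpose_mat SXY \<in> carrier_mat n n"
    and X: "random_vec M n X" and Y: "random_vec M n Y"
    using P by (auto simp: gaussian_pair_def)
  have t: "b \<bullet> (transpose_mat SXY *\<^sub>v a) = a \<bullet> (SXY *\<^sub>v b)"
    if a: "a \<in> carrier_vec n" and b: "b \<in> carrier_vec n" for a b
    using transpose_vec_mult_scalar[OF S(1) b a] comm_scalar_prod[OF b, of "transpose_mat SXY *\<^sub>v a"] S a by simp
  obtain \<mu>\<^sub>1 \<mu>\<^sub>2 where \<mu>: "\<mu>\<^sub>1 \<in> carrier_vec n" "\<mu>\<^sub>2 \<in> carrier_vec n"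
    and H: "\<And>a b. a \<in> carrier_vec n \<Longrightarrow> b \<in> carrier_vec n \<Longrightarrow>
       0 \<le> a \<bullet> (SX *\<^sub>v a) + 2 * (a \<bullet> (SXY *\<^sub>v b)) + b \<bullet> (SY *\<^sub>v b) \<and>
       distr M borel (\<lambda>\<omega>. a \<bullet> X \<omega> + b \<bullet> Y \<omega>)
         = normal_law (a \<bullet> \<mu>\<^sub>1 + b \<bullet> \<mu>\<^sub>2) (a \<bullet> (SX *\<^sub>v a) + 2 * (a \<bullet> (SXY *\<^sub>v b)) + b \<bullet> (SY *\<^sub>v b))"
    using P unfolding gaussian_pair_def by blast
  show ?thesis
    unfolding gaussian_pair_def
  proof (intro conjI X Y S, rule bexI[OF bexI[OF _ \<mu>(1)] \<mu>(2)], intro ballI conjI)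
    fix b a :: "real vec" assume b: "b \<in> carrier_vec n" and a: "a \<in> carrier_vec n"
    have e: "b \<bullet> (SY *\<^sub>v b) + 2 * (b \<bullet> (transpose_mat SXY *\<^sub>v a)) + a \<bullet> (SX *\<^sub>v a)
      = a \<bullet> (SX *\<^sub>v a) + 2 * (a \<bullet> (SXY *\<^sub>v b)) + b \<bullet> (SY *\<^sub>v b)"
      by (simp add: t[OF a b])
    show "0 \<le> b \<bullet> (SY *\<^sub>v b) + 2 * (b \<bullet> (transpose_mat SXY *\<^sub>v a)) + a \<bullet> (SX *\<^sub>v a)"
      unfolding e using H[OF a b] by simp
    show "distr M borel (\<lambda>\<omega>. b \<bullet> Y \<omega> + a \<bullet> X \<omega>)
      = normal_law (b \<bullet> \<mu>\<^sub>2 + a \<bullet> \<mu>\<^sub>1) (b \<bullet> (SY *\<^sub>v b) + 2 * (b \<bullet> (transpose_mat SXY *\<^sub>v a)) + a \<bullet> (SX *\<^sub>v a))"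
      unfolding e using H[OF a b] by (simp add: add.commute)
  qed
qed

lemma gaussian_pair_marginal:
  assumes P: "gaussian_pair M n X Y SX SXY SY" and SY: "SY \<in> carrier_mat n n"
  obtains \<mu>\<^sub>1 where "\<mu>\<^sub>1 \<in> carrier_vec n"
    "\<And>a. a \<in> carrier_vec n \<Longrightarrow> distr M borel (\<lambda>\<omega>. a \<bullet> X \<omega>) = normal_law (a \<bullet> \<mu>\<^sub>1) (a \<bullet> (SX *\<^sub>v a))"
proof -
  have S: "SXY \<in> carrier_mat n n" and X: "random_vec M n X" and Y: "random_vec M n Y"
    using P by (auto simp: gaussian_pair_def)
  obtain \<mu>\<^sub>1 \<mu>\<^sub>2 where \<mu>: "\<mu>\<^sub>1 \<in> carrier_vec n" "\<mu>\<^sub>2 \<in> carrier_vec n"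
    and H: "\<And>a b. a \<in> carrier_vec n \<Longrightarrow> b \<in> carrier_vec n \<Longrightarrow>
       distr M borel (\<lambda>\<omega>. a \<bullet> X \<omega> + b \<bullet> Y \<omega>)
         = normal_law (a \<bullet> \<mu>\<^sub>1 + b \<bullet> \<mu>\<^sub>2) (a \<bullet> (SX *\<^sub>v a) + 2 * (a \<bullet> (SXY *\<^sub>v b)) + b \<bullet> (SY *\<^sub>v b))"
    using P unfolding gaussian_pair_def by blast
  show thesis
  proof
    fix a :: "real vec" assume a: "a \<in> carrier_vec n"
    have z: "B *\<^sub>v 0\<^sub>v n = 0\<^sub>v n" if "B \<in> carrier_mat n n" for B :: "real mat"
      using that by (intro eq_vecI) auto
    have "distr M borel (\<lambda>\<omega>. a \<bullet> X \<omega>) = distr M borel (\<lambda>\<omega>. a \<bullet> X \<omega> + 0\<^sub>v n \<bullet> Y \<omega>)"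
      using Y by (intro distr_cong) (auto simp: random_vec_def)
    then show "distr M borel (\<lambda>\<omega>. a \<bullet> X \<omega>) = normal_law (a \<bullet> \<mu>\<^sub>1) (a \<bullet> (SX *\<^sub>v a))"
      using H[OF a, of "0\<^sub>v n"] a \<mu> z[OF S] z[OF SY] by simp
  qed (rule \<mu>)
qed

text \<open>Needed for the denominator of the distance correlation: \<open>(X, X)\<close> has all covariance blocks equal to \<open>\<Sigma>\<^sub>X\<close>.\<close>

lemma gaussian_pair_diag:
  assumes P: "gaussian_pair M n X Y SX SXY SY" and SX: "pos_semidef n SX" and SY: "SY \<in> carrier_mat n n"
  shows "gaussian_pair M n X X SX SX SX"
proof -
  have X: "random_vec M n X" using P by (simp add: gaussian_pair_def)
  have Sc: "SX \<in> carrier_mat n n" and St: "transpose_mat SX = SX" using SX by (auto simp: pos_semidef_def)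
  obtain \<mu>\<^sub>1 where \<mu>: "\<mu>\<^sub>1 \<in> carrier_vec n"
    and H: "\<And>a. a \<in> carrier_vec n \<Longrightarrow> distr M borel (\<lambda>\<omega>. a \<bullet> X \<omega>) = normal_law (a \<bullet> \<mu>\<^sub>1) (a \<bullet> (SX *\<^sub>v a))"
    using gaussian_pair_marginal[OF P SY] by blast
  show ?thesis
    unfolding gaussian_pair_def
  proof (intro conjI X Sc bexI[OF _ \<mu>] ballI)
    fix a b :: "real vec" assume a: "a \<in> carrier_vec n" and b: "b \<in> carrier_vec n"
    have "b \<bullet> (SX *\<^sub>v a) = a \<bullet> (SX *\<^sub>v b)"
      using sym_mat_scalar_prod[OF Sc St a b] comm_scalar_prod[OF b, of "SX *\<^sub>v a"] Sc a by simp
    then have q: "(a + b) \<bullet> (SX *\<^sub>v (a + b)) = a \<bullet> (SX *\<^sub>v a) + 2 * (a \<bullet> (SX *\<^sub>v b)) + b \<bullet> (SX *\<^sub>v b)"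
      using Sc a b
      by (simp add: mult_add_distrib_mat_vec[of _ n n] add_scalar_prod_distrib[of _ n] scalar_prod_add_distrib[of _ n])
    show "0 \<le> a \<bullet> (SX *\<^sub>v a) + 2 * (a \<bullet> (SX *\<^sub>v b)) + b \<bullet> (SX *\<^sub>v b)"
      unfolding q[symmetric] using SX a b by (simp add: pos_semidef_def)
    have "distr M borel (\<lambda>\<omega>. a \<bullet> X \<omega> + b \<bullet> X \<omega>) = distr M borel (\<lambda>\<omega>. (a + b) \<bullet> X \<omega>)"
      using X a b by (intro distr_cong) (auto simp: random_vec_def add_scalar_prod_distrib[of _ n])
    then show "distr M borel (\<lambda>\<omega>. a \<bullet> X \<omega> + b \<bullet> X \<omega>)
      = normal_law (a \<bullet> \<mu>\<^sub>1 + b \<bullet> \<mu>\<^sub>1) (a \<bullet> (SX *\<^sub>v a) + 2 * (a \<bullet> (SX *\<^sub>v b)) + b \<bullet> (SX *\<^sub>v b))"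
      using H[of "a + b"] a b \<mu> by (simp add: q add_scalar_prod_distrib[of _ n])
  qed
qed

lemma gaussian_pair_cov_mat:
  assumes P: "gaussian_pair M n X Y SX SXY SY" and SX: "pos_semidef n SX" and SY: "SY \<in> carrier_mat n n"
  shows "cov_mat M n X = SX"
proof -
  obtain \<mu>\<^sub>1 where "\<And>a. a \<in> carrier_vec n \<Longrightarrow> distr M borel (\<lambda>\<omega>. a \<bullet> X \<omega>) = normal_law (a \<bullet> \<mu>\<^sub>1) (a \<bullet> (SX *\<^sub>v a))"
    using gaussian_pair_marginal[OF P SY] by blast
  then show ?thesis
    using P SX by (intro cov_mat_eqI[where m = "\<lambda>a. a \<bullet> \<mu>\<^sub>1"]) (auto simp: gaussian_pair_def pos_semidef_def)
qed

definition whitened_cross_cov :: "real mat \<Rightarrow> real mat \<Rightarrow> real mat \<Rightarrow> real mat" where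
  "whitened_cross_cov SX SXY SY = mat_inv_sqrt SX * SXY * mat_inv_sqrt SY"

lemma whitened_variance:
  assumes SX: "pos_def n SX" and SY: "pos_def n SY" and S: "SXY \<in> carrier_mat n n"
    and s: "s \<in> carrier_vec n" and t: "t \<in> carrier_vec n"
  defines "a \<equiv> mat_inv_sqrt SX *\<^sub>v s" and "b \<equiv> mat_inv_sqrt SY *\<^sub>v t"
  shows "a \<bullet> (SX *\<^sub>v a) + 2 * (a \<bullet> (SXY *\<^sub>v b)) + b \<bullet> (SY *\<^sub>v b)
    = s \<bullet> s + 2 * (s \<bullet> (whitened_cross_cov SX SXY SY *\<^sub>v t)) + t \<bullet> t"
proof -
  note WX = mat_inv_sqrt_pos_def[OF SX] and WY = mat_inv_sqrt_pos_def[OF SY]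
  have c: "SX \<in> carrier_mat n n" "SY \<in> carrier_mat n n" using SX SY by (auto simp: pos_def_def)
  have gen: "(W *\<^sub>v u) \<bullet> (B *\<^sub>v (W' *\<^sub>v v)) = u \<bullet> ((W * B * W') *\<^sub>v v)"
    if "W \<in> carrier_mat n n" "transpose_mat W = W" "B \<in> carrier_mat n n" "W' \<in> carrier_mat n n"
      "u \<in> carrier_vec n" "v \<in> carrier_vec n" for W B W' :: "real mat" and u v
    using sym_mat_scalar_prod[of W n u "B *\<^sub>v (W' *\<^sub>v v)"] that
    by (simp add: assoc_mult_mat_vec[of _ n n _ n])
  show ?thesis
    unfolding a_def b_def whitened_cross_cov_def
    using gen[OF WX(1,2) c(1) WX(1) s s] gen[OF WX(1,2) S WY(1) s t] gen[OF WY(1,2) c(2) WY(1) t t]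
      WX(3) WY(3) s t by simp
qed

text \<open>The variance of \<open>s \<bullet> U + t \<bullet> V\<close> for the whitened vectors \<open>U, V\<close> is \<open>|s|\<^sup>2 + 2 <s, A t> + |t|\<^sup>2\<close>. It is
nonnegative, and the choice \<open>s = - A t\<close> turns this into \<open>|A t|\<^sup>2 \<le> |t|\<^sup>2\<close>.\<close>

lemma whitened_contraction:
  assumes P: "gaussian_pair M n X Y SX SXY SY" and SX: "pos_def n SX" and SY: "pos_def n SY"
    and t: "t \<in> carrier_vec n"
  defines "A \<equiv> whitened_cross_cov SX SXY SY"
  shows "(A *\<^sub>v t) \<bullet> (A *\<^sub>v t) \<le> t \<bullet> t"
proof -
  have S: "SXY \<in> carrier_mat n n" using P by (simp add: gaussian_pair_def)
  note WX = mat_inv_sqrt_pos_def[OF SX] and WY = mat_inv_sqrt_pos_def[OF SY]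
  have A: "A \<in> carrier_mat n n" using S WX(1) WY(1) by (simp add: A_def whitened_cross_cov_def)
  define s where "s = - (A *\<^sub>v t)"
  have s: "s \<in> carrier_vec n" using A t by (simp add: s_def)
  have "0 \<le> s \<bullet> s + 2 * (s \<bullet> (A *\<^sub>v t)) + t \<bullet> t"
    unfolding A_def whitened_variance[OF SX SY S s t, symmetric]
    using P WX(1) WY(1) s t by (auto simp: gaussian_pair_def)
  then show ?thesis using A t by (simp add: s_def)
qed

text \<open>The means enter the characteristic function only through a factor of modulus one, which is multiplicative
in \<open>(s, t)\<close> and therefore common to both terms of the difference.\<close>

lemma joint_char_whitened:
  assumes P: "gaussian_pair M n X Y SX SXY SY" and SX: "pos_def n SX" and SY: "pos_def n SY"
    and s: "s \<in> carrier_vec n" and t: "t \<in> carrier_vec n"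
  defines "U \<equiv> \<lambda>\<omega>. mat_inv_sqrt SX *\<^sub>v X \<omega>" and "V \<equiv> \<lambda>\<omega>. mat_inv_sqrt SY *\<^sub>v Y \<omega>"
    and "A \<equiv> whitened_cross_cov SX SXY SY"
  shows "(cmod (joint_char M U V s t - joint_char M U V s (0\<^sub>v n) * joint_char M U V (0\<^sub>v n) t))\<^sup>2
    = exp (- (s \<bullet> s)) * exp (- (t \<bullet> t)) * (1 - exp (- (s \<bullet> (A *\<^sub>v t))))\<^sup>2"
proof -
  note WX = mat_inv_sqrt_pos_def[OF SX] and WY = mat_inv_sqrt_pos_def[OF SY]
  let ?WX = "mat_inv_sqrt SX" and ?WY = "mat_inv_sqrt SY"
  have S: "SXY \<in> carrier_mat n n" and X: "random_vec M n X" and Y: "random_vec M n Y"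
    using P by (auto simp: gaussian_pair_def)
  obtain \<mu>\<^sub>1 \<mu>\<^sub>2 where \<mu>: "\<mu>\<^sub>1 \<in> carrier_vec n" "\<mu>\<^sub>2 \<in> carrier_vec n"
    and H: "\<And>a b. a \<in> carrier_vec n \<Longrightarrow> b \<in> carrier_vec n \<Longrightarrow>
       0 \<le> a \<bullet> (SX *\<^sub>v a) + 2 * (a \<bullet> (SXY *\<^sub>v b)) + b \<bullet> (SY *\<^sub>v b) \<and>
       distr M borel (\<lambda>\<omega>. a \<bullet> X \<omega> + b \<bullet> Y \<omega>)
         = normal_law (a \<bullet> \<mu>\<^sub>1 + b \<bullet> \<mu>\<^sub>2) (a \<bullet> (SX *\<^sub>v a) + 2 * (a \<bullet> (SXY *\<^sub>v b)) + b \<bullet> (SY *\<^sub>v b))"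
    using P unfolding gaussian_pair_def by blast
  define \<alpha> \<beta> where "\<alpha> s = (?WX *\<^sub>v s) \<bullet> \<mu>\<^sub>1" and "\<beta> t = (?WY *\<^sub>v t) \<bullet> \<mu>\<^sub>2" for s t
  have jc: "joint_char M U V s t = exp (\<i> * complex_of_real (\<alpha> s + \<beta> t))
      * complex_of_real (exp (- (s \<bullet> s + 2 * (s \<bullet> (A *\<^sub>v t)) + t \<bullet> t) / 2))"
    if s: "s \<in> carrier_vec n" and t: "t \<in> carrier_vec n" for s t
  proof -
    define a b where "a = ?WX *\<^sub>v s" and "b = ?WY *\<^sub>v t"
    have ab: "a \<in> carrier_vec n" "b \<in> carrier_vec n" using WX(1) WY(1) s t by (auto simp: a_def b_def)
    have [measurable]: "(\<lambda>\<omega>. a \<bullet> X \<omega> + b \<bullet> Y \<omega>) \<in> borel_measurable M"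
      by (intro borel_measurable_add random_vec_scalar_prod_measurable[OF X] random_vec_scalar_prod_measurable[OF Y])
    have "joint_char M U V s t = (LINT \<omega>|M. exp (\<i> * complex_of_real (a \<bullet> X \<omega> + b \<bullet> Y \<omega>)))"
      unfolding joint_char_def
    proof (intro Bochner_Integration.integral_cong refl)
      fix \<omega> assume \<omega>: "\<omega> \<in> space M"
      then have "X \<omega> \<in> carrier_vec n" "Y \<omega> \<in> carrier_vec n" using X Y by (auto simp: random_vec_def)
      then have "s \<bullet> U \<omega> = a \<bullet> X \<omega>" "t \<bullet> V \<omega> = b \<bullet> Y \<omega>"
        using sym_mat_scalar_prod[OF WX(1,2) s] sym_mat_scalar_prod[OF WY(1,2) t]
        by (auto simp: U_def V_def a_def b_def)
      then show "exp (\<i> * complex_of_real (s \<bullet> U \<omega>) + \<i> * complex_of_real (t \<bullet> V \<omega>))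
        = exp (\<i> * complex_of_real (a \<bullet> X \<omega> + b \<bullet> Y \<omega>))"
        by (simp add: distrib_left)
    qed
    also have "\<dots> = (LINT x|distr M borel (\<lambda>\<omega>. a \<bullet> X \<omega> + b \<bullet> Y \<omega>). exp (\<i> * complex_of_real x))"
      by (subst integral_distr) auto
    also have "\<dots> = exp (\<i> * complex_of_real (a \<bullet> \<mu>\<^sub>1 + b \<bullet> \<mu>\<^sub>2))
        * complex_of_real (exp (- (a \<bullet> (SX *\<^sub>v a) + 2 * (a \<bullet> (SXY *\<^sub>v b)) + b \<bullet> (SY *\<^sub>v b)) / 2))"
    proof -
      define m v where "m = a \<bullet> \<mu>\<^sub>1 + b \<bullet> \<mu>\<^sub>2"
        and "v = a \<bullet> (SX *\<^sub>v a) + 2 * (a \<bullet> (SXY *\<^sub>v b)) + b \<bullet> (SY *\<^sub>v b)"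
      have "0 \<le> v" "distr M borel (\<lambda>\<omega>. a \<bullet> X \<omega> + b \<bullet> Y \<omega>) = normal_law m v"
        using H[OF ab] by (auto simp: m_def v_def)
      then show ?thesis unfolding m_def[symmetric] v_def[symmetric] by (simp only: char_normal_law)
    qed
    finally show ?thesis
      using whitened_variance[OF SX SY S s t] unfolding a_def b_def A_def \<alpha>_def \<beta>_def by simp
  qed
  have A: "A \<in> carrier_mat n n" using S WX(1) WY(1) by (simp add: A_def whitened_cross_cov_def)
  have z: "B *\<^sub>v 0\<^sub>v n = 0\<^sub>v n" if "B \<in> carrier_mat n n" for B :: "real mat"
    using that by (intro eq_vecI) auto
  have \<alpha>0: "\<alpha> (0\<^sub>v n) = 0" and \<beta>0: "\<beta> (0\<^sub>v n) = 0"
    using \<mu> z WX(1) WY(1) by (auto simp: \<alpha>_def \<beta>_def)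
  define c where "c = s \<bullet> (A *\<^sub>v t)"
  define g where "g = exp (- (s \<bullet> s) / 2) * exp (- (t \<bullet> t) / 2)"
  have At: "A *\<^sub>v t \<in> carrier_vec n" using A t by simp
  have 1: "joint_char M U V s t = exp (\<i> * complex_of_real (\<alpha> s + \<beta> t)) * complex_of_real (g * exp (- c))"
  proof -
    have "exp (- (s \<bullet> s + 2 * c + t \<bullet> t) / 2) = g * exp (- c)"
      unfolding g_def by (simp add: add_divide_distrib diff_divide_distrib flip: exp_add)
    then show ?thesis using jc[OF s t] by (simp add: c_def)
  qed
  have 2: "joint_char M U V s (0\<^sub>v n) * joint_char M U V (0\<^sub>v n) t
      = exp (\<i> * complex_of_real (\<alpha> s + \<beta> t)) * complex_of_real g"
    using jc[OF s zero_carrier_vec] jc[OF zero_carrier_vec t] s t At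
    by (simp add: \<alpha>0 \<beta>0 z[OF A] g_def exp_add distrib_left)
  have "joint_char M U V s t - joint_char M U V s (0\<^sub>v n) * joint_char M U V (0\<^sub>v n) t
      = exp (\<i> * complex_of_real (\<alpha> s + \<beta> t)) * complex_of_real (g * (exp (- c) - 1))"
    unfolding 1 2 by (simp add: algebra_simps)
  then have "cmod (joint_char M U V s t - joint_char M U V s (0\<^sub>v n) * joint_char M U V (0\<^sub>v n) t) = \<bar>g * (exp (- c) - 1)\<bar>"
    by (simp add: norm_mult norm_exp_i_times del: of_real_mult of_real_add)
  then have "(cmod (joint_char M U V s t - joint_char M U V s (0\<^sub>v n) * joint_char M U V (0\<^sub>v n) t))\<^sup>2 = g\<^sup>2 * (1 - exp (- c))\<^sup>2"
    by (simp add: power_mult_distrib power2_commute)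
  also have "g\<^sup>2 = exp (- (s \<bullet> s)) * exp (- (t \<bullet> t))"
    by (simp add: g_def power2_eq_square flip: exp_add)
  finally show ?thesis by (simp add: c_def)
qed

lemma Lambda_mat_whitened:
  assumes SX: "pos_def n SX" and SY: "pos_def n SY" and S: "SXY \<in> carrier_mat n n"
  defines "A \<equiv> whitened_cross_cov SX SXY SY"
  shows "Lambda_mat SX SXY SY = transpose_mat A * A" "A \<in> carrier_mat n n"
proof -
  note WX = mat_inv_sqrt_pos_def[OF SX] and WY = mat_inv_sqrt_pos_def[OF SY]
  let ?WX = "mat_inv_sqrt SX" and ?WY = "mat_inv_sqrt SY"
  have St: "transpose_mat SXY \<in> carrier_mat n n" using S by simp
  show "A \<in> carrier_mat n n" using S WX(1) WY(1) by (simp add: A_def whitened_cross_cov_def)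
  have "transpose_mat A = ?WY * (transpose_mat SXY * ?WX)"
    using S WX(1,2) WY(1,2) by (simp add: A_def whitened_cross_cov_def transpose_mult[of _ n n _ n])
  then show "Lambda_mat SX SXY SY = transpose_mat A * A"
    unfolding Lambda_mat_def A_def whitened_cross_cov_def WX(4)[symmetric]
    using S St WX(1) WY(1) by (simp add: assoc_mult_mat[of _ n n _ n _ n])
qed

lemma mat_tr_transpose_mult_self:
  assumes A: "(A :: real mat) \<in> carrier_mat n n"
  shows "mat_tr (transpose_mat A * A) = (\<Sum>i<n. \<Sum>j<n. (A $$ (i, j))\<^sup>2)"
proof -
  have "mat_tr (transpose_mat A * A) = (\<Sum>j<n. \<Sum>i<n. (A $$ (i, j))\<^sup>2)"
    using A by (simp add: mat_tr_def scalar_prod_def power2_eq_square lessThan_atLeast0)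
  also have "\<dots> = (\<Sum>i<n. \<Sum>j<n. (A $$ (i, j))\<^sup>2)" by (rule sum.swap)
  finally show ?thesis .
qed

section \<open>Integrals of functions of the norm and a linear form\<close>

text \<open>Fubini and two affine substitutions: for fixed \<open>y\<close> replace \<open>x\<close> by \<open>u = c x + s y\<close>, then for fixed \<open>u\<close> replace
\<open>y\<close> by \<open>v = (y - s u) / c\<close>; the Jacobians \<open>1 / |c|\<close> and \<open>|c|\<close> cancel. When \<open>c = 0\<close> the rotation
only exchanges the axes, up to signs.\<close>

lemma nn_integral_plane_rotation:
  fixes f :: "real \<times> real \<Rightarrow> ennreal"
  assumes [measurable]: "f \<in> borel_measurable (borel \<Otimes>\<^sub>M borel)"
    and cs: "c\<^sup>2 + s\<^sup>2 = 1"
  shows "(\<integral>\<^sup>+x. \<integral>\<^sup>+y. f (c * x + s * y, c * y - s * x) \<partial>lborel \<partial>lborel)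
       = (\<integral>\<^sup>+v. \<integral>\<^sup>+u. f (u, v) \<partial>lborel \<partial>lborel)"
    (is "?L = ?R")
proof (cases "c = 0")
  case False
  have "\<bar>c\<bar> * ?L = (\<integral>\<^sup>+y. \<bar>c\<bar> * (\<integral>\<^sup>+x. f (c * x + s * y, c * y - s * x) \<partial>lborel) \<partial>lborel)"
    by (subst lborel_pair.Fubini') (auto simp: nn_integral_cmult)
  also have "\<dots> = (\<integral>\<^sup>+y. \<integral>\<^sup>+u. f (u, (y - s * u) / c) \<partial>lborel \<partial>lborel)"
  proof (intro nn_integral_cong)
    fix y
    have "c * y - s * x = (y - s * (s * y + c * x)) / c" for x
    proof -
      have "y - s * (s * y + c * x) = c * (c * y - s * x)"
      proof -
        have "y = (c\<^sup>2 + s\<^sup>2) * y" using cs by simp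
        then show ?thesis by (simp add: power2_eq_square algebra_simps)
      qed
      then show ?thesis using False by simp
    qed
    then show "\<bar>c\<bar> * (\<integral>\<^sup>+x. f (c * x + s * y, c * y - s * x) \<partial>lborel)
        = (\<integral>\<^sup>+u. f (u, (y - s * u) / c) \<partial>lborel)"
      using nn_integral_real_affine[of "\<lambda>u. f (u, (y - s * u) / c)" c "s * y"] False
      by (simp add: add.commute)
  qed
  also have "\<dots> = (\<integral>\<^sup>+u. \<integral>\<^sup>+y. f (u, (y - s * u) / c) \<partial>lborel \<partial>lborel)"
    by (rule lborel_pair.Fubini') measurable
  also have "\<dots> = (\<integral>\<^sup>+u. \<bar>c\<bar> * (\<integral>\<^sup>+v. f (u, v) \<partial>lborel) \<partial>lborel)"
  proof (intro nn_integral_cong)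
    fix u
    have "\<bar>c\<bar> * (\<integral>\<^sup>+v. f (u, v) \<partial>lborel)
        = \<bar>c\<bar> * (ennreal \<bar>1 / c\<bar> * (\<integral>\<^sup>+y. f (u, - s * u / c + 1 / c * y) \<partial>lborel))"
      using False by (subst nn_integral_real_affine[of _ "1 / c" "- s * u / c"]) auto
    also have "\<dots> = ennreal (\<bar>c\<bar> * \<bar>1 / c\<bar>) * (\<integral>\<^sup>+y. f (u, - s * u / c + 1 / c * y) \<partial>lborel)"
      by (simp only: ennreal_mult abs_ge_zero mult.assoc)
    also have "\<bar>c\<bar> * \<bar>1 / c\<bar> = 1" using False by simp
    finally show "(\<integral>\<^sup>+y. f (u, (y - s * u) / c) \<partial>lborel) = \<bar>c\<bar> * (\<integral>\<^sup>+v. f (u, v) \<partial>lborel)"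
      by (simp add: diff_divide_distrib)
  qed
  also have "\<dots> = \<bar>c\<bar> * ?R"
    by (subst lborel_pair.Fubini') (auto simp: nn_integral_cmult)
  finally show ?thesis
    using False by (simp add: ennreal_mult_cancel_left)
next
  case True
  then have s: "\<bar>s\<bar> = 1" "s \<noteq> 0" using cs by (auto simp: power2_eq_square abs_if square_eq_1_iff)
  have *: "(\<integral>\<^sup>+y. g (s * y) \<partial>lborel) = (\<integral>\<^sup>+y. g y \<partial>lborel)"
    "(\<integral>\<^sup>+y. g (- (s * y)) \<partial>lborel) = (\<integral>\<^sup>+y. g y \<partial>lborel)"
    if [measurable]: "g \<in> borel_measurable borel" for g :: "real \<Rightarrow> ennreal"
    using nn_integral_real_affine[of g s 0] nn_integral_real_affine[of g "- s" 0] s by auto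
  have "?L = (\<integral>\<^sup>+x. (\<integral>\<^sup>+u. f (u, - (s * x)) \<partial>lborel) \<partial>lborel)"
    using True *(1)[of "\<lambda>u. f (u, - (s * x))" for x] by simp
  also have "\<dots> = ?R"
    using *(2)[of "\<lambda>v. \<integral>\<^sup>+u. f (u, v) \<partial>lborel"] by simp
  finally show ?thesis .
qed

abbreviation lebesgue_pow :: "nat \<Rightarrow> (nat \<Rightarrow> real) measure" where
  "lebesgue_pow p \<equiv> PiM {..<p} (\<lambda>_. lborel)"

abbreviation sqn :: "nat \<Rightarrow> (nat \<Rightarrow> real) \<Rightarrow> real" where
  "sqn p x \<equiv> (\<Sum>i<p. (x i)\<^sup>2)"

abbreviation ip :: "nat \<Rightarrow> (nat \<Rightarrow> real) \<Rightarrow> (nat \<Rightarrow> real) \<Rightarrow> real" where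
  "ip p a x \<equiv> (\<Sum>i<p. a i * x i)"

interpretation lborel_pow: product_sigma_finite "\<lambda>_::nat. lborel :: real measure" ..

lemma nn_integral_lebesgue_pow_Suc:
  assumes "f \<in> borel_measurable (lebesgue_pow (Suc n))"
  shows "(\<integral>\<^sup>+x. f x \<partial>lebesgue_pow (Suc n)) = (\<integral>\<^sup>+x. \<integral>\<^sup>+u. f (x(n := u)) \<partial>lborel \<partial>lebesgue_pow n)"
  using lborel_pow.product_nn_integral_insert[of "{..<n}" n f] assms by (simp add: lessThan_Suc)

text \<open>Rotation invariance of Lebesgue measure, in the form needed here and without orthogonal matrices: the linear form
\<open>a\<close> can be turned into \<open>|a|\<close> times one coordinate. By induction, all coordinates but the newest are already
merged into one, \<open>u\<close>, with coefficient \<open>\<alpha>\<close>; the newest, \<open>v\<close>, has coefficient \<open>\<beta>\<close>, and a rotation of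
the \<open>(u, v)\<close> plane merges the two.\<close>

lemma nn_integral_linear_form_aux:
  fixes G :: "real \<times> real \<Rightarrow> ennreal"
  assumes "G \<in> borel_measurable (borel \<Otimes>\<^sub>M borel)"
  shows "(\<integral>\<^sup>+x. G (sqn (Suc n) x, ip (Suc n) a x) \<partial>lebesgue_pow (Suc n))
    = (\<integral>\<^sup>+y. \<integral>\<^sup>+u. G (u\<^sup>2 + sqn n y, sqrt (sqn (Suc n) a) * u) \<partial>lborel \<partial>lebesgue_pow n)"
  using assms
proof (induction n arbitrary: G)
  case 0
  note [measurable] = 0
  have "(\<integral>\<^sup>+u. G (u\<^sup>2, a 0 * u) \<partial>lborel) = (\<integral>\<^sup>+u. G (u\<^sup>2, \<bar>a 0\<bar> * u) \<partial>lborel)"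
    using nn_integral_real_affine[of "\<lambda>u. G (u\<^sup>2, a 0 * u)" "-1" 0]
    by (cases "a 0 \<ge> 0") auto
  then show ?case
    by (subst nn_integral_lebesgue_pow_Suc) (auto simp: lborel_pow.nn_integral_empty)
next
  case (Suc n)
  note [measurable] = Suc.prems
  define \<alpha> where "\<alpha> = sqrt (sqn (Suc n) a)"
  define \<beta> where "\<beta> = a (Suc n)"
  define r where "r = sqrt (sqn (Suc (Suc n)) a)"
  have r2: "r\<^sup>2 = \<alpha>\<^sup>2 + \<beta>\<^sup>2"
    by (simp add: r_def \<alpha>_def \<beta>_def sum_nonneg)
  have rnn: "r \<ge> 0" by (simp add: r_def sum_nonneg)
  have rot: "(\<integral>\<^sup>+u. \<integral>\<^sup>+v. G (v\<^sup>2 + (u\<^sup>2 + t), \<beta> * v + \<alpha> * u) \<partial>lborel \<partial>lborel)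
    = (\<integral>\<^sup>+v. \<integral>\<^sup>+u. G (u\<^sup>2 + (v\<^sup>2 + t), r * u) \<partial>lborel \<partial>lborel)" for t
  proof (cases "r = 0")
    case True
    then have "\<alpha> = 0" "\<beta> = 0" using r2 by (auto simp: sum_power2_eq_zero_iff)
    then show ?thesis using True by (simp add: add_ac)
  next
    case False
    have 1: "(\<alpha> / r)\<^sup>2 + (\<beta> / r)\<^sup>2 = 1"
      using False by (simp add: power_divide r2[symmetric] flip: add_divide_distrib)
    have 2: "(\<alpha> / r * u + \<beta> / r * v)\<^sup>2 + ((\<alpha> / r * v - \<beta> / r * u)\<^sup>2 + t) = v\<^sup>2 + (u\<^sup>2 + t)" for u v
    proof -
      have "(a * u + b * v)\<^sup>2 + (a * v - b * u)\<^sup>2 = (a\<^sup>2 + b\<^sup>2) * (u\<^sup>2 + v\<^sup>2)" for a b :: real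
        by (simp add: power2_eq_square algebra_simps)
      from this[of "\<alpha> / r" "\<beta> / r"] show ?thesis unfolding 1 by simp
    qed
    have 3: "r * (\<alpha> / r * u + \<beta> / r * v) = \<beta> * v + \<alpha> * u" for u v
      using False by (simp add: field_simps)
    show ?thesis
      using nn_integral_plane_rotation[OF _ 1, of "\<lambda>(u, v). G (u\<^sup>2 + (v\<^sup>2 + t), r * u)"]
      unfolding split_conv 2 3 by simp
  qed
  have "(\<integral>\<^sup>+x. G (sqn (Suc (Suc n)) x, ip (Suc (Suc n)) a x) \<partial>lebesgue_pow (Suc (Suc n)))
      = (\<integral>\<^sup>+x. \<integral>\<^sup>+v. G (v\<^sup>2 + sqn (Suc n) x, \<beta> * v + ip (Suc n) a x) \<partial>lborel \<partial>lebesgue_pow (Suc n))"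
    by (subst nn_integral_lebesgue_pow_Suc) (auto simp: \<beta>_def add_ac)
  also have "\<dots> = (\<integral>\<^sup>+y. \<integral>\<^sup>+u. \<integral>\<^sup>+v. G (v\<^sup>2 + (u\<^sup>2 + sqn n y), \<beta> * v + \<alpha> * u) \<partial>lborel \<partial>lborel \<partial>lebesgue_pow n)"
    using Suc.IH[of "\<lambda>(q, w). \<integral>\<^sup>+v. G (v\<^sup>2 + q, \<beta> * v + w) \<partial>lborel"]
    by (simp add: \<alpha>_def)
  also have "\<dots> = (\<integral>\<^sup>+y. \<integral>\<^sup>+v. \<integral>\<^sup>+u. G (u\<^sup>2 + (v\<^sup>2 + sqn n y), r * u) \<partial>lborel \<partial>lborel \<partial>lebesgue_pow n)"
    by (simp only: rot)
  also have "\<dots> = (\<integral>\<^sup>+y. \<integral>\<^sup>+u. G (u\<^sup>2 + sqn (Suc n) y, r * u) \<partial>lborel \<partial>lebesgue_pow (Suc n))"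
    by (subst nn_integral_lebesgue_pow_Suc) (auto simp: add_ac)
  finally show ?case by (simp add: r_def)
qed

lemma nn_integral_linear_form_cong:
  fixes G :: "real \<times> real \<Rightarrow> ennreal"
  assumes "G \<in> borel_measurable (borel \<Otimes>\<^sub>M borel)" "sqn p a = sqn p b"
  shows "(\<integral>\<^sup>+x. G (sqn p x, ip p a x) \<partial>lebesgue_pow p) = (\<integral>\<^sup>+x. G (sqn p x, ip p b x) \<partial>lebesgue_pow p)"
proof (cases p)
  case 0
  then show ?thesis by simp
next
  case (Suc n)
  show ?thesis
    using assms(2) unfolding Suc by (simp only: nn_integral_linear_form_aux[OF assms(1)])
qed

lemma nn_integral_linear_form_power:
  fixes F :: "real \<Rightarrow> ennreal"
  assumes [measurable]: "F \<in> borel_measurable borel" and i: "i < p" and k: "even k"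
  shows "(\<integral>\<^sup>+x. F (sqn p x) * ennreal (ip p a x ^ k) \<partial>lebesgue_pow p)
    = ennreal (sqrt (sqn p a) ^ k) * (\<integral>\<^sup>+x. F (sqn p x) * ennreal (x i ^ k) \<partial>lebesgue_pow p)"
proof -
  let ?b = "\<lambda>j. if j = i then sqrt (sqn p a) else 0"
  have "sqn p ?b = (\<Sum>j<p. if j = i then sqn p a else 0)"
    by (intro sum.cong) (auto simp: sum_nonneg)
  then have "sqn p a = sqn p ?b"
    using i by simp
  have ipb: "ip p ?b x = sqrt (sqn p a) * x i" for x
    using i by (simp add: if_distrib[of "\<lambda>c. c * _"] cong: if_cong)
  from nn_integral_linear_form_cong[OF _ \<open>sqn p a = sqn p ?b\<close>, of "\<lambda>(q, u). F q * ennreal (u ^ k)"]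
  have "(\<integral>\<^sup>+x. F (sqn p x) * ennreal (ip p a x ^ k) \<partial>lebesgue_pow p)
    = (\<integral>\<^sup>+x. F (sqn p x) * ennreal (ip p ?b x ^ k) \<partial>lebesgue_pow p)"
    by simp
  also have "\<dots> = (\<integral>\<^sup>+x. F (sqn p x) * ennreal ((sqrt (sqn p a) * x i) ^ k) \<partial>lebesgue_pow p)"
    by (simp only: ipb)
  also have "(\<integral>\<^sup>+x. F (sqn p x) * ennreal ((sqrt (sqn p a) * x i) ^ k) \<partial>lebesgue_pow p)
    = (\<integral>\<^sup>+x. ennreal (sqrt (sqn p a) ^ k) * (F (sqn p x) * ennreal (x i ^ k)) \<partial>lebesgue_pow p)"
    using k by (intro nn_integral_cong) (simp add: power_mult_distrib ennreal_mult zero_le_even_power mult_ac sum_nonneg)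
  also have "\<dots> = ennreal (sqrt (sqn p a) ^ k) * (\<integral>\<^sup>+x. F (sqn p x) * ennreal (x i ^ k) \<partial>lebesgue_pow p)"
    using i by (intro nn_integral_cmult) measurable
  finally show ?thesis .
qed

text \<open>Up to the factor \<open>|a|\<^sup>2\<close>, the linear form may be replaced by any coordinate; summing over all of them gives \<open>|x|\<^sup>2\<close>.\<close>

lemma nn_integral_second_moment:
  fixes F :: "real \<Rightarrow> ennreal"
  assumes [measurable]: "F \<in> borel_measurable borel"
  shows "of_nat p * (\<integral>\<^sup>+x. F (sqn p x) * ennreal ((ip p a x)\<^sup>2) \<partial>lebesgue_pow p)
    = ennreal (sqn p a) * (\<integral>\<^sup>+x. F (sqn p x) * ennreal (sqn p x) \<partial>lebesgue_pow p)"
proof -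
  have "of_nat p * (\<integral>\<^sup>+x. F (sqn p x) * ennreal ((ip p a x)\<^sup>2) \<partial>lebesgue_pow p)
    = (\<Sum>i<p. \<integral>\<^sup>+x. F (sqn p x) * ennreal ((ip p a x)\<^sup>2) \<partial>lebesgue_pow p)"
    by simp
  also have "\<dots> = (\<Sum>i<p. ennreal (sqn p a) * (\<integral>\<^sup>+x. F (sqn p x) * ennreal ((x i)\<^sup>2) \<partial>lebesgue_pow p))"
    by (intro sum.cong refl) (subst nn_integral_linear_form_power, auto simp: sum_nonneg)
  also have "\<dots> = ennreal (sqn p a) * (\<integral>\<^sup>+x. (\<Sum>i<p. F (sqn p x) * ennreal ((x i)\<^sup>2)) \<partial>lebesgue_pow p)"
    by (subst nn_integral_sum) (auto simp: sum_distrib_left)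
  also have "(\<lambda>x. \<Sum>i<p. F (sqn p x) * ennreal ((x i)\<^sup>2)) = (\<lambda>x. F (sqn p x) * ennreal (sqn p x))"
    by (simp add: sum_distrib_left[symmetric])
  finally show ?thesis .
qed

text \<open>Let \<open>m\<close> be the integral of \<open>x\<^sub>i^4\<close> against the radial density. The forms \<open>x\<^sub>i + x\<^sub>j\<close> and \<open>x\<^sub>i - x\<^sub>j\<close> have norm \<open>sqrt 2\<close>, so their fourth powers
integrate to \<open>4 m\<close> each; adding them shows that \<open>x\<^sub>i\<^sup>2 x\<^sub>j\<^sup>2\<close> integrates to \<open>m / 3\<close> for \<open>i \<noteq> j\<close>. Expanding
\<open>|x|^4\<close> gives \<open>(p + p (p - 1) / 3) m\<close>, which is \<open>p (p + 2) m / 3\<close>. The case \<open>m = \<infinity>\<close> is separate, because there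
the equation for the mixed moment cannot be solved.\<close>

lemma nn_integral_fourth_moment:
  fixes F :: "real \<Rightarrow> ennreal"
  assumes [measurable]: "F \<in> borel_measurable borel" and p: "p > 0"
  shows "of_nat (p * (p + 2)) * (\<integral>\<^sup>+x. F (sqn p x) * ennreal (ip p a x ^ 4) \<partial>lebesgue_pow p)
    = ennreal (3 * (sqn p a)\<^sup>2) * (\<integral>\<^sup>+x. F (sqn p x) * ennreal ((sqn p x)\<^sup>2) \<partial>lebesgue_pow p)"
proof -
  define m where "m = (\<integral>\<^sup>+x. F (sqn p x) * ennreal (x 0 ^ 4) \<partial>lebesgue_pow p)"
  define I where "I = (\<integral>\<^sup>+x. F (sqn p x) * ennreal ((sqn p x)\<^sup>2) \<partial>lebesgue_pow p)"
  define mm where "mm = (\<lambda>i j. \<integral>\<^sup>+x. F (sqn p x) * ennreal ((x i)\<^sup>2 * (x j)\<^sup>2) \<partial>lebesgue_pow p)"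
  have lin: "(\<integral>\<^sup>+x. F (sqn p x) * ennreal (ip p b x ^ 4) \<partial>lebesgue_pow p) = ennreal ((sqn p b)\<^sup>2) * m" for b
  proof -
    have "sqrt (sqn p b) ^ 4 = ((sqrt (sqn p b))\<^sup>2)\<^sup>2" by (simp flip: power_mult)
    then show ?thesis
      using p unfolding m_def by (subst nn_integral_linear_form_power[of _ 0]) (auto simp: sum_nonneg)
  qed
  have coord: "(\<integral>\<^sup>+x. F (sqn p x) * ennreal (x i ^ 4) \<partial>lebesgue_pow p) = m" if "i < p" for i
    using lin[of "\<lambda>j. if j = i then 1 else 0"] that
    by (simp add: if_distrib[of "\<lambda>c. c * _"] if_distrib[of "\<lambda>c. c\<^sup>2"] cong: if_cong)
  have off: "4 * m + 12 * mm i j = 8 * m" if ij: "i < p" "j < p" "i \<noteq> j" for i j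
  proof -
    have e: "(\<integral>\<^sup>+x. F (sqn p x) * ennreal ((x i + \<sigma> * x j) ^ 4) \<partial>lebesgue_pow p) = 4 * m"
      if \<sigma>: "\<sigma>\<^sup>2 = 1" for \<sigma>
    proof -
      let ?b = "\<lambda>k. (if k = i then 1 else 0) + (if k = j then \<sigma> else 0)"
      have "sqn p ?b = (\<Sum>k<p. (if k = i then 1 else 0) + (if k = j then 1 else 0))"
        using ij(3) \<sigma> by (intro sum.cong) auto
      also have "\<dots> = 2" using ij by (simp add: sum.distrib)
      finally have "sqn p ?b = 2" .
      moreover have "ip p ?b x = x i + \<sigma> * x j" for x
        using ij by (simp add: distrib_right sum.distrib if_distrib[of "\<lambda>c. c * _"] cong: if_cong)
      ultimately show ?thesis using lin[of ?b] by simp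
    qed
    have id: "(u + 1 * v) ^ 4 + (u + (-1) * v) ^ 4 = 2 * u ^ 4 + 2 * v ^ 4 + 12 * (u\<^sup>2 * v\<^sup>2)" for u v :: real
      by (simp add: power2_eq_square power4_eq_xxxx algebra_simps)
    have "8 * m = 4 * m + 4 * m" by (simp flip: distrib_right)
    also have "\<dots> = (\<integral>\<^sup>+x. F (sqn p x) * ennreal ((x i + 1 * x j) ^ 4) \<partial>lebesgue_pow p)
       + (\<integral>\<^sup>+x. F (sqn p x) * ennreal ((x i + (-1) * x j) ^ 4) \<partial>lebesgue_pow p)"
      by (simp only: e[of 1] e[of "-1"] power_one power2_minus)
    also have "\<dots> = (\<integral>\<^sup>+x. F (sqn p x) * ennreal ((x i + 1 * x j) ^ 4) + F (sqn p x) * ennreal ((x i + (-1) * x j) ^ 4) \<partial>lebesgue_pow p)"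
      using ij by (intro nn_integral_add[symmetric]) measurable
    also have "\<dots> = (\<integral>\<^sup>+x. F (sqn p x) * ennreal (2 * x i ^ 4 + 2 * x j ^ 4 + 12 * ((x i)\<^sup>2 * (x j)\<^sup>2)) \<partial>lebesgue_pow p)"
      unfolding id[symmetric] by (intro nn_integral_cong) (simp add: distrib_left)
    also have "\<dots> = (\<integral>\<^sup>+x. 2 * (F (sqn p x) * ennreal (x i ^ 4)) + 2 * (F (sqn p x) * ennreal (x j ^ 4))
        + 12 * (F (sqn p x) * ennreal ((x i)\<^sup>2 * (x j)\<^sup>2)) \<partial>lebesgue_pow p)"
      by (intro nn_integral_cong) (simp add: distrib_left ennreal_mult mult_ac)
    also have "\<dots> = 2 * m + 2 * m + 12 * mm i j"
      using ij by (simp add: nn_integral_add nn_integral_cmult coord mm_def)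
    finally show ?thesis by (simp flip: distrib_right)
  qed
  have I_sum: "I = (\<Sum>i<p. \<Sum>j<p. mm i j)"
  proof -
    have "I = (\<integral>\<^sup>+x. (\<Sum>i<p. \<Sum>j<p. F (sqn p x) * ennreal ((x i)\<^sup>2 * (x j)\<^sup>2)) \<partial>lebesgue_pow p)"
      unfolding I_def
      by (intro nn_integral_cong) (simp add: power2_eq_square[of "sum _ _"] sum_product sum_nonneg flip: sum_distrib_left)
    also have "\<dots> = (\<Sum>i<p. \<Sum>j<p. mm i j)"
    proof -
      have m: "(\<lambda>x. F (sqn p x) * ennreal ((x i)\<^sup>2 * (x j)\<^sup>2)) \<in> borel_measurable (lebesgue_pow p)"
        if "i \<in> {..<p}" "j \<in> {..<p}" for i j
        using that by simp
      have "(\<integral>\<^sup>+x. (\<Sum>i<p. \<Sum>j<p. F (sqn p x) * ennreal ((x i)\<^sup>2 * (x j)\<^sup>2)) \<partial>lebesgue_pow p)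
        = (\<Sum>i<p. \<integral>\<^sup>+x. (\<Sum>j<p. F (sqn p x) * ennreal ((x i)\<^sup>2 * (x j)\<^sup>2)) \<partial>lebesgue_pow p)"
        by (intro nn_integral_sum borel_measurable_sum m)
      also have "\<dots> = (\<Sum>i<p. \<Sum>j<p. mm i j)"
        unfolding mm_def by (intro sum.cong refl nn_integral_sum m)
      finally show ?thesis .
    qed
    finally show ?thesis .
  qed
  have main: "of_nat (p * (p + 2)) * m = 3 * I"
  proof (cases "m = \<infinity>")
    case True
    have "mm 0 0 \<le> I"
      unfolding I_sum using p by (intro order_trans[OF _ member_le_sum[of 0]] member_le_sum[of 0]) auto
    moreover have "mm 0 0 = m" by (simp add: mm_def m_def flip: power_add)
    ultimately have "I = \<infinity>" using True by (simp add: top_unique)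
    then show ?thesis using p True by (simp add: ennreal_mult_eq_top_iff of_nat_eq_0_iff)
  next
    case False
    then obtain m' where m': "m = ennreal m'" "m' \<ge> 0" by (cases m) auto
    have "mm i j = ennreal (if i = j then m' else m' / 3)" if "i < p" "j < p" for i j
    proof (cases "i = j")
      case True
      then show ?thesis using coord[OF that(1)] m' by (simp add: mm_def flip: power_add)
    next
      case ne: False
      note o = off[OF that ne]
      have "mm i j \<noteq> \<infinity>" using o m' by (auto simp: ennreal_mult_eq_top_iff simp flip: ennreal_numeral ennreal_mult)
      then obtain k where k: "mm i j = ennreal k" "k \<ge> 0" by (cases "mm i j") auto
      have "ennreal (4 * m' + 12 * k) = ennreal (8 * m')"
        using o m' k by (simp add: ennreal_mult)
      then have "4 * m' + 12 * k = 8 * m'" using m' k by (subst (asm) ennreal_inj) auto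
      then show ?thesis using ne k by simp
    qed
    then have "I = (\<Sum>i<p. \<Sum>j<p. ennreal (if i = j then m' else m' / 3))"
      unfolding I_sum by simp
    also have "\<dots> = ennreal (\<Sum>i<p. \<Sum>j<p. if i = j then m' else m' / 3)"
      using m' by (subst sum_ennreal sum_ennreal[symmetric]; auto intro!: sum_nonneg)+
    also have "(\<Sum>i<p. \<Sum>j<p. if i = j then m' else m' / 3) = (\<Sum>i<p. \<Sum>j<p. m' / 3 + (if j = i then 2 * m' / 3 else 0))"
      by (intro sum.cong) auto
    also have "\<dots> = real (p * (p + 2)) * m' / 3"
      by (simp add: sum.distrib) (simp add: field_simps)
    finally have I: "I = ennreal (real (p * (p + 2)) * m' / 3)" .
    have "of_nat (p * (p + 2)) * m = ennreal (real (p * (p + 2)) * m')"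
      using m' by (simp only: ennreal_of_nat_eq_real_of_nat ennreal_mult of_nat_0_le_iff)
    also have "\<dots> = ennreal (3 * (real (p * (p + 2)) * m' / 3))" by simp
    also have "\<dots> = 3 * I" unfolding I using m' by (subst ennreal_mult) auto
    finally show ?thesis .
  qed
  have "of_nat (p * (p + 2)) * (ennreal ((sqn p a)\<^sup>2) * m) = ennreal ((sqn p a)\<^sup>2) * (3 * I)"
    unfolding main[symmetric] by (simp add: mult_ac)
  then show ?thesis
    unfolding lin I_def[symmetric] by (simp add: ennreal_mult mult_ac)
qed

text \<open>The surface measure of the unit sphere in \<open>R^p\<close>.\<close>

definition sphere_area :: "nat \<Rightarrow> real" where
  "sphere_area p = real p * unit_ball_vol (real p)"

text \<open>Both measures give the half line up to \<open>r\<close> the volume of a ball of radius \<open>r\<close>, and half lines generate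
the Borel sets.\<close>

lemma distr_lebesgue_pow_norm:
  assumes p: "p > 0"
  shows "distr (lebesgue_pow p) borel (\<lambda>x. sqrt (sqn p x))
    = density lborel (\<lambda>r. ennreal (sphere_area p * r ^ (p - 1)) * indicator {0<..} r)"
    (is "?D = ?E")
proof (rule measure_eqI_generator_eq[where E = "range (\<lambda>a. {..a::real})" and \<Omega> = UNIV and A = "\<lambda>i. {..real i}"])
  show "Int_stable (range (\<lambda>a. {..a::real}))"
    by (auto simp: Int_stable_def)
  have emD: "emeasure ?D {..r} = ennreal (unit_ball_vol p * max 0 r ^ p)" for r
  proof -
    have "emeasure ?D {..r} = emeasure (lebesgue_pow p) ((\<lambda>x. sqrt (sqn p x)) -` {..r} \<inter> space (lebesgue_pow p))"
      by (intro emeasure_distr) auto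
    also have "\<dots> = ennreal (unit_ball_vol p * max 0 r ^ p)"
    proof (cases "r > 0")
      case True
      have "(\<lambda>x. sqrt (sqn p x)) -` {..r} = {f. sqrt (sqn p f) \<le> r}" by auto
      then show ?thesis using emeasure_cball_aux[of "{..<p}" r] True by simp
    next
      case False
      \<comment> \<open>For \<open>r \<le> 0\<close> the set is contained in balls of arbitrarily small radius \<open>e\<close>.\<close>
      have "emeasure (lebesgue_pow p) ((\<lambda>x. sqrt (sqn p x)) -` {..r} \<inter> space (lebesgue_pow p)) \<le> 0"
      proof (rule tendsto_lowerbound)
        have "((\<lambda>e::real. ennreal (unit_ball_vol p * e ^ p)) \<longlongrightarrow> ennreal (unit_ball_vol p * 0 ^ p)) (at_right 0)"
          by (intro tendsto_intros tendsto_ennrealI)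
        moreover have "ennreal (unit_ball_vol p * 0 ^ p) = 0" using p by (simp add: zero_power)
        ultimately show "((\<lambda>e::real. ennreal (unit_ball_vol p * e ^ p)) \<longlongrightarrow> 0) (at_right 0)"
          by (simp only:)
        show "\<forall>\<^sub>F e in at_right 0. emeasure (lebesgue_pow p) ((\<lambda>x. sqrt (sqn p x)) -` {..r} \<inter> space (lebesgue_pow p))
          \<le> ennreal (unit_ball_vol p * e ^ p)"
          using eventually_at_right_less[of "0::real"]
        proof eventually_elim
          case (elim e)
          have "emeasure (lebesgue_pow p) ((\<lambda>x. sqrt (sqn p x)) -` {..r} \<inter> space (lebesgue_pow p))
            \<le> emeasure (lebesgue_pow p) ({f. sqrt (sqn p f) \<le> e} \<inter> space (lebesgue_pow p))"
            using False elim by (intro emeasure_mono) auto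
          also have "\<dots> = ennreal (unit_ball_vol p * e ^ p)"
            using emeasure_cball_aux[of "{..<p}" e] elim by simp
          finally show ?case .
        qed
      qed simp
      then show ?thesis using False p by (simp add: max_def)
    qed
    finally show ?thesis .
  qed
  have emE: "emeasure ?E {..r} = ennreal (unit_ball_vol p * max 0 r ^ p)" for r
  proof -
    have "emeasure ?E {..r} = (\<integral>\<^sup>+x. ennreal (sphere_area p * x ^ (p - 1)) * indicator {0<..} x * indicator {..r} x \<partial>lborel)"
      by (intro emeasure_density) auto
    also have "\<dots> = (\<integral>\<^sup>+x. ennreal (sphere_area p * x ^ (p - 1)) * indicator {0..max 0 r} x \<partial>lborel)"
    proof (rule nn_integral_cong_AE)
      show "AE x in lborel. ennreal (sphere_area p * x ^ (p - 1)) * indicator {0<..} x * indicator {..r} x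
          = ennreal (sphere_area p * x ^ (p - 1)) * indicator {0..max 0 r} x"
        using AE_lborel_singleton[of "0::real"]
        by eventually_elim (auto split: split_indicator)
    qed
    also have "\<dots> = ennreal (unit_ball_vol p * max 0 r ^ p - unit_ball_vol p * 0 ^ p)"
      using p by (intro nn_integral_FTC_Icc)
        (auto intro!: derivative_eq_intros simp: sphere_area_def)
    finally show ?thesis using p by simp
  qed
  show "emeasure ?D X = emeasure ?E X" if "X \<in> range (\<lambda>a. {..a})" for X
    using that emD emE by auto
  show "sets ?D = sigma_sets UNIV (range (\<lambda>a. {..a}))" "sets ?E = sigma_sets UNIV (range (\<lambda>a. {..a}))"
    by (simp_all add: borel_eq_atMost)
  show "(\<Union>i. {..real i}) = UNIV" by (auto intro: real_arch_simple)
  show "emeasure ?D {..real i} \<noteq> \<infinity>" for i by (simp add: emD)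
qed auto

lemma nn_integral_radial:
  fixes f :: "real \<Rightarrow> ennreal"
  assumes [measurable]: "f \<in> borel_measurable borel" and p: "p > 0"
  shows "(\<integral>\<^sup>+x. f (sqrt (sqn p x)) \<partial>lebesgue_pow p)
    = (\<integral>\<^sup>+r. f r * ennreal (sphere_area p * r ^ (p - 1)) * indicator {0<..} r \<partial>lborel)"
proof -
  have "(\<integral>\<^sup>+x. f (sqrt (sqn p x)) \<partial>lebesgue_pow p) = (\<integral>\<^sup>+r. f r \<partial>distr (lebesgue_pow p) borel (\<lambda>x. sqrt (sqn p x)))"
    by (subst nn_integral_distr) auto
  also have "\<dots> = (\<integral>\<^sup>+r. f r * ennreal (sphere_area p * r ^ (p - 1)) * indicator {0<..} r \<partial>lborel)"
    unfolding distr_lebesgue_pow_norm[OF p] by (subst nn_integral_density) (auto simp: mult_ac)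
  finally show ?thesis .
qed

section \<open>The remainder of the hyperbolic cosine\<close>

text \<open>What symmetrisation in \<open>u\<close> leaves of \<open>(1 - exp (-u))\<^sup>2\<close> beyond the quadratic term.\<close>

definition cosh_rem :: "real \<Rightarrow> real" where
  "cosh_rem u = cosh (2 * u) - 2 * cosh u + 1 - u\<^sup>2"

definition cosh_rem_coeff :: "nat \<Rightarrow> real" where
  "cosh_rem_coeff n = (if even n \<and> 4 \<le> n then (2 ^ n - 2) / fact n else 0)"

lemma cosh_rem_coeff_nonneg: "0 \<le> cosh_rem_coeff n"
proof -
  have "(2::real) ^ 1 \<le> 2 ^ n" if "4 \<le> n"
    using that by (intro power_increasing) auto
  then show ?thesis by (auto simp: cosh_rem_coeff_def)
qed

lemma cosh_rem_sums: "(\<lambda>n. cosh_rem_coeff n * u ^ n) sums cosh_rem u"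
proof -
  have c: "(\<lambda>n. if even n then x ^ n / fact n else 0) sums cosh x" for x :: real
    using cosh_converges[of x] by (simp add: scaleR_conv_of_real divide_inverse mult.commute cong: if_cong)
  let ?f = "\<lambda>n. (if even n then (2 * u) ^ n / fact n else 0)
      - 2 * (if even n then u ^ n / fact n else 0)"
  have 1: "?f sums (cosh (2 * u) - 2 * cosh u)"
    by (intro sums_diff sums_mult c)
  have 2: "(\<lambda>n. if n \<in> {0, 2} then ?f n else 0) sums (\<Sum>n\<in>{0,2}. ?f n)"
    by (rule sums_If_finite_set) simp
  have 3: "(\<Sum>n\<in>{0,2}. ?f n) = -1 + u\<^sup>2"
    by (simp add: power_mult_distrib fact_numeral field_simps)
  have "(\<lambda>n. ?f n - (if n \<in> {0, 2} then ?f n else 0)) sums (cosh (2 * u) - 2 * cosh u - (-1 + u\<^sup>2))"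
    using sums_diff[OF 1 2] unfolding 3 .
  moreover have "?f n - (if n \<in> {0, 2} then ?f n else 0) = cosh_rem_coeff n * u ^ n" for n
  proof -
    have "even n \<Longrightarrow> n \<noteq> 0 \<Longrightarrow> n \<noteq> 2 \<Longrightarrow> 4 \<le> n" by presburger
    then show ?thesis
      by (auto simp: cosh_rem_coeff_def power_mult_distrib field_simps)
  qed
  ultimately have "(\<lambda>n. cosh_rem_coeff n * u ^ n) sums (cosh (2 * u) - 2 * cosh u - (-1 + u\<^sup>2))"
    by simp
  then show ?thesis
    by (simp add: cosh_rem_def algebra_simps)
qed

lemma cosh_rem_nonneg: "0 \<le> cosh_rem u"
proof -
  have "0 \<le> cosh_rem_coeff n * u ^ n" for n
  proof (cases "even n")
    case True
    then show ?thesis by (intro mult_nonneg_nonneg cosh_rem_coeff_nonneg zero_le_even_power)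
  qed (simp add: cosh_rem_coeff_def)
  then show ?thesis
    using sums_le[OF _ sums_zero cosh_rem_sums] by blast
qed

text \<open>Termwise, as every power in the series is even and at least the fourth.\<close>

lemma cosh_rem_contract:
  assumes "\<bar>x\<bar> \<le> 1"
  shows "cosh_rem (x * u) \<le> x ^ 4 * cosh_rem u"
proof (rule sums_le[OF _ cosh_rem_sums sums_mult[OF cosh_rem_sums]])
  fix n
  show "cosh_rem_coeff n * (x * u) ^ n \<le> x ^ 4 * (cosh_rem_coeff n * u ^ n)"
  proof (cases "even n \<and> 4 \<le> n")
    case True
    have "x ^ n = \<bar>x\<bar> ^ n" using True by (simp add: power_even_abs)
    also have "\<dots> \<le> \<bar>x\<bar> ^ 4"
      using assms True by (intro power_decreasing) auto
    also have "\<bar>x\<bar> ^ 4 = x ^ 4" by (simp add: power_even_abs)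
    finally have "x ^ n * (cosh_rem_coeff n * u ^ n) \<le> x ^ 4 * (cosh_rem_coeff n * u ^ n)"
      using True by (intro mult_right_mono mult_nonneg_nonneg cosh_rem_coeff_nonneg) (auto simp: zero_le_even_power)
    then show ?thesis by (simp add: power_mult_distrib mult_ac)
  qed (auto simp: cosh_rem_coeff_def)
qed

lemma cosh_rem_le_exp:
  assumes "0 \<le> u"
  shows "cosh_rem u \<le> exp (2 * u)"
proof -
  have "cosh u \<ge> 1" by (rule cosh_real_ge_1)
  moreover have "cosh (2 * u) \<le> exp (2 * u)"
    using assms by (simp add: cosh_def)
  ultimately show ?thesis
    unfolding cosh_rem_def by (smt (verit) zero_le_power2)
qed

text \<open>For small \<open>u\<close> the order of vanishing is decisive, for large \<open>u\<close> the exponential growth.\<close>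

lemma cosh_rem_bound:
  assumes "0 \<le> u"
  shows "(1 + u\<^sup>2) * cosh_rem u \<le> 2 * exp 2 * u\<^sup>2 * exp (2 * u)"
proof (cases "u \<le> 1")
  case True
  have "cosh_rem (u * 1) \<le> u ^ 4 * cosh_rem 1"
    using assms True by (intro cosh_rem_contract) auto
  also have "\<dots> \<le> u ^ 4 * exp 2"
    using cosh_rem_le_exp[of 1] by (intro mult_left_mono) auto
  also have "\<dots> \<le> u\<^sup>2 * exp 2"
    using assms True by (intro mult_right_mono power_decreasing) auto
  also have "\<dots> \<le> u\<^sup>2 * exp 2 * exp (2 * u)"
    using assms mult_left_mono[of 1 "exp (2 * u)" "u\<^sup>2 * exp 2"] by simp
  finally have "cosh_rem u \<le> u\<^sup>2 * exp 2 * exp (2 * u)" by simp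
  moreover have "1 + u\<^sup>2 \<le> 2"
    using assms True by (simp add: power_le_one)
  ultimately have "(1 + u\<^sup>2) * cosh_rem u \<le> 2 * (u\<^sup>2 * exp 2 * exp (2 * u))"
    using cosh_rem_nonneg by (intro mult_mono) auto
  then show ?thesis by (simp add: mult_ac)
next
  case False
  have "(1 + u\<^sup>2) * cosh_rem u \<le> (2 * u\<^sup>2) * exp (2 * u)"
    using False cosh_rem_le_exp[OF assms] cosh_rem_nonneg
    by (intro mult_mono) (auto simp: one_le_power)
  also have "\<dots> \<le> (2 * u\<^sup>2) * exp (2 * u) * exp 2"
    using mult_left_mono[of 1 "exp 2" "(2 * u\<^sup>2) * exp (2 * u)"] by simp
  finally show ?thesis by (simp add: mult_ac)
qed

text \<open>The growth \<open>exp (2 r q)\<close> turns the Gaussian \<open>exp (- r\<^sup>2 - q\<^sup>2)\<close> into \<open>exp (- (q - r)\<^sup>2)\<close>, which does not decay along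
the diagonal. The factor \<open>1 / (1 + (r q)\<^sup>2)\<close> left over from the previous bound supplies the decay: it is at most
\<open>1 / (1 + r\<^sup>2)\<close> up to a factor \<open>3 (1 + (q - r)\<^sup>2)\<close>, which the Gaussian absorbs. In the variables \<open>r\<close> and \<open>q - r\<close>
the resulting bound is a product of integrable functions.\<close>

lemma cosh_rem_kernel_bound:
  assumes "0 < r" "0 < q"
  shows "exp (- r\<^sup>2 - q\<^sup>2) * cosh_rem (r * q) / (r * q)\<^sup>2
    \<le> 12 * exp 2 * (inverse (1 + r\<^sup>2) * inverse (1 + (q - r)\<^sup>2))"
proof -
  define w where "w = q - r"
  have W: "exp (- w\<^sup>2) \<le> 2 / (1 + w\<^sup>2)\<^sup>2"
  proof -
    have "1 + w\<^sup>2 + (w\<^sup>2)\<^sup>2 / 2 \<le> exp (w\<^sup>2)"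
      by (rule exp_lower_Taylor_quadratic) simp
    then have "(1 + w\<^sup>2)\<^sup>2 / 2 \<le> exp (w\<^sup>2)"
      by (simp add: power2_eq_square algebra_simps)
    then show ?thesis
      using add_pos_nonneg[of 1 "w\<^sup>2"] by (simp add: exp_minus field_simps)
  qed
  have R: "1 + r\<^sup>2 \<le> 3 * (1 + (r * q)\<^sup>2) * (1 + w\<^sup>2)"
  proof (cases "q \<ge> 1")
    case True
    have "1 + r\<^sup>2 * 1 \<le> 1 + r\<^sup>2 * q\<^sup>2"
      using True by (intro add_left_mono mult_left_mono) (auto simp: one_le_power)
    also have "\<dots> \<le> (1 + r\<^sup>2 * q\<^sup>2) * (3 * (1 + w\<^sup>2))"
      using mult_left_mono[of 1 "3 * (1 + w\<^sup>2)" "1 + r\<^sup>2 * q\<^sup>2"] by simp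
    finally show ?thesis by (simp add: power_mult_distrib algebra_simps)
  next
    case False
    have "r\<^sup>2 = (q - w)\<^sup>2" by (simp add: w_def)
    also have "\<dots> \<le> 2 * q\<^sup>2 + 2 * w\<^sup>2"
      using zero_le_power2[of "q + w"] by (simp add: power2_eq_square algebra_simps)
    finally have "r\<^sup>2 \<le> 2 * q\<^sup>2 + 2 * w\<^sup>2" .
    moreover have "q\<^sup>2 \<le> 1" using False assms by (simp add: power_le_one)
    ultimately have "1 + r\<^sup>2 \<le> 3 * (1 + w\<^sup>2)" using zero_le_power2[of w] by argo
    also have "\<dots> \<le> 3 * (1 + w\<^sup>2) * (1 + (r * q)\<^sup>2)"
      using mult_left_mono[of 1 "1 + (r * q)\<^sup>2" "3 * (1 + w\<^sup>2)"] by simp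
    finally show ?thesis by (simp add: algebra_simps)
  qed
  have "exp (- r\<^sup>2 - q\<^sup>2) * exp (2 * (r * q)) = exp (- w\<^sup>2)"
    unfolding exp_add[symmetric] w_def by (simp add: power2_eq_square algebra_simps)
  note E = this
  have "cosh_rem (r * q) / (r * q)\<^sup>2 \<le> 2 * exp 2 * exp (2 * (r * q)) / (1 + (r * q)\<^sup>2)"
    using cosh_rem_bound[of "r * q"] assms
    by (simp add: field_simps add_pos_nonneg)
  then have "exp (- r\<^sup>2 - q\<^sup>2) * (cosh_rem (r * q) / (r * q)\<^sup>2)
      \<le> exp (- r\<^sup>2 - q\<^sup>2) * (2 * exp 2 * exp (2 * (r * q)) / (1 + (r * q)\<^sup>2))"
    by (rule mult_left_mono) simp
  also have "\<dots> = 2 * exp 2 * exp (- w\<^sup>2) / (1 + (r * q)\<^sup>2)"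
    unfolding E[symmetric] by simp
  also have "\<dots> \<le> 2 * exp 2 * (2 / (1 + w\<^sup>2)\<^sup>2) / (1 + (r * q)\<^sup>2)"
    using W by (intro divide_right_mono mult_left_mono) auto
  also have "\<dots> = 4 * exp 2 / ((1 + w\<^sup>2)\<^sup>2 * (1 + (r * q)\<^sup>2))"
    by simp
  also have "\<dots> \<le> 12 * exp 2 / ((1 + r\<^sup>2) * (1 + w\<^sup>2))"
  proof -
    have pos: "0 < 1 + r\<^sup>2" "0 < 1 + w\<^sup>2" "0 < 1 + (r * q)\<^sup>2"
      by (auto intro!: add_pos_nonneg)
    have "(1 + r\<^sup>2) * (1 + w\<^sup>2) \<le> 3 * (1 + (r * q)\<^sup>2) * (1 + w\<^sup>2) * (1 + w\<^sup>2)"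
      using R by (intro mult_right_mono) auto
    also have "\<dots> = 3 * ((1 + w\<^sup>2)\<^sup>2 * (1 + (r * q)\<^sup>2))"
      by (simp only: power2_eq_square[of "1 + w\<^sup>2"] mult_ac)
    finally have "12 * exp 2 / (3 * ((1 + w\<^sup>2)\<^sup>2 * (1 + (r * q)\<^sup>2))) \<le> 12 * exp 2 / ((1 + r\<^sup>2) * (1 + w\<^sup>2))"
      using pos by (intro divide_left_mono mult_pos_pos) auto
    then show ?thesis by (simp add: mult.commute)
  qed
  finally show ?thesis by (simp add: w_def divide_inverse)
qed

lemma borel_measurable_cosh_rem [measurable]: "cosh_rem \<in> borel_measurable borel"
  unfolding cosh_rem_def cosh_def by measurable

lemma nn_integral_inverse_1_plus_square_finite:
  "(\<integral>\<^sup>+x. ennreal (inverse (1 + x\<^sup>2)) \<partial>lborel) < \<infinity>"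
proof -
  have "integrable lborel (\<lambda>x::real. inverse (1 + x\<^sup>2))"
    using integrable_inverse_1_plus_square by (simp add: set_integrable_def einterval_def)
  then show ?thesis
    by (subst (asm) integrable_iff_bounded) (simp add: add_nonneg_nonneg)
qed

text \<open>The radial part of the remainder integral. The powers of \<open>r\<close> and \<open>q\<close> that depend on the dimension cancel against the
surface elements, so that the constant does not depend on \<open>p\<close>.\<close>

definition rem_const :: ennreal where
  "rem_const = (\<integral>\<^sup>+q. \<integral>\<^sup>+r. ennreal (exp (- r\<^sup>2 - q\<^sup>2) * cosh_rem (r * q) / (r * q)\<^sup>2)
     * indicator {0<..} r * indicator {0<..} q \<partial>lborel \<partial>lborel)"

lemma rem_const_finite: "rem_const < \<infinity>"
proof -
  let ?I = "\<integral>\<^sup>+x. ennreal (inverse (1 + x\<^sup>2)) \<partial>lborel"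
  have "rem_const \<le> (\<integral>\<^sup>+q. \<integral>\<^sup>+r. ennreal (12 * exp 2) * (ennreal (inverse (1 + r\<^sup>2)) * ennreal (inverse (1 + (q - r)\<^sup>2))) \<partial>lborel \<partial>lborel)"
    unfolding rem_const_def
    by (intro nn_integral_mono)
      (auto split: split_indicator simp: ennreal_mult[symmetric] intro!: ennreal_leI cosh_rem_kernel_bound)
  also have "\<dots> = (\<integral>\<^sup>+r. \<integral>\<^sup>+q. ennreal (12 * exp 2) * (ennreal (inverse (1 + r\<^sup>2)) * ennreal (inverse (1 + (q - r)\<^sup>2))) \<partial>lborel \<partial>lborel)"
    by (rule lborel_pair.Fubini') measurable
  also have "\<dots> = (\<integral>\<^sup>+r. ennreal (12 * exp 2) * (ennreal (inverse (1 + r\<^sup>2)) * ?I) \<partial>lborel)"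
  proof (intro nn_integral_cong)
    fix r :: real
    have "(\<integral>\<^sup>+q. ennreal (inverse (1 + (q - r)\<^sup>2)) \<partial>lborel) = ?I"
      using nn_integral_real_affine[of "\<lambda>x. ennreal (inverse (1 + x\<^sup>2))" 1 "- r"] by simp
    then show "(\<integral>\<^sup>+q. ennreal (12 * exp 2) * (ennreal (inverse (1 + r\<^sup>2)) * ennreal (inverse (1 + (q - r)\<^sup>2))) \<partial>lborel)
      = ennreal (12 * exp 2) * (ennreal (inverse (1 + r\<^sup>2)) * ?I)"
      by (simp add: nn_integral_cmult)
  qed
  also have "\<dots> = ennreal (12 * exp 2) * (?I * ?I)"
    by (simp add: nn_integral_cmult nn_integral_multc)
  also have "\<dots> < \<infinity>"
    using nn_integral_inverse_1_plus_square_finite by (simp add: ennreal_mult_less_top)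
  finally show ?thesis .
qed

section \<open>Bounds for the energy integral\<close>

text \<open>The radial weight of the distance covariance including the Gaussian factor, as a function of the squared norm \<open>q\<close>.
Division by zero makes it vanish at \<open>q = 0\<close>, in agreement with the integrand of the distance covariance.\<close>

definition weight :: "nat \<Rightarrow> real \<Rightarrow> real" where
  "weight p q = exp (- q) / sqrt q ^ (p + 1)"

lemma weight_nonneg: "0 \<le> q \<Longrightarrow> 0 \<le> weight p q"
  by (simp add: weight_def)

lemma weight_0: "weight p 0 = 0"
  by (simp add: weight_def)

lemma borel_measurable_weight [measurable]: "weight p \<in> borel_measurable borel"
  unfolding weight_def by measurable

lemma symmetrise_exp:
  "(1 - exp (- u))\<^sup>2 + (1 - exp u)\<^sup>2 = 2 * (u\<^sup>2 + cosh_rem u)" for u :: real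
proof -
  have "exp (2 * u) = (exp u)\<^sup>2" "exp (- (2 * u)) = (exp (- u))\<^sup>2"
    by (simp_all add: power2_eq_square flip: exp_add)
  then show ?thesis
    by (simp add: cosh_rem_def cosh_def power2_eq_square algebra_simps)
qed

text \<open>Replacing \<open>a\<close> by \<open>-a\<close> does not change the integral, so it equals the mean of the two versions.\<close>

lemma nn_integral_symmetrise:
  fixes F :: "real \<Rightarrow> ennreal"
  assumes [measurable]: "F \<in> borel_measurable borel"
  shows "(\<integral>\<^sup>+x. F (sqn p x) * ennreal ((1 - exp (- ip p a x))\<^sup>2) \<partial>lebesgue_pow p)
    = (\<integral>\<^sup>+x. F (sqn p x) * ennreal ((ip p a x)\<^sup>2) \<partial>lebesgue_pow p)
    + (\<integral>\<^sup>+x. F (sqn p x) * ennreal (cosh_rem (ip p a x)) \<partial>lebesgue_pow p)" (is "?L = ?R")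
proof -
  have neg: "ip p (\<lambda>i. - a i) x = - ip p a x" for x
    by (simp add: sum_negf)
  have "?L = (\<integral>\<^sup>+x. F (sqn p x) * ennreal ((1 - exp (ip p a x))\<^sup>2) \<partial>lebesgue_pow p)"
    using nn_integral_linear_form_cong[where G = "\<lambda>(q, u). F q * ennreal ((1 - exp (- u))\<^sup>2)"
        and p = p and a = a and b = "\<lambda>i. - a i"]
    unfolding split_conv neg by simp
  then have "2 * ?L = (\<integral>\<^sup>+x. F (sqn p x) * ennreal ((1 - exp (- ip p a x))\<^sup>2) \<partial>lebesgue_pow p)
      + (\<integral>\<^sup>+x. F (sqn p x) * ennreal ((1 - exp (ip p a x))\<^sup>2) \<partial>lebesgue_pow p)"
    by (simp add: mult_2)
  also have "\<dots> = (\<integral>\<^sup>+x. F (sqn p x) * ennreal ((1 - exp (- ip p a x))\<^sup>2)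
      + F (sqn p x) * ennreal ((1 - exp (ip p a x))\<^sup>2) \<partial>lebesgue_pow p)"
    by (intro nn_integral_add[symmetric]) measurable
  also have "\<dots> = (\<integral>\<^sup>+x. 2 * (F (sqn p x) * ennreal ((ip p a x)\<^sup>2)
      + F (sqn p x) * ennreal (cosh_rem (ip p a x))) \<partial>lebesgue_pow p)"
  proof (intro nn_integral_cong)
    fix x
    let ?u = "ip p a x"
    have "F (sqn p x) * ennreal ((1 - exp (- ?u))\<^sup>2) + F (sqn p x) * ennreal ((1 - exp ?u)\<^sup>2)
      = F (sqn p x) * ennreal ((1 - exp (- ?u))\<^sup>2 + (1 - exp ?u)\<^sup>2)"
      by (simp add: distrib_left)
    also have "\<dots> = F (sqn p x) * (2 * (ennreal (?u\<^sup>2) + ennreal (cosh_rem ?u)))"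
      unfolding symmetrise_exp by (simp add: ennreal_mult cosh_rem_nonneg)
    finally show "F (sqn p x) * ennreal ((1 - exp (- ?u))\<^sup>2) + F (sqn p x) * ennreal ((1 - exp ?u)\<^sup>2)
      = 2 * (F (sqn p x) * ennreal (?u\<^sup>2) + F (sqn p x) * ennreal (cosh_rem ?u))"
      by (simp add: distrib_left mult_ac)
  qed
  also have "\<dots> = 2 * ?R"
    by (simp add: nn_integral_cmult nn_integral_add)
  finally have "2 * ?L = 2 * ?R" .
  then show ?thesis
    by (subst (asm) ennreal_mult_cancel_left) auto
qed

text \<open>Up to the factor \<open>c\<^sub>p^-2\<close>, the squared affinely invariant distance covariance of a Gaussian pair whose whitened
cross covariance is \<open>A\<close>.\<close>

definition energy :: "nat \<Rightarrow> (nat \<Rightarrow> nat \<Rightarrow> real) \<Rightarrow> ennreal" where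
  "energy p A = (\<integral>\<^sup>+y. \<integral>\<^sup>+x. ennreal (weight p (sqn p x) * weight p (sqn p y)
     * (1 - exp (- ip p (\<lambda>i. ip p (A i) y) x))\<^sup>2) \<partial>lebesgue_pow p \<partial>lebesgue_pow p)"

text \<open>The squared Hilbert--Schmidt norm, which is \<open>tr (A' A)\<close>.\<close>

definition hs_norm2 :: "nat \<Rightarrow> (nat \<Rightarrow> nat \<Rightarrow> real) \<Rightarrow> real" where
  "hs_norm2 p A = (\<Sum>i<p. sqn p (A i))"

lemma hs_norm2_nonneg: "0 \<le> hs_norm2 p A"
  by (simp add: hs_norm2_def sum_nonneg)

lemma nn_integral_second_moment_mat:
  fixes F :: "real \<Rightarrow> ennreal"
  assumes [measurable]: "F \<in> borel_measurable borel"
  shows "of_nat p * (\<integral>\<^sup>+y. F (sqn p y) * ennreal (sqn p (\<lambda>i. ip p (A i) y)) \<partial>lebesgue_pow p)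
    = ennreal (hs_norm2 p A) * (\<integral>\<^sup>+y. F (sqn p y) * ennreal (sqn p y) \<partial>lebesgue_pow p)"
proof -
  have "(\<integral>\<^sup>+y. F (sqn p y) * ennreal (sqn p (\<lambda>i. ip p (A i) y)) \<partial>lebesgue_pow p)
    = (\<integral>\<^sup>+y. (\<Sum>i<p. F (sqn p y) * ennreal ((ip p (A i) y)\<^sup>2)) \<partial>lebesgue_pow p)"
    by (simp flip: sum_distrib_left)
  also have "\<dots> = (\<Sum>i<p. \<integral>\<^sup>+y. F (sqn p y) * ennreal ((ip p (A i) y)\<^sup>2) \<partial>lebesgue_pow p)"
    by (intro nn_integral_sum) measurable
  finally have "of_nat p * (\<integral>\<^sup>+y. F (sqn p y) * ennreal (sqn p (\<lambda>i. ip p (A i) y)) \<partial>lebesgue_pow p)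
    = (\<Sum>i<p. ennreal (sqn p (A i)) * (\<integral>\<^sup>+y. F (sqn p y) * ennreal (sqn p y) \<partial>lebesgue_pow p))"
    by (simp add: sum_distrib_left nn_integral_second_moment)
  also have "\<dots> = ennreal (hs_norm2 p A) * (\<integral>\<^sup>+y. F (sqn p y) * ennreal (sqn p y) \<partial>lebesgue_pow p)"
    by (simp add: hs_norm2_def sum_nonneg flip: sum_distrib_right)
  finally show ?thesis .
qed

lemma sphere_area_pos: "p > 0 \<Longrightarrow> 0 < sphere_area p"
  by (simp add: sphere_area_def)

lemma nn_integral_gaussian_half_line:
  "(\<integral>\<^sup>+r. ennreal (exp (- r\<^sup>2)) * indicator {0<..} r \<partial>lborel) = ennreal (sqrt pi / 2)"
proof -
  have "(\<integral>\<^sup>+r. ennreal (indicator {0..} r *\<^sub>R exp (- r\<^sup>2)) \<partial>lborel) = ennreal (sqrt pi / 2)"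
    by (rule nn_integral_eq_integral[THEN trans])
      (use gaussian_moment_0 in \<open>auto simp: has_bochner_integral_iff\<close>)
  moreover have "(\<integral>\<^sup>+r. ennreal (exp (- r\<^sup>2)) * indicator {0<..} r \<partial>lborel)
      = (\<integral>\<^sup>+r. ennreal (indicator {0..} r *\<^sub>R exp (- r\<^sup>2)) \<partial>lborel)"
  proof (rule nn_integral_cong_AE)
    show "AE r in lborel. ennreal (exp (- r\<^sup>2)) * indicator {0<..} r = ennreal (indicator {0..} r *\<^sub>R exp (- r\<^sup>2))"
      using AE_lborel_singleton[of "0::real"] by eventually_elim (auto split: split_indicator)
  qed
  ultimately show ?thesis by simp
qed

lemma nn_integral_weight_sqn:
  assumes p: "p > 0"
  shows "(\<integral>\<^sup>+x. ennreal (weight p (sqn p x)) * ennreal (sqn p x) \<partial>lebesgue_pow p)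
    = ennreal (sphere_area p * (sqrt pi / 2))"
proof -
  let ?f = "\<lambda>r. ennreal (weight p (r\<^sup>2)) * ennreal (r\<^sup>2)"
  have "(\<integral>\<^sup>+x. ennreal (weight p (sqn p x)) * ennreal (sqn p x) \<partial>lebesgue_pow p)
    = (\<integral>\<^sup>+x. ?f (sqrt (sqn p x)) \<partial>lebesgue_pow p)"
    by (simp add: sum_nonneg)
  also have "\<dots> = (\<integral>\<^sup>+r. ?f r * ennreal (sphere_area p * r ^ (p - 1)) * indicator {0<..} r \<partial>lborel)"
    by (rule nn_integral_radial[OF _ p]) measurable
  also have "\<dots> = (\<integral>\<^sup>+r. ennreal (sphere_area p) * (ennreal (exp (- r\<^sup>2)) * indicator {0<..} r) \<partial>lborel)"
  proof (intro nn_integral_cong)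
    fix r :: real
    obtain k where k: "p = Suc k" using p by (cases p) auto
    have "weight p (r\<^sup>2) * r\<^sup>2 * (sphere_area p * r ^ (p - 1)) = sphere_area p * exp (- r\<^sup>2)" if "r > 0"
      using that by (simp add: weight_def k power2_eq_square field_simps)
    then show "?f r * ennreal (sphere_area p * r ^ (p - 1)) * indicator {0<..} r
      = ennreal (sphere_area p) * (ennreal (exp (- r\<^sup>2)) * indicator {0<..} r)"
      using sphere_area_pos[OF p] by (auto split: split_indicator simp: weight_nonneg simp flip: ennreal_mult)
  qed
  also have "\<dots> = ennreal (sphere_area p * (sqrt pi / 2))"
    using sphere_area_pos[OF p]
    by (simp add: nn_integral_cmult nn_integral_gaussian_half_line less_imp_le flip: ennreal_mult)
  finally show ?thesis .
qed

lemma nn_integral_weight_cosh_rem: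
  assumes p: "p > 0"
  shows "(\<integral>\<^sup>+y. ennreal (weight p (sqn p y)) * (\<integral>\<^sup>+x. ennreal (weight p (sqn p x))
      * ennreal (cosh_rem (sqrt (sqn p x) * sqrt (sqn p y))) \<partial>lebesgue_pow p) \<partial>lebesgue_pow p)
    = ennreal ((sphere_area p)\<^sup>2) * rem_const"
proof -
  let ?g = "\<lambda>s r. ennreal (weight p (r\<^sup>2)) * ennreal (cosh_rem (r * s))"
  let ?w = "\<lambda>r. ennreal (sphere_area p * r ^ (p - 1))"
  have inner: "(\<integral>\<^sup>+x. ennreal (weight p (sqn p x)) * ennreal (cosh_rem (sqrt (sqn p x) * s)) \<partial>lebesgue_pow p)
    = (\<integral>\<^sup>+r. ?g s r * ?w r * indicator {0<..} r \<partial>lborel)" for s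
  proof -
    have "(\<integral>\<^sup>+x. ennreal (weight p (sqn p x)) * ennreal (cosh_rem (sqrt (sqn p x) * s)) \<partial>lebesgue_pow p)
      = (\<integral>\<^sup>+x. ?g s (sqrt (sqn p x)) \<partial>lebesgue_pow p)"
      by (simp add: sum_nonneg)
    also have "\<dots> = (\<integral>\<^sup>+r. ?g s r * ?w r * indicator {0<..} r \<partial>lborel)"
      by (rule nn_integral_radial[OF _ p]) measurable
    finally show ?thesis .
  qed
  have "(\<integral>\<^sup>+y. ennreal (weight p (sqn p y)) * (\<integral>\<^sup>+x. ennreal (weight p (sqn p x))
      * ennreal (cosh_rem (sqrt (sqn p x) * sqrt (sqn p y))) \<partial>lebesgue_pow p) \<partial>lebesgue_pow p)
    = (\<integral>\<^sup>+y. (\<lambda>s. ennreal (weight p (s\<^sup>2)) * (\<integral>\<^sup>+r. ?g s r * ?w r * indicator {0<..} r \<partial>lborel))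
        (sqrt (sqn p y)) \<partial>lebesgue_pow p)"
    by (simp add: inner sum_nonneg)
  also have "\<dots> = (\<integral>\<^sup>+s. ennreal (weight p (s\<^sup>2)) * (\<integral>\<^sup>+r. ?g s r * ?w r * indicator {0<..} r \<partial>lborel)
      * ?w s * indicator {0<..} s \<partial>lborel)"
    by (rule nn_integral_radial[OF _ p]) measurable
  also have "\<dots> = (\<integral>\<^sup>+s. \<integral>\<^sup>+r. ennreal ((sphere_area p)\<^sup>2) * (ennreal (exp (- r\<^sup>2 - s\<^sup>2) * cosh_rem (r * s) / (r * s)\<^sup>2)
     * indicator {0<..} r * indicator {0<..} s) \<partial>lborel \<partial>lborel)"
  proof (intro nn_integral_cong)
    fix s :: real
    obtain k where k: "p = Suc k" using p by (cases p) auto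
    have e: "weight p (s\<^sup>2) * (weight p (r\<^sup>2) * cosh_rem (r * s) * (sphere_area p * r ^ (p - Suc 0))) * (sphere_area p * s ^ (p - Suc 0))
        = (sphere_area p)\<^sup>2 * (exp (- r\<^sup>2 - s\<^sup>2) * cosh_rem (r * s)) / (r * s)\<^sup>2" if "r > 0" "s > 0" for r
      using that by (simp add: weight_def k power2_eq_square field_simps exp_diff exp_minus)
    have "ennreal (weight p (s\<^sup>2)) * (\<integral>\<^sup>+r. ?g s r * ?w r * indicator {0<..} r \<partial>lborel) * ?w s * indicator {0<..} s
      = (\<integral>\<^sup>+r. ennreal (weight p (s\<^sup>2)) * (?g s r * ?w r * indicator {0<..} r) * ?w s * indicator {0<..} s \<partial>lborel)"
      by (simp add: nn_integral_cmult nn_integral_multc)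
    also have "\<dots> = (\<integral>\<^sup>+r. ennreal ((sphere_area p)\<^sup>2) * (ennreal (exp (- r\<^sup>2 - s\<^sup>2) * cosh_rem (r * s) / (r * s)\<^sup>2)
     * indicator {0<..} r * indicator {0<..} s) \<partial>lborel)"
      using sphere_area_pos[OF p]
      by (intro nn_integral_cong)
        (auto split: split_indicator simp: weight_nonneg cosh_rem_nonneg e simp flip: ennreal_mult)
    finally show "ennreal (weight p (s\<^sup>2)) * (\<integral>\<^sup>+r. ?g s r * ?w r * indicator {0<..} r \<partial>lborel) * ?w s * indicator {0<..} s
      = (\<integral>\<^sup>+r. ennreal ((sphere_area p)\<^sup>2) * (ennreal (exp (- r\<^sup>2 - s\<^sup>2) * cosh_rem (r * s) / (r * s)\<^sup>2)
     * indicator {0<..} r * indicator {0<..} s) \<partial>lborel)" .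
  qed
  also have "\<dots> = ennreal ((sphere_area p)\<^sup>2) * rem_const"
    by (simp add: rem_const_def nn_integral_cmult)
  finally show ?thesis .
qed

text \<open>Pointwise \<open>\<bar><a, x>\<bar> \<le> |x| sqrt t\<close>, so \<open>cosh_rem_contract\<close> leaves the fourth power of the linear form times a function of
\<open>|x|\<close>. After the fourth-moment identity one factor \<open>|a|\<^sup>2 \<le> t\<close> is given away; the other is kept, since it produces the trace
when \<open>a = A y\<close>, \<open>t = |y|\<^sup>2\<close> is integrated over \<open>y\<close>.\<close>

lemma remainder_inner_bound:
  assumes p: "p > 0" and y: "sqn p a \<le> t" "0 < t"
  shows "of_nat (p * (p + 2)) * (\<integral>\<^sup>+x. ennreal (weight p (sqn p x)) * ennreal (cosh_rem (ip p a x)) \<partial>lebesgue_pow p)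
    \<le> ennreal (3 * sqn p a / t) * (\<integral>\<^sup>+x. ennreal (weight p (sqn p x)) * ennreal (cosh_rem (sqrt (sqn p x) * sqrt t)) \<partial>lebesgue_pow p)"
proof -
  define F where "F q = ennreal (weight p q * cosh_rem (sqrt q * sqrt t) / (q * t)\<^sup>2)" for q
  have [measurable]: "F \<in> borel_measurable borel" unfolding F_def by measurable
  have pt: "ennreal (weight p (sqn p x)) * ennreal (cosh_rem (ip p a x)) \<le> F (sqn p x) * ennreal (ip p a x ^ 4)" for x
  proof (cases "sqn p x = 0")
    case True
    then show ?thesis by (simp add: weight_0)
  next
    case False
    define n where "n = sqrt (sqn p x) * sqrt t"
    have q: "sqn p x > 0" using False by (simp add: less_le sum_nonneg)
    have n: "n > 0" using q y by (simp add: n_def)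
    have n4: "n ^ 4 = (sqn p x * t)\<^sup>2"
    proof -
      have "n ^ 4 = (n\<^sup>2)\<^sup>2" by (simp flip: power_mult)
      then show ?thesis using q y by (simp add: n_def power_mult_distrib)
    qed
    have "(ip p a x)\<^sup>2 \<le> sqn p a * sqn p x"
      using Cauchy_Schwarz_ineq_sum[of a x "{..<p}"] by simp
    also have "\<dots> \<le> t * sqn p x" using y q by (intro mult_right_mono) auto
    also have "\<dots> = n\<^sup>2" using y q by (simp add: n_def power_mult_distrib)
    finally have "\<bar>ip p a x\<bar> \<le> n" using n by (intro power2_le_imp_le[of "\<bar>_\<bar>"]) auto
    then have "\<bar>ip p a x / n\<bar> \<le> 1" using n by simp
    from cosh_rem_contract[OF this, of n] have "cosh_rem (ip p a x) \<le> (ip p a x) ^ 4 / n ^ 4 * cosh_rem n"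
      using n by (simp add: power_divide)
    then have "weight p (sqn p x) * cosh_rem (ip p a x) \<le> weight p (sqn p x) * ((ip p a x) ^ 4 / n ^ 4 * cosh_rem n)"
      using q by (intro mult_left_mono weight_nonneg) auto
    then have "ennreal (weight p (sqn p x)) * ennreal (cosh_rem (ip p a x))
        \<le> ennreal (weight p (sqn p x) * ((ip p a x) ^ 4 / n ^ 4 * cosh_rem n))"
      using q by (simp add: weight_nonneg cosh_rem_nonneg ennreal_leI flip: ennreal_mult)
    also have "\<dots> = ennreal (weight p (sqn p x) * cosh_rem n / n ^ 4 * (ip p a x) ^ 4)"
      by (simp add: mult_ac)
    also have "\<dots> = ennreal (weight p (sqn p x) * cosh_rem n / n ^ 4) * ennreal ((ip p a x) ^ 4)"
      using q n by (intro ennreal_mult) (auto simp: weight_nonneg cosh_rem_nonneg)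
    also have "ennreal (weight p (sqn p x) * cosh_rem n / n ^ 4) = F (sqn p x)"
      by (simp only: F_def n4) (simp only: n_def)
    finally show ?thesis .
  qed
  have "of_nat (p * (p + 2)) * (\<integral>\<^sup>+x. ennreal (weight p (sqn p x)) * ennreal (cosh_rem (ip p a x)) \<partial>lebesgue_pow p)
    \<le> of_nat (p * (p + 2)) * (\<integral>\<^sup>+x. F (sqn p x) * ennreal (ip p a x ^ 4) \<partial>lebesgue_pow p)"
    by (intro mult_left_mono nn_integral_mono pt) auto
  also have "\<dots> = ennreal (3 * (sqn p a)\<^sup>2) * (\<integral>\<^sup>+x. F (sqn p x) * ennreal ((sqn p x)\<^sup>2) \<partial>lebesgue_pow p)"
    by (rule nn_integral_fourth_moment[OF _ p]) measurable
  also have "\<dots> \<le> ennreal (3 * (sqn p a)\<^sup>2) * (\<integral>\<^sup>+x. ennreal (1 / t\<^sup>2) * (ennreal (weight p (sqn p x)) * ennreal (cosh_rem (sqrt (sqn p x) * sqrt t))) \<partial>lebesgue_pow p)"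
  proof (intro mult_left_mono nn_integral_mono)
    fix x
    show "F (sqn p x) * ennreal ((sqn p x)\<^sup>2) \<le> ennreal (1 / t\<^sup>2) * (ennreal (weight p (sqn p x)) * ennreal (cosh_rem (sqrt (sqn p x) * sqrt t)))"
      by (cases "sqn p x = 0")
        (auto simp: F_def weight_0 weight_nonneg cosh_rem_nonneg sum_nonneg power_mult_distrib simp flip: ennreal_mult intro!: ennreal_leI)
  qed simp
  also have "\<dots> = ennreal (3 * (sqn p a)\<^sup>2 / t\<^sup>2) * (\<integral>\<^sup>+x. ennreal (weight p (sqn p x)) * ennreal (cosh_rem (sqrt (sqn p x) * sqrt t)) \<partial>lebesgue_pow p)"
    by (subst nn_integral_cmult) (auto simp: mult.assoc[symmetric] simp flip: ennreal_mult)
  also have "\<dots> \<le> ennreal (3 * sqn p a / t) * (\<integral>\<^sup>+x. ennreal (weight p (sqn p x)) * ennreal (cosh_rem (sqrt (sqn p x) * sqrt t)) \<partial>lebesgue_pow p)"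
  proof (intro mult_right_mono ennreal_leI)
    have "sqn p a * sqn p a \<le> sqn p a * t" using y by (intro mult_left_mono) (auto simp: sum_nonneg)
    then show "3 * (sqn p a)\<^sup>2 / t\<^sup>2 \<le> 3 * sqn p a / t"
      using y by (simp add: field_simps power2_eq_square)
  qed simp
  finally show ?thesis .
qed

text \<open>The quadratic part \<open>E2\<close> is computed by applying the second-moment identity first in \<open>x\<close> and then in \<open>y\<close>. The remainder
\<open>E4\<close> uses the fourth moment in \<open>x\<close> and the second moment in \<open>y\<close>, whence the additional factor \<open>3 / (p + 2)\<close>.\<close>

lemma energy_bounds:
  assumes p: "p > 0" and contr: "\<And>y. sqn p (\<lambda>i. ip p (A i) y) \<le> sqn p y"
  defines "K \<equiv> sphere_area p * (sqrt pi / 2)"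
  shows "ennreal (hs_norm2 p A * K\<^sup>2) \<le> of_nat (p\<^sup>2) * energy p A"
    and "of_nat (p\<^sup>2 * (p + 2)) * energy p A
      \<le> ennreal ((real p + 2) * hs_norm2 p A * K\<^sup>2) + ennreal (3 * hs_norm2 p A * (sphere_area p)\<^sup>2) * rem_const"
proof -
  let ?L = "lebesgue_pow p"
  let ?a = "\<lambda>y i. ip p (A i) y"
  let ?w = "\<lambda>x. ennreal (weight p (sqn p x))"
  have Knn: "0 \<le> K" using sphere_area_pos[OF p] by (simp add: K_def)
  define E2 where "E2 = (\<integral>\<^sup>+y. ?w y * (\<integral>\<^sup>+x. ?w x * ennreal ((ip p (?a y) x)\<^sup>2) \<partial>?L) \<partial>?L)"
  define E4 where "E4 = (\<integral>\<^sup>+y. ?w y * (\<integral>\<^sup>+x. ?w x * ennreal (cosh_rem (ip p (?a y) x)) \<partial>?L) \<partial>?L)"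
  have [measurable]: "(\<lambda>(y, x). ip p (?a y) x) \<in> borel_measurable (?L \<Otimes>\<^sub>M ?L)"
    by measurable
  interpret L: sigma_finite_measure ?L
    by (rule lborel_pow.sigma_finite) simp
  have "energy p A = (\<integral>\<^sup>+y. ?w y * (\<integral>\<^sup>+x. ?w x * ennreal ((1 - exp (- ip p (?a y) x))\<^sup>2) \<partial>?L) \<partial>?L)"
    unfolding energy_def
  proof (intro nn_integral_cong)
    fix y
    have "(\<integral>\<^sup>+x. ennreal (weight p (sqn p x) * weight p (sqn p y) * (1 - exp (- ip p (?a y) x))\<^sup>2) \<partial>?L)
      = (\<integral>\<^sup>+x. ?w y * (?w x * ennreal ((1 - exp (- ip p (?a y) x))\<^sup>2)) \<partial>?L)"
      by (intro nn_integral_cong) (simp add: weight_nonneg sum_nonneg ennreal_mult mult_ac)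
    then show "(\<integral>\<^sup>+x. ennreal (weight p (sqn p x) * weight p (sqn p y) * (1 - exp (- ip p (?a y) x))\<^sup>2) \<partial>?L)
      = ?w y * (\<integral>\<^sup>+x. ?w x * ennreal ((1 - exp (- ip p (?a y) x))\<^sup>2) \<partial>?L)"
      by (simp add: nn_integral_cmult)
  qed
  also have "\<dots> = E2 + E4"
    unfolding E2_def E4_def
    by (subst nn_integral_symmetrise) (auto simp: distrib_left nn_integral_add)
  finally have split: "energy p A = E2 + E4" .
  have K: "(\<integral>\<^sup>+x. ?w x * ennreal (sqn p x) \<partial>?L) = ennreal K"
    using nn_integral_weight_sqn[OF p] by (simp add: K_def)
  have sm: "of_nat p * (\<integral>\<^sup>+x. ?w x * ennreal ((ip p (?a y) x)\<^sup>2) \<partial>?L) = ennreal (sqn p (?a y)) * ennreal K" for y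
    using nn_integral_second_moment[where F = "\<lambda>q. ennreal (weight p q)" and a = "?a y"] by (simp add: K)
  have "of_nat p * E2 = (\<integral>\<^sup>+y. ?w y * (of_nat p * (\<integral>\<^sup>+x. ?w x * ennreal ((ip p (?a y) x)\<^sup>2) \<partial>?L)) \<partial>?L)"
    unfolding E2_def by (subst nn_integral_cmult[symmetric]) (auto simp: mult_ac)
  also have "\<dots> = (\<integral>\<^sup>+y. ennreal K * (?w y * ennreal (sqn p (?a y))) \<partial>?L)"
    by (simp only: sm mult.left_commute[of "ennreal K"] mult.commute[of _ "ennreal K"])
  finally have "of_nat p * E2 = ennreal K * (\<integral>\<^sup>+y. ?w y * ennreal (sqn p (?a y)) \<partial>?L)"
    by (simp add: nn_integral_cmult)
  then have "of_nat p * (of_nat p * E2) = ennreal K * (of_nat p * (\<integral>\<^sup>+y. ?w y * ennreal (sqn p (?a y)) \<partial>?L))"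
    by (simp add: mult_ac)
  also have "\<dots> = ennreal K * (ennreal (hs_norm2 p A) * ennreal K)"
    by (subst nn_integral_second_moment_mat) (auto simp: K)
  finally have E2: "of_nat (p\<^sup>2) * E2 = ennreal (hs_norm2 p A * K\<^sup>2)"
    using Knn hs_norm2_nonneg[of p A] by (simp add: power2_eq_square mult_ac ennreal_mult)
  show "ennreal (hs_norm2 p A * K\<^sup>2) \<le> of_nat (p\<^sup>2) * energy p A"
    unfolding E2[symmetric] split by (intro mult_left_mono) auto
  define H where "H q = (\<integral>\<^sup>+x. ?w x * ennreal (cosh_rem (sqrt (sqn p x) * sqrt q)) \<partial>?L)" for q
  have [measurable]: "H \<in> borel_measurable borel"
    unfolding H_def by measurable
  have "of_nat (p * (p + 2)) * E4 = (\<integral>\<^sup>+y. ?w y * (of_nat (p * (p + 2)) * (\<integral>\<^sup>+x. ?w x * ennreal (cosh_rem (ip p (?a y) x)) \<partial>?L)) \<partial>?L)"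
    unfolding E4_def by (subst nn_integral_cmult[symmetric]) (auto simp: mult_ac)
  also have "\<dots> \<le> (\<integral>\<^sup>+y. 3 * ((?w y * (ennreal (1 / sqn p y) * H (sqn p y))) * ennreal (sqn p (?a y))) \<partial>?L)"
  proof (intro nn_integral_mono)
    fix y
    show "?w y * (of_nat (p * (p + 2)) * (\<integral>\<^sup>+x. ?w x * ennreal (cosh_rem (ip p (?a y) x)) \<partial>?L))
      \<le> 3 * ((?w y * (ennreal (1 / sqn p y) * H (sqn p y))) * ennreal (sqn p (?a y)))"
    proof (cases "sqn p y = 0")
      case True
      then show ?thesis by (simp add: weight_0)
    next
      case False
      then have y: "0 < sqn p y" by (simp add: less_le sum_nonneg)
      have "?w y * (of_nat (p * (p + 2)) * (\<integral>\<^sup>+x. ?w x * ennreal (cosh_rem (ip p (?a y) x)) \<partial>?L))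
        \<le> ?w y * (ennreal (3 * sqn p (?a y) / sqn p y) * H (sqn p y))"
        using remainder_inner_bound[OF p contr[of y] y] unfolding H_def by (intro mult_left_mono) auto
      also have "ennreal (3 * sqn p (?a y) / sqn p y) = 3 * (ennreal (1 / sqn p y) * ennreal (sqn p (?a y)))"
        using y by (simp add: sum_nonneg flip: ennreal_mult ennreal_numeral)
      finally show ?thesis by (simp add: mult_ac)
    qed
  qed
  also have "\<dots> = 3 * (\<integral>\<^sup>+y. (?w y * (ennreal (1 / sqn p y) * H (sqn p y))) * ennreal (sqn p (?a y)) \<partial>?L)"
    by (rule nn_integral_cmult) measurable
  finally have "of_nat p * (of_nat (p * (p + 2)) * E4)
    \<le> 3 * (of_nat p * (\<integral>\<^sup>+y. (?w y * (ennreal (1 / sqn p y) * H (sqn p y))) * ennreal (sqn p (?a y)) \<partial>?L))"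
    by (simp add: mult.left_commute[of 3] mult_left_mono)
  also have "of_nat p * (\<integral>\<^sup>+y. (?w y * (ennreal (1 / sqn p y) * H (sqn p y))) * ennreal (sqn p (?a y)) \<partial>?L)
    = ennreal (hs_norm2 p A) * (\<integral>\<^sup>+y. (?w y * (ennreal (1 / sqn p y) * H (sqn p y))) * ennreal (sqn p y) \<partial>?L)"
    using nn_integral_second_moment_mat[of "\<lambda>q. ennreal (weight p q) * (ennreal (1 / q) * H q)"] by simp
  also have "(\<integral>\<^sup>+y. (?w y * (ennreal (1 / sqn p y) * H (sqn p y))) * ennreal (sqn p y) \<partial>?L)
    = (\<integral>\<^sup>+y. ?w y * H (sqn p y) \<partial>?L)"
  proof (intro nn_integral_cong)
    fix y
    show "(?w y * (ennreal (1 / sqn p y) * H (sqn p y))) * ennreal (sqn p y) = ?w y * H (sqn p y)"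
    proof (cases "sqn p y = 0")
      case True
      then show ?thesis by (simp add: weight_0)
    next
      case False
      then have "ennreal (1 / sqn p y) * ennreal (sqn p y) = 1"
        by (simp add: sum_nonneg flip: ennreal_mult)
      moreover have "(?w y * (ennreal (1 / sqn p y) * H (sqn p y))) * ennreal (sqn p y)
          = (ennreal (1 / sqn p y) * ennreal (sqn p y)) * (?w y * H (sqn p y))"
        by (simp only: mult_ac)
      ultimately show ?thesis by simp
    qed
  qed
  also have "\<dots> = ennreal ((sphere_area p)\<^sup>2) * rem_const"
    unfolding H_def by (rule nn_integral_weight_cosh_rem[OF p])
  finally have "of_nat p * (of_nat (p * (p + 2)) * E4)
    \<le> 3 * (ennreal (hs_norm2 p A) * (ennreal ((sphere_area p)\<^sup>2) * rem_const))" .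
  moreover have "of_nat p * (of_nat (p * (p + 2)) * E4) = of_nat (p\<^sup>2 * (p + 2)) * E4"
    by (simp only: of_nat_mult power2_eq_square mult_ac)
  moreover have "3 * (ennreal (hs_norm2 p A) * (ennreal ((sphere_area p)\<^sup>2) * rem_const))
    = ennreal (3 * hs_norm2 p A * (sphere_area p)\<^sup>2) * rem_const"
    using hs_norm2_nonneg[of p A] by (simp add: ennreal_mult mult.assoc)
  ultimately have E4: "of_nat (p\<^sup>2 * (p + 2)) * E4 \<le> ennreal (3 * hs_norm2 p A * (sphere_area p)\<^sup>2) * rem_const"
    by simp
  have "of_nat (p\<^sup>2 * (p + 2)) * energy p A = of_nat (p + 2) * (of_nat (p\<^sup>2) * E2) + of_nat (p\<^sup>2 * (p + 2)) * E4"
    unfolding split by (simp add: distrib_left distrib_right mult_ac)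
  also have "of_nat (p + 2) * (of_nat (p\<^sup>2) * E2) = ennreal ((real p + 2) * hs_norm2 p A * K\<^sup>2)"
  proof -
    have "of_nat (p + 2) = ennreal (real p + 2)"
      by (simp add: ennreal_of_nat_eq_real_of_nat)
    then show ?thesis
      unfolding E2 using hs_norm2_nonneg[of p A] by (simp only: mult.assoc ennreal_mult mult_nonneg_nonneg zero_le_power2 of_nat_0_le_iff add_nonneg_nonneg zero_le_numeral)
  qed
  finally show "of_nat (p\<^sup>2 * (p + 2)) * energy p A
      \<le> ennreal ((real p + 2) * hs_norm2 p A * K\<^sup>2) + ennreal (3 * hs_norm2 p A * (sphere_area p)\<^sup>2) * rem_const"
    using E4 by (simp add: add_left_mono)
qed

section \<open>Asymptotics in the dimension\<close>

lemma dcov_const_pos: "0 < dcov_const p"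
  by (simp add: dcov_const_def Gamma_real_pos add_pos_nonneg)

lemma vnorm_vec: "vnorm (vec p x) = sqrt (sqn p x)"
  by (simp add: vnorm_def scalar_prod_def power2_eq_square lessThan_atLeast0)

lemma scalar_prod_vec_mat:
  assumes "A \<in> carrier_mat p p"
  shows "vec p x \<bullet> (A *\<^sub>v vec p y) = ip p (\<lambda>i. ip p (\<lambda>j. A $$ (i, j)) y) x"
  using assms by (simp add: scalar_prod_def lessThan_atLeast0 mult.commute)

text \<open>The covariance matrices that standardise \<open>X\<close> and \<open>Y\<close> are \<open>\<Sigma>\<^sub>X\<close> and \<open>\<Sigma>\<^sub>Y\<close>, and the integrand is known from
\<open>joint_char_whitened\<close>.\<close>

lemma aff_dcov_energy:
  assumes P: "gaussian_pair M p X Y SX SXY SY" and SX: "pos_def p SX" and SY: "pos_def p SY"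
  shows "aff_dcov M p p X Y
    = sqrt (enn2real (energy p (\<lambda>i j. whitened_cross_cov SX SXY SY $$ (i, j))) / (dcov_const p)\<^sup>2)"
proof -
  let ?L = "lebesgue_pow p"
  define A where "A = whitened_cross_cov SX SXY SY"
  define a where "a = (\<lambda>i j. A $$ (i, j))"
  have S: "SXY \<in> carrier_mat p p" using P by (simp add: gaussian_pair_def)
  have A: "A \<in> carrier_mat p p" unfolding A_def by (rule Lambda_mat_whitened(2)[OF SX SY S])
  have c: "SX \<in> carrier_mat p p" "SY \<in> carrier_mat p p" using SX SY by (auto simp: pos_def_def)
  have cov: "cov_mat M p X = SX" "cov_mat M p Y = SY"
    using gaussian_pair_cov_mat[OF P pos_def_imp_pos_semidef[OF SX] c(2)]
      gaussian_pair_cov_mat[OF gaussian_pair_swap[OF P] pos_def_imp_pos_semidef[OF SY] c(1)] by auto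
  define F where "F x y = weight p (sqn p x) * weight p (sqn p y) * (1 - exp (- ip p (\<lambda>i. ip p (a i) y) x))\<^sup>2" for x y
  have F_nonneg: "0 \<le> F x y" for x y by (simp add: F_def weight_nonneg sum_nonneg)
  let ?U = "\<lambda>\<omega>. mat_inv_sqrt SX *\<^sub>v X \<omega>" and ?V = "\<lambda>\<omega>. mat_inv_sqrt SY *\<^sub>v Y \<omega>"
  have integrand: "(let s = vec p x; t = vec p y in
          (cmod (joint_char M ?U ?V s t - joint_char M ?U ?V s (0\<^sub>v p) * joint_char M ?U ?V (0\<^sub>v p) t))\<^sup>2
          / (vnorm s ^ (p + 1) * vnorm t ^ (p + 1))) = F x y" for x y
  proof -
    have "vec p z \<bullet> vec p z = sqn p z" for z :: "nat \<Rightarrow> real"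
      by (simp add: scalar_prod_def power2_eq_square lessThan_atLeast0)
    then show ?thesis
      unfolding Let_def joint_char_whitened[OF P SX SY vec_carrier vec_carrier] vnorm_vec
        A_def[symmetric] scalar_prod_vec_mat[OF A]
      by (simp add: F_def weight_def a_def)
  qed
  interpret L: sigma_finite_measure ?L by (rule lborel_pow.sigma_finite) simp
  interpret LL: pair_sigma_finite ?L ?L ..
  have [measurable]: "(\<lambda>(x, y). F x y) \<in> borel_measurable (?L \<Otimes>\<^sub>M ?L)"
    unfolding F_def by measurable
  have "(LINT (x, y)|(?L \<Otimes>\<^sub>M ?L). F x y) = enn2real (\<integral>\<^sup>+z. ennreal (case z of (x, y) \<Rightarrow> F x y) \<partial>(?L \<Otimes>\<^sub>M ?L))"
    by (rule integral_eq_nn_integral) (auto simp: F_nonneg)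
  also have "(\<integral>\<^sup>+z. ennreal (case z of (x, y) \<Rightarrow> F x y) \<partial>(?L \<Otimes>\<^sub>M ?L)) = energy p a"
    unfolding energy_def F_def[symmetric]
    by (subst LL.nn_integral_snd[symmetric]) auto
  finally have int: "(LINT (x, y)|(?L \<Otimes>\<^sub>M ?L). F x y) = enn2real (energy p a)" .
  show ?thesis
    unfolding aff_dcov_def cov dcov_def integrand int by (simp add: a_def A_def power2_eq_square)
qed

text \<open>Log-convexity at the midpoint of \<open>y\<close> and \<open>y + 1\<close>. Used at \<open>p / 2\<close> and at \<open>(p + 1) / 2\<close>, it encloses the
ratio of Gamma values from both sides, sharply enough for its limit.\<close>

lemma Gamma_half_step:
  fixes y :: real
  assumes y: "y > 0"
  shows "(Gamma (y + 1 / 2))\<^sup>2 \<le> y * (Gamma y)\<^sup>2"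
proof -
  have g: "Gamma y > 0" "Gamma (y + 1 / 2) > 0" "Gamma (y + 1) > 0"
    using y by (auto intro!: Gamma_real_pos)
  have "(ln \<circ> Gamma) ((1 - 1 / 2) *\<^sub>R y + (1 / 2) *\<^sub>R (y + 1)) \<le> (1 - 1 / 2) * (ln \<circ> Gamma) y + (1 / 2) * (ln \<circ> Gamma) (y + 1)"
    using y by (intro convex_onD[OF log_convex_Gamma_real]) auto
  also have "(1 - 1 / 2) *\<^sub>R y + (1 / 2) *\<^sub>R (y + 1) = y + 1 / 2" by (simp add: field_simps)
  finally have "ln (Gamma (y + 1 / 2)) \<le> (1 / 2) * ln (Gamma y) + (1 / 2) * ln (Gamma (y + 1))" by simp
  then have "ln ((Gamma (y + 1 / 2))\<^sup>2) \<le> ln (Gamma y * Gamma (y + 1))"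
    using g by (simp add: ln_realpow ln_mult)
  then have "(Gamma (y + 1 / 2))\<^sup>2 \<le> Gamma y * Gamma (y + 1)"
    using g by simp
  also have "Gamma (y + 1) = y * Gamma y" using y by (intro Gamma_plus1) (auto elim!: nonpos_Ints_cases)
  finally show ?thesis by (simp add: power2_eq_square mult_ac)
qed

text \<open>The quadratic part of the energy after division by \<open>c\<^sub>p\<^sup>2\<close> and multiplication by \<open>p / tr \<Lambda>\<close>; nothing of the
distribution is left in it.\<close>

definition quad_part :: "nat \<Rightarrow> real" where
  "quad_part p = (sphere_area p * (sqrt pi / 2) / dcov_const p)\<^sup>2 / real p"

lemma quad_part_Gamma:
  assumes p: "p > 0"
  shows "quad_part p = (Gamma (real p / 2 + 1 / 2) / Gamma (real p / 2))\<^sup>2 / real p"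
proof -
  let ?x = "real p / 2"
  have x: "?x > 0" using p by simp
  have G: "Gamma (?x + 1) = ?x * Gamma ?x" using x by (intro Gamma_plus1) (auto elim!: nonpos_Ints_cases)
  have "sphere_area p = 2 * pi powr ?x / Gamma ?x"
    unfolding sphere_area_def unit_ball_vol_def G using p by simp
  moreover have "pi powr ?x * sqrt pi = pi powr ((real p + 1) / 2)"
    by (simp add: add_divide_distrib powr_add powr_half_sqrt)
  ultimately have "sphere_area p * (sqrt pi / 2) = pi powr ((real p + 1) / 2) / Gamma ?x"
    by simp
  then show ?thesis
    by (simp add: quad_part_def dcov_const_def add_divide_distrib)
qed

lemma quad_part_bounds:
  assumes p: "p > 0"
  shows "real p / (2 * (real p + 1)) \<le> quad_part p" "quad_part p \<le> 1 / 2"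
proof -
  define x where "x = real p / 2"
  have x: "x > 0" "real p = 2 * x" using p by (auto simp: x_def)
  have g: "Gamma x > 0" using x by (intro Gamma_real_pos)
  have r: "quad_part p = (Gamma (x + 1 / 2))\<^sup>2 / (Gamma x)\<^sup>2 / (2 * x)"
    using quad_part_Gamma[OF p] by (simp add: power_divide x_def)
  have "(Gamma (x + 1 / 2))\<^sup>2 / (Gamma x)\<^sup>2 \<le> x"
    using Gamma_half_step[OF x(1)] g by (simp add: field_simps)
  then show "quad_part p \<le> 1 / 2" unfolding r using x by (subst pos_divide_le_eq) auto
  have le: "x\<^sup>2 * (Gamma x)\<^sup>2 \<le> (x + 1 / 2) * (Gamma (x + 1 / 2))\<^sup>2"
  proof -
    have "x + 1 / 2 + 1 / 2 = x + 1" by simp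
    moreover have "Gamma (x + 1) = x * Gamma x"
      using x by (intro Gamma_plus1) (auto elim!: nonpos_Ints_cases)
    ultimately have "Gamma (x + 1 / 2 + 1 / 2) = x * Gamma x" by (simp only:)
    then show ?thesis
      using Gamma_half_step[of "x + 1 / 2"] x by (simp only: power_mult_distrib)
  qed
  have "0 < (Gamma x)\<^sup>2" by (rule zero_less_power[OF g])
  then have "x\<^sup>2 / (x + 1 / 2) \<le> (Gamma (x + 1 / 2))\<^sup>2 / (Gamma x)\<^sup>2"
    using le x by (subst pos_le_divide_eq) (auto simp: divide_le_eq mult_ac)
  then have "x\<^sup>2 / (x + 1 / 2) / (2 * x) \<le> quad_part p"
    unfolding r using x by (intro divide_right_mono) auto
  also have "x\<^sup>2 / (x + 1 / 2) / (2 * x) = real p / (2 * (real p + 1))"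
  proof -
    have "x\<^sup>2 / (x + 1 / 2) / (2 * x) = (x / 2) / (x + 1 / 2)"
      using x by (simp add: power2_eq_square)
    also have "\<dots> = 2 * x / (2 * (2 * x + 1))"
      using x by (subst frac_eq_eq) (auto simp: algebra_simps)
    finally show ?thesis by (simp add: x(2))
  qed
  finally show "real p / (2 * (real p + 1)) \<le> quad_part p" .
qed

lemma quad_part_tendsto: "quad_part \<longlonglongrightarrow> 1 / 2"
proof (rule tendsto_sandwich[OF _ _ _ tendsto_const])
  show "(\<lambda>p. real p / (2 * (real p + 1))) \<longlonglongrightarrow> 1 / 2" by real_asymp
  show "\<forall>\<^sub>F p in sequentially. real p / (2 * (real p + 1)) \<le> quad_part p"
    "\<forall>\<^sub>F p in sequentially. quad_part p \<le> 1 / 2"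
    by (rule eventually_sequentiallyI[of 1], rule quad_part_bounds, simp)+
qed

text \<open>One plus a bound for the remainder relative to the quadratic part; the constant collects the \<open>3\<close> of the fourth moment and the \<open>4 / \<pi>\<close> in
\<open>(sphere_area p)\<^sup>2 = 4 / \<pi> * K\<^sup>2\<close>.\<close>

definition rem_factor :: "nat \<Rightarrow> real" where
  "rem_factor p = 1 + 12 / pi * enn2real rem_const / (real p + 2)"

lemma rem_factor_tendsto: "rem_factor \<longlonglongrightarrow> 1"
  unfolding rem_factor_def by real_asymp

lemma hs_norm2_whitened:
  assumes SX: "pos_def p SX" and SY: "pos_def p SY" and S: "SXY \<in> carrier_mat p p"
  shows "mat_tr (Lambda_mat SX SXY SY) = hs_norm2 p (\<lambda>i j. whitened_cross_cov SX SXY SY $$ (i, j))"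
  using Lambda_mat_whitened[OF SX SY S] by (simp add: mat_tr_transpose_mult_self hs_norm2_def)

text \<open>Bounds that depend on the dimension alone, not on the covariance matrices. This uniformity is what allows the distributions to vary
arbitrarily with \<open>p\<close>.\<close>

lemma scaled_aff_dcov_bounds:
  assumes P: "gaussian_pair M p X Y SX SXY SY" and SX: "pos_def p SX" and SY: "pos_def p SY"
    and p: "p > 0" and T: "0 < mat_tr (Lambda_mat SX SXY SY)"
  defines "R \<equiv> real p / mat_tr (Lambda_mat SX SXY SY) * (aff_dcov M p p X Y)\<^sup>2"
  shows "quad_part p \<le> R" "R \<le> quad_part p * rem_factor p"
proof -
  define A where "A = whitened_cross_cov SX SXY SY"
  define a where "a = (\<lambda>i j. A $$ (i, j))"
  define h where "h = hs_norm2 p a"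
  define \<omega> where "\<omega> = sphere_area p"
  define K where "K = \<omega> * (sqrt pi / 2)"
  define c where "c = dcov_const p"
  define C where "C = enn2real rem_const"
  have S: "SXY \<in> carrier_mat p p" using P by (simp add: gaussian_pair_def)
  have A: "A \<in> carrier_mat p p" unfolding A_def by (rule Lambda_mat_whitened(2)[OF SX SY S])
  have tr: "mat_tr (Lambda_mat SX SXY SY) = h"
    unfolding h_def a_def A_def by (rule hs_norm2_whitened[OF SX SY S])
  then have h: "h > 0" using T by simp
  have c: "c > 0" by (simp add: c_def dcov_const_pos)
  have C: "rem_const = ennreal C" "0 \<le> C" using rem_const_finite by (auto simp: C_def)
  have contr: "sqn p (\<lambda>i. ip p (a i) y) \<le> sqn p y" for y
  proof -
    have "(A *\<^sub>v vec p y) \<bullet> (A *\<^sub>v vec p y) \<le> vec p y \<bullet> vec p y"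
      unfolding A_def by (rule whitened_contraction[OF P SX SY vec_carrier])
    then show ?thesis
      using A by (simp add: scalar_prod_def a_def power2_eq_square lessThan_atLeast0)
  qed
  note B = energy_bounds[OF p contr, folded \<omega>_def h_def, folded K_def]
  have fin: "energy p a < \<infinity>"
  proof (rule ccontr)
    assume "\<not> energy p a < \<infinity>"
    then have "energy p a = \<infinity>" by (simp add: not_less top_unique)
    then have "of_nat (p\<^sup>2 * (p + 2)) * energy p a = \<infinity>"
      using p by (simp add: ennreal_mult_eq_top_iff of_nat_eq_0_iff del: of_nat_mult of_nat_power)
    then show False
      using B(2) rem_const_finite by (auto simp: top_unique ennreal_mult_eq_top_iff)
  qed
  define e where "e = enn2real (energy p a)"
  have e: "energy p a = ennreal e" "0 \<le> e" using fin by (auto simp: e_def)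
  have "ennreal (h * K\<^sup>2) \<le> ennreal (real (p\<^sup>2) * e)"
    using B(1) e by (simp add: ennreal_of_nat_eq_real_of_nat ennreal_mult del: of_nat_power)
  then have lower: "h * K\<^sup>2 \<le> (real p)\<^sup>2 * e" using e by simp
  have "ennreal (real (p\<^sup>2 * (p + 2)) * e) \<le> ennreal ((real p + 2) * h * K\<^sup>2 + 3 * h * \<omega>\<^sup>2 * C)"
    using B(2) e C h by (simp add: ennreal_of_nat_eq_real_of_nat ennreal_mult del: of_nat_power of_nat_mult of_nat_add)
  then have upper: "(real p)\<^sup>2 * (real p + 2) * e \<le> (real p + 2) * h * K\<^sup>2 + 3 * h * \<omega>\<^sup>2 * C"
    using C h by (subst (asm) ennreal_le_iff) (auto simp: algebra_simps)
  have R: "R = real p / h * (e / c\<^sup>2)"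
    unfolding R_def tr aff_dcov_energy[OF P SX SY] using e by (simp add: e_def a_def A_def c_def)
  have rt: "quad_part p = K\<^sup>2 / c\<^sup>2 / real p"
    by (simp add: quad_part_def K_def \<omega>_def c_def power_divide)
  have w: "\<omega>\<^sup>2 = 4 / pi * K\<^sup>2" by (simp add: K_def power_mult_distrib power_divide)
  have fac: "0 < h * c\<^sup>2 * real p" using h c p by simp
  have "R * (h * c\<^sup>2 * real p) = (real p)\<^sup>2 * e" "quad_part p * (h * c\<^sup>2 * real p) = h * K\<^sup>2"
    unfolding R rt using h c p by (auto simp: power2_eq_square)
  then have "quad_part p * (h * c\<^sup>2 * real p) \<le> R * (h * c\<^sup>2 * real p)" using lower by (simp only:)
  then show "quad_part p \<le> R" using fac by (simp add: mult_le_cancel_right_pos)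
  have "R * (h * c\<^sup>2 * real p) * (real p + 2) \<le> (quad_part p * rem_factor p) * (h * c\<^sup>2 * real p) * (real p + 2)"
  proof -
    have "R * (h * c\<^sup>2 * real p) * (real p + 2) = (real p)\<^sup>2 * (real p + 2) * e"
      unfolding R using h c p by (simp add: power2_eq_square)
    also note upper
    also have "(real p + 2) * h * K\<^sup>2 + 3 * h * \<omega>\<^sup>2 * C = (h * K\<^sup>2) * ((real p + 2) + 12 / pi * C)"
      unfolding w by (simp add: algebra_simps)
    also have "(real p + 2) + 12 / pi * C = rem_factor p * (real p + 2)"
      by (simp add: rem_factor_def C_def distrib_right add_nonneg_eq_0_iff)
    also have "h * K\<^sup>2 = quad_part p * (h * c\<^sup>2 * real p)" unfolding rt using c p by simp
    finally show ?thesis by (simp add: mult_ac)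
  qed
  then have "R * (h * c\<^sup>2 * real p * (real p + 2)) \<le> (quad_part p * rem_factor p) * (h * c\<^sup>2 * real p * (real p + 2))"
    by (simp only: mult.assoc)
  moreover have "0 < h * c\<^sup>2 * real p * (real p + 2)" by (rule mult_pos_pos[OF fac]) simp
  ultimately show "R \<le> quad_part p * rem_factor p" by (simp only: mult_le_cancel_right_pos)
qed

text \<open>Here \<open>\<Lambda>\<close> is the identity matrix, with trace \<open>p\<close>.\<close>

lemma aff_dcov_self_bounds:
  assumes P: "gaussian_pair M p X X SX SX SX" and SX: "pos_def p SX" and p: "p > 0"
  shows "quad_part p \<le> (aff_dcov M p p X X)\<^sup>2" "(aff_dcov M p p X X)\<^sup>2 \<le> quad_part p * rem_factor p"
proof -
  have c: "SX \<in> carrier_mat p p" using SX by (simp add: pos_def_def)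
  have "whitened_cross_cov SX SX SX = 1\<^sub>m p"
    using mat_inv_sqrt_pos_def(3)[OF SX] by (simp add: whitened_cross_cov_def)
  then have tr: "mat_tr (Lambda_mat SX SX SX) = real p"
    using Lambda_mat_whitened(1)[OF SX SX c] by (simp add: mat_tr_def)
  show "quad_part p \<le> (aff_dcov M p p X X)\<^sup>2" "(aff_dcov M p p X X)\<^sup>2 \<le> quad_part p * rem_factor p"
    using scaled_aff_dcov_bounds[OF P SX SX p] p by (simp_all add: tr)
qed

lemma Lambda_mat_trace_pos:
  assumes SX: "pos_def p SX" and SY: "pos_def p SY" and S: "SXY \<in> carrier_mat p p"
    and nz: "Lambda_mat SX SXY SY \<noteq> 0\<^sub>m p p"
  shows "0 < mat_tr (Lambda_mat SX SXY SY)"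
proof (rule ccontr)
  let ?A = "whitened_cross_cov SX SXY SY"
  note A = Lambda_mat_whitened[OF SX SY S]
  assume "\<not> 0 < mat_tr (Lambda_mat SX SXY SY)"
  then have "(\<Sum>i<p. \<Sum>j<p. (?A $$ (i, j))\<^sup>2) = 0"
    unfolding A(1) mat_tr_transpose_mult_self[OF A(2)] by (simp add: not_less sum_nonneg antisym)
  then have "?A $$ (i, j) = 0" if "i < p" "j < p" for i j
    using that by (simp add: sum_nonneg_eq_0_iff sum_nonneg)
  then have "?A = 0\<^sub>m p p" using A(2) by (intro eq_matI) auto
  then show False using nz unfolding A(1) by simp
qed


theorem theorem4p2:
  fixes M :: "nat \<Rightarrow> 'a measure"
    and X Y :: "nat \<Rightarrow> 'a \<Rightarrow> real vec"
    and \<mu> :: "nat \<Rightarrow> real vec"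
    and SX SXY SY :: "nat \<Rightarrow> real mat"
  assumes "\<And>p. p \<ge> 1 \<Longrightarrow> prob_space (M p)"
    and "\<And>p. p \<ge> 1 \<Longrightarrow> random_vec (M p) p (X p)"
    and "\<And>p. p \<ge> 1 \<Longrightarrow> random_vec (M p) p (Y p)"
    and "\<And>p. p \<ge> 1 \<Longrightarrow> SXY p \<in> carrier_mat p p"
    and "\<And>p. p \<ge> 1 \<Longrightarrow> pos_def p (SX p)"
    and "\<And>p. p \<ge> 1 \<Longrightarrow> pos_def p (SY p)"
    and "\<And>p. p \<ge> 1 \<Longrightarrow> mv_normal (M p) (2 * p) (\<lambda>\<omega>. X p \<omega> @\<^sub>v Y p \<omega>) (\<mu> p)
           (four_block_mat (SX p) (SXY p) (transpose_mat (SXY p)) (SY p))"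
    and "\<And>p. p \<ge> 1 \<Longrightarrow> Lambda_mat (SX p) (SXY p) (SY p) \<noteq> 0\<^sub>m p p"
  shows "((\<lambda>p. real p / mat_tr (Lambda_mat (SX p) (SXY p) (SY p))
             * (aff_dcov (M p) p p (X p) (Y p))\<^sup>2) \<longlonglongrightarrow> 1 / 2) \<and>
         ((\<lambda>p. real p / mat_tr (Lambda_mat (SX p) (SXY p) (SY p))
             * (aff_dcor (M p) p p (X p) (Y p))\<^sup>2) \<longlonglongrightarrow> 1)"
proof
  define V where "V p = aff_dcov (M p) p p (X p) (Y p)" for p
  define VX where "VX p = aff_dcov (M p) p p (X p) (X p)" for p
  define VY where "VY p = aff_dcov (M p) p p (Y p) (Y p)" for p
  define q where "q p = real p / mat_tr (Lambda_mat (SX p) (SXY p) (SY p))" for p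
  have pair: "gaussian_pair (M p) p (X p) (Y p) (SX p) (SXY p) (SY p)" if "p \<ge> 1" for p
    using assms(2-7)[OF that] by (intro mv_normal_gaussian_pair) (auto simp: pos_def_def)
  have diag: "gaussian_pair (M p) p (X p) (X p) (SX p) (SX p) (SX p)"
    "gaussian_pair (M p) p (Y p) (Y p) (SY p) (SY p) (SY p)" if "p \<ge> 1" for p
    using gaussian_pair_diag[OF pair[OF that]] gaussian_pair_diag[OF gaussian_pair_swap[OF pair[OF that]]]
      assms(5,6)[OF that] pos_def_imp_pos_semidef by (auto simp: pos_def_def)
  have bounds: "quad_part p \<le> q p * (V p)\<^sup>2" "q p * (V p)\<^sup>2 \<le> quad_part p * rem_factor p"
    "quad_part p \<le> (VX p)\<^sup>2" "(VX p)\<^sup>2 \<le> quad_part p * rem_factor p"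
    "quad_part p \<le> (VY p)\<^sup>2" "(VY p)\<^sup>2 \<le> quad_part p * rem_factor p" if "p \<ge> 1" for p
    using scaled_aff_dcov_bounds[OF pair[OF that] assms(5,6)[OF that]]
      Lambda_mat_trace_pos[OF assms(5,6,4,8)[OF that]]
      aff_dcov_self_bounds[OF diag(1)[OF that] assms(5)[OF that]]
      aff_dcov_self_bounds[OF diag(2)[OF that] assms(6)[OF that]] that
    by (auto simp: V_def VX_def VY_def q_def)
  have squeeze: "f \<longlonglongrightarrow> 1 / 2"
    if "\<And>p. p \<ge> 1 \<Longrightarrow> quad_part p \<le> f p" "\<And>p. p \<ge> 1 \<Longrightarrow> f p \<le> quad_part p * rem_factor p" for f
  proof (rule tendsto_sandwich[OF _ _ quad_part_tendsto])
    show "(\<lambda>p. quad_part p * rem_factor p) \<longlonglongrightarrow> 1 / 2"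
      using tendsto_mult[OF quad_part_tendsto rem_factor_tendsto] by simp
  qed (use that in \<open>auto intro!: eventually_sequentiallyI[of 1]\<close>)
  have lim: "(\<lambda>p. q p * (V p)\<^sup>2) \<longlonglongrightarrow> 1 / 2" "(\<lambda>p. (VX p)\<^sup>2) \<longlonglongrightarrow> 1 / 2" "(\<lambda>p. (VY p)\<^sup>2) \<longlonglongrightarrow> 1 / 2"
    using bounds by (auto intro!: squeeze)
  then show "(\<lambda>p. real p / mat_tr (Lambda_mat (SX p) (SXY p) (SY p)) * (aff_dcov (M p) p p (X p) (Y p))\<^sup>2) \<longlonglongrightarrow> 1 / 2"
    by (simp add: V_def q_def)
  have pos: "VX p > 0" "VY p > 0" if "p \<ge> 1" for p
  proof -
    have "0 < real p / (2 * (real p + 1))" using that by simp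
    then have "0 < quad_part p" using quad_part_bounds(1)[of p] that by linarith
    then have "VX p \<noteq> 0" "VY p \<noteq> 0" using bounds(3,5)[OF that] by auto
    moreover have "0 \<le> VX p" "0 \<le> VY p"
      using aff_dcov_energy[OF diag(1)[OF that] assms(5,5)[OF that]]
        aff_dcov_energy[OF diag(2)[OF that] assms(6,6)[OF that]] by (simp_all add: VX_def VY_def)
    ultimately show "VX p > 0" "VY p > 0" by auto
  qed
  have "(\<lambda>p. q p * (V p)\<^sup>2 / sqrt ((VX p)\<^sup>2 * (VY p)\<^sup>2)) \<longlonglongrightarrow> (1 / 2) / sqrt (1 / 2 * (1 / 2))"
    by (intro tendsto_divide tendsto_real_sqrt tendsto_mult lim) simp
  also have "(1 / 2) / sqrt (1 / 2 * (1 / 2)) = (1 :: real)"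
    by (simp add: real_sqrt_divide)
  finally have "(\<lambda>p. q p * (V p)\<^sup>2 / sqrt ((VX p)\<^sup>2 * (VY p)\<^sup>2)) \<longlonglongrightarrow> 1" .
  moreover have "\<forall>\<^sub>F p in sequentially. q p * (V p)\<^sup>2 / sqrt ((VX p)\<^sup>2 * (VY p)\<^sup>2)
      = real p / mat_tr (Lambda_mat (SX p) (SXY p) (SY p)) * (aff_dcor (M p) p p (X p) (Y p))\<^sup>2"
    using eventually_ge_at_top[of 1]
  proof eventually_elim
    case (elim p)
    note pos = pos[OF elim]
    have "aff_dcor (M p) p p (X p) (Y p) = V p / sqrt (VX p * VY p)"
      using pos by (simp add: aff_dcor_def V_def VX_def VY_def)
    then show ?case
      using pos by (simp add: power_divide real_sqrt_mult power_mult_distrib q_def)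
  qed
  ultimately show "(\<lambda>p. real p / mat_tr (Lambda_mat (SX p) (SXY p) (SY p)) * (aff_dcor (M p) p p (X p) (Y p))\<^sup>2) \<longlonglongrightarrow> 1"
    by (rule Lim_transform_eventually)
qed

end
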